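(* Let $n,r,k,t$ be positive integers with $r\ge 3$, $k\ge t+1$ and $n\ge 4k+6$. Let $\mathcal F_1,\dots,\mathcal F_r\subseteq\genfrac{[}{]}{0pt}{}{V}{k}$ be non-empty $r$-cross $t$-intersecting families with $\dim\big(\bigcap_{F\in\mathcal F_i}F\big)<t$ for every $i\in\{1,\dots,r\}$, such that $|\mathcal F_1||\mathcal F_2|\cdots|\mathcal F_r|$ is maximum among all non-empty $r$-cross $t$-intersecting families $\mathcal F_1',\dots,\mathcal F_r'\subseteq\genfrac{[}{]}{0pt}{}{V}{k}$ with $\dim\big(\bigcap_{F\in\mathcal F_i'}F\big)<t$ for every $i$. Then $r\le k-t+1$, and: (i) If $k>2t+2r-3$, then there exist $M\in\genfrac{[}{]}{0pt}{}{V}{k+1}$ and $T\in\genfrac{[}{]}{0pt}{}{M}{t+r-2}$ such that for every $i\in\{1,\dots,r\}$, $\mathcal F_i=\{F\in\genfrac{[}{]}{0pt}{}{V}{k}: T\subseteq F,\ \dim(F\cap M)\ge t+r-1\}\cup\{F\in\genfrac{[}{]}{0pt}{}{M}{k}: T\not\subseteq F\}$. (ii) If $k\le 2t+2r-3$, then there exists $Z\in\genfrac{[}{]}{0pt}{}{V}{t+r}$ such that for every $i\in\{1,\dots,r\}$, $\mathcal F_i=\{F\in\genfrac{[}{]}{0pt}{}{V}{k}: \dim(F\cap Z)\ge t+r-1\}$.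
   Context: Let $q$ be a prime power and $V$ an $n$-dimensional vector space over the finite field $\mathbb F_q$. For a subspace $W$ of $V$ and an integer $j$, $\genfrac{[}{]}{0pt}{}{W}{j}$ denotes the set of all $j$-dimensional subspaces of $W$. Families $\mathcal F_1,\dots,\mathcal F_r\subseteq\genfrac{[}{]}{0pt}{}{V}{k}$ are $r$-cross $t$-intersecting if $\dim(F_1\cap F_2\cap\cdots\cap F_r)\ge t$ for all choices $F_i\in\mathcal F_i$, $i=1,\dots,r$. *)

theory Defs
  imports Complex_Main
begin

definition dim_subspaces ::
    "('a::field \<Rightarrow> 'b::ab_group_add \<Rightarrow> 'b) \<Rightarrow> 'b set \<Rightarrow> nat \<Rightarrow> 'b set set" where
  "dim_subspaces scale W j =
     {U. module.subspace scale U \<and> U \<subseteq> W \<and> vector_space.dim scale U = j}"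

definition cross_intersecting ::
    "('a::field \<Rightarrow> 'b::ab_group_add \<Rightarrow> 'b) \<Rightarrow> nat \<Rightarrow> nat \<Rightarrow> (nat \<Rightarrow> 'b set set) \<Rightarrow> bool" where
  "cross_intersecting scale r t \<F> \<longleftrightarrow>
     (\<forall>F. (\<forall>i\<in>{1..r}. F i \<in> \<F> i) \<longrightarrow> t \<le> vector_space.dim scale (\<Inter>i\<in>{1..r}. F i))"

text \<open>The tuples of families over which the product of sizes is maximized. The ambient space is
  the whole type, and only the values of \<open>\<F>\<close> on the indices \<open>1, \<dots>, r\<close> matter.\<close>

definition nontrivial_cross_families ::
    "('a::field \<Rightarrow> 'b::ab_group_add \<Rightarrow> 'b) \<Rightarrow> nat \<Rightarrow> nat \<Rightarrow> nat \<Rightarrow> (nat \<Rightarrow> 'b set set) \<Rightarrow> bool" where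
  "nontrivial_cross_families scale r k t \<F> \<longleftrightarrow>
     (\<forall>i\<in>{1..r}. \<F> i \<subseteq> dim_subspaces scale UNIV k \<and> \<F> i \<noteq> {} \<and>
        vector_space.dim scale (\<Inter>F\<in>\<F> i. F) < t) \<and>
     cross_intersecting scale r t \<F>"

end

theory Submission
  imports Defs
begin

text \<open>
  Put \<open>s = t + r - 2\<close>. If \<open>j\<close> of the \<open>r\<close> families had members intersecting in a space of dimension
  below \<open>t + r - j\<close>, then by downward induction on \<open>j\<close> this space would lie in all members of a further
  family, against non-triviality. Hence any two of the families are cross \<open>s\<close>-intersecting and
  \<open>k \<ge> s + 1\<close>. The theorem then follows from a sharp bound \<open>|\<F>||\<G>| \<le> h\<^sup>2\<close> for pairs, because
  three or more numbers with pairwise products at most \<open>h\<^sup>2\<close> and total product at least \<open>h\<^sup>r\<close>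
  are all equal to \<open>h\<close>.

  For a pair, let \<open>a\<close> and \<open>b\<close> be the least dimensions of spaces meeting all members of \<open>\<F>\<close>, respectively
  \<open>\<G>\<close>, in dimension \<open>s\<close>. Counting members of \<open>\<F>\<close> through chains of subspaces bounds \<open>|\<F>||\<G>|\<close> by a
  quantity that drops by a factor \<open>q\<^bsup>2k+4\<^esup>\<close> as soon as \<open>a\<close> or \<open>b\<close> exceeds \<open>s + 1\<close>; here
  \<open>n \<ge> 4k + 6\<close> enters. If \<open>a = b = s + 1\<close>, then up to a negligible error \<open>|\<F>||\<G>|\<close> is governed by
  \<open>|A||B|\<close>, where \<open>A\<close> and \<open>B\<close> are the sets of \<open>(s+1)\<close>-dimensional covers. These cross-intersect in
  dimension \<open>s\<close>, and the product is largest exactly when both are the hyperplanes of one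
  \<open>(s+2)\<close>-space, or both are maximal stars around the same \<open>s\<close>-space.
  In the star case a pair may still use two different \<open>(k+1)\<close>-spaces; a third family forces them to agree.
\<close>

section \<open>Gaussian numbers and subspace counts\<close>

text \<open>The constant in \<open>n \<ge> 4 * k + 6\<close> has this origin. Let N be the number of
  k-spaces above an (s+1)-space. Raising the dimension of a minimal cover by one multiplies the
  number of choices by at most q^(k+2) and divides the number of k-spaces above the cover by at
  least q^(n-k). At dimension s+1 the bound is estimated by q^(k+2) N for each of the two families,
  and this loss is made up for by a single raise if n - k is at least 3(k+2). The argument needs the
  covers of both families to cross-intersect as well. This is guaranteed once one family consists of
  all k-spaces meeting the other in dimension s. Passing to this closure is harmless for an upper
  bound, and in the case of equality it adds no member. The value h need not be known exactly. As
  |A||B| is an integer, any value below the maximum [m]^2 costs at least N^2, where [m] is the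
  largest size of a clique of covers. The members without a small cover and the defect of h^2
  against [m]^2 N^2 together amount to less than that.\<close>

locale gaussian =
  fixes q :: nat
  assumes q_ge_2: "q \<ge> 2"
begin

text \<open>The Gaussian number (q^a - 1)/(q - 1); written as a sum it stays in the natural
  numbers.\<close>

definition qnum :: "nat \<Rightarrow> nat" where "qnum a = (\<Sum>i<a. q ^ i)"

text \<open>The Gaussian binomial coefficient through its absorption rule, which is the recursion
  that double counting gives in \<open>card_between\<close>. Real values make the quotient exact
  without a divisibility proof.\<close>

fun qbinom :: "nat \<Rightarrow> nat \<Rightarrow> real" where
  "qbinom d 0 = 1"
| "qbinom 0 (Suc e) = 0"
| "qbinom (Suc d) (Suc e) = qnum (Suc d) / qnum (Suc e) * qbinom d e"

lemma qnum_0 [simp]: "qnum 0 = 0" and qnum_1 [simp]: "qnum (Suc 0) = 1"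
  by (simp_all add: qnum_def)

lemma qnum_Suc: "qnum (Suc a) = qnum a + q ^ a"
  by (simp add: qnum_def)

lemma qnum_Suc': "qnum (Suc a) = 1 + q * qnum a"
  unfolding qnum_def by (subst sum.lessThan_Suc_shift) (simp add: sum_distrib_left)

lemma qnum_eq: "(q - 1) * qnum a + 1 = q ^ a"
proof (induction a)
  case (Suc a)
  have "(q - 1) * qnum (Suc a) + 1 = (q - 1) * q ^ a + ((q - 1) * qnum a + 1)"
    by (simp add: qnum_Suc algebra_simps)
  also have "\<dots> = (q - 1 + 1) * q ^ a" by (simp only: Suc) (simp add: algebra_simps)
  also have "q - 1 + 1 = q" using q_ge_2 by simp
  finally show ?case by simp
qed simp

lemma qnum_less: "qnum a < q ^ a"
proof -
  have "1 * qnum a \<le> (q - 1) * qnum a" using q_ge_2 by (intro mult_right_mono) auto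
  thus ?thesis using qnum_eq[of a] by linarith
qed

lemma qnum_ge: "q ^ a \<le> qnum (Suc a)"
  by (simp add: qnum_Suc)

lemma qnum_strict_mono: "a < b \<Longrightarrow> qnum a < qnum b"
proof (induction b)
  case (Suc b)
  have "qnum b < qnum (Suc b)" using q_ge_2 by (simp add: qnum_Suc)
  thus ?case using Suc by (cases "a = b") auto
qed simp

lemma qnum_mono: "a \<le> b \<Longrightarrow> qnum a \<le> qnum b"
  using qnum_strict_mono by (cases "a = b") (auto simp: le_less)

lemma qnum_inject: "qnum a = qnum b \<longleftrightarrow> a = b"
  by (metis qnum_strict_mono linorder_neqE_nat less_irrefl)

lemma qnum_pos: "a > 0 \<Longrightarrow> qnum a > 0"
  using qnum_strict_mono[of 0 a] by simp

text \<open>The exponents below \<open>a\<close>, shifted by \<open>b - a\<close>, stay below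
  \<open>b\<close>. The gain in \<open>num_above_Suc\<close> comes from here.\<close>

lemma qnum_shift: assumes "a \<le> b" shows "qnum a * q ^ (b - a) \<le> qnum b"
proof -
  have "qnum a * q ^ (b - a) = (\<Sum>i\<in>{..<a}. q ^ (i + (b - a)))"
    by (simp add: qnum_def sum_distrib_right power_add)
  also have "\<dots> = (\<Sum>i\<in>(\<lambda>i. i + (b - a)) ` {..<a}. q ^ i)"
    by (subst sum.reindex) auto
  also have "\<dots> \<le> qnum b" unfolding qnum_def
    using assms by (intro sum_mono2) auto
  finally show ?thesis .
qed

lemma qbinom_nonneg [simp]: "qbinom d e \<ge> 0"
  by (induction d e rule: qbinom.induct) auto

lemma qbinom_1 [simp]: "qbinom d (Suc 0) = qnum d"
  by (cases d) auto

lemma qbinom_rec: "qbinom (Suc d) (Suc e) * qnum (Suc e) = qnum (Suc d) * qbinom d e"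
  using qnum_pos[of "Suc e"] by simp

lemma qbinom_Suc_self: "qbinom (Suc d) d = qnum (Suc d)"
proof (induction d)
  case (Suc d)
  thus ?case using qnum_pos[of "Suc d"] by simp
qed simp

text \<open>Companion of the absorption rule with fixed lower index, for comparing
  \<open>qbinom a s\<close> with \<open>qbinom (Suc a) s\<close>.\<close>

lemma qbinom_Suc_left: "e \<le> d \<Longrightarrow> qbinom (Suc d) e * qnum (Suc d - e) = qnum (Suc d) * qbinom d e"
proof (induction d e rule: qbinom.induct)
  case (3 d e)
  have "qbinom (Suc (Suc d)) (Suc e) * qnum (Suc (Suc d) - Suc e)
    = qnum (Suc (Suc d)) / qnum (Suc e) * (qbinom (Suc d) e * qnum (Suc d - e))" by simp
  also have "\<dots> = qnum (Suc (Suc d)) / qnum (Suc e) * (qnum (Suc d) * qbinom d e)"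
    using 3 by simp
  also have "\<dots> = qnum (Suc (Suc d)) * qbinom (Suc d) (Suc e)" by simp
  finally show ?case .
qed auto

lemma qbinom_2: "qbinom (Suc d) 2 * (q + 1) = qnum (Suc d) * qnum d"
  using qbinom_rec[of d 1] by (simp add: qnum_Suc numeral_2_eq_2 algebra_simps)

end

(* The parameter q names the field size: a locale constant depending on the type of scalars only
   would carry an additional type argument. *)
locale finite_vector_space = finite_dimensional_vector_space scale Basis + gaussian q
  for scale :: "'a::{field,finite} \<Rightarrow> 'b::ab_group_add \<Rightarrow> 'b" and Basis and q +
  assumes q_eq: "q = card (UNIV :: 'a set)"
begin

definition join :: "'b set \<Rightarrow> 'b set \<Rightarrow> 'b set" where "join A B = span (A \<union> B)"

definition between :: "'b set \<Rightarrow> 'b set \<Rightarrow> nat \<Rightarrow> 'b set set" where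
  "between U W j = {K. subspace K \<and> U \<subseteq> K \<and> K \<subseteq> W \<and> dim K = j}"

lemma finite_UNIV_vec: "finite (UNIV :: 'b set)"
proof -
  have "finite (span B)" if "finite B" for B :: "'b set"
    using that
  proof (induction B)
    case (insert x B)
    have "span (insert x B) \<subseteq> (\<lambda>(c, y). scale c x + y) ` (UNIV \<times> span B)"
    proof
      fix y assume "y \<in> span (insert x B)"
      then obtain c where "y - scale c x \<in> span B" by (auto simp: span_breakdown_eq)
      thus "y \<in> (\<lambda>(c, y). scale c x + y) ` (UNIV \<times> span B)"
        by (intro image_eqI[of _ _ "(c, y - scale c x)"]) auto
    qed
    moreover have "finite \<dots>" using insert by auto
    ultimately show ?case by (rule finite_subset)
  qed simp
  from this[OF finite_Basis] show ?thesis by (simp only: span_Basis)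
qed

lemma finite_vec [simp]: "finite (X :: 'b set)"
  using finite_UNIV_vec by (rule finite_subset[rotated]) simp

lemma finite_vec_sets [simp]: "finite (X :: 'b set set)"
  by (rule finite_subset[of X "Pow UNIV", OF _ finite_Pow_iff[THEN iffD2, OF finite_UNIV_vec]]) simp

lemma card_span_insert:
  assumes "x \<notin> span B" shows "card (span (insert x B)) = q * card (span B)"
proof -
  let ?f = "\<lambda>(c, y). scale c x + y"
  have inj: "inj_on ?f (UNIV \<times> span B)"
  proof (rule inj_onI, clarsimp)
    fix c y c' y' assume y: "y \<in> span B" "y' \<in> span B" and e: "scale c x + y = scale c' x + y'"
    hence "scale (c - c') x = y' - y" by (simp add: algebra_simps)
    hence i: "scale (c - c') x \<in> span B" using y by (simp add: span_diff)
    have "c = c'"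
    proof (rule ccontr)
      assume "c \<noteq> c'"
      with i have "x \<in> span B" using span_scale[OF i, of "inverse (c - c')"] by simp
      with assms show False by simp
    qed
    with e show "c = c' \<and> y = y'" by simp
  qed
  have "span (insert x B) = ?f ` (UNIV \<times> span B)"
  proof (intro subset_antisym subsetI)
    fix y assume "y \<in> span (insert x B)"
    then obtain c where "y - scale c x \<in> span B" by (auto simp: span_breakdown_eq)
    thus "y \<in> ?f ` (UNIV \<times> span B)" by (intro image_eqI[of _ _ "(c, y - scale c x)"]) auto
  next
    fix y assume "y \<in> ?f ` (UNIV \<times> span B)"
    then obtain c z where "y = scale c x + z" "z \<in> span B" by auto
    thus "y \<in> span (insert x B)" by (auto simp: span_breakdown_eq intro!: exI[of _ c])
  qed
  hence "card (span (insert x B)) = card (UNIV \<times> span B :: ('a \<times> 'b) set)"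
    using card_image[OF inj] by simp
  thus ?thesis by (simp add: q_eq)
qed

lemma card_subspace: assumes "subspace W" shows "card W = q ^ dim W"
proof -
  have *: "independent B \<Longrightarrow> card (span B) = q ^ card B" if "finite B" for B
    using that
    by (induction B) (auto simp: independent_insert card_span_insert)
  obtain B where B: "B \<subseteq> W" "independent B" "W \<subseteq> span B" "card B = dim W"
    using basis_exists by blast
  hence "span B = W" using assms by (simp add: span_minimal subset_antisym)
  thus ?thesis using * B finiteI_independent by metis
qed

lemma subspace_join [simp, intro]: "subspace (join A B)"
  by (simp add: join_def)

lemma join_upper [simp, intro]: "A \<subseteq> join A B" "B \<subseteq> join A B"
  by (auto simp: join_def intro: span_base)

lemma join_upperI: "x \<in> A \<Longrightarrow> x \<in> join A B" "x \<in> B \<Longrightarrow> x \<in> join A B"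
  using join_upper by blast+

lemma join_least: "subspace W \<Longrightarrow> A \<subseteq> W \<Longrightarrow> B \<subseteq> W \<Longrightarrow> join A B \<subseteq> W"
  unfolding join_def by (intro span_minimal) auto

lemma dim_join:
  assumes "subspace A" "subspace B"
  shows "dim (join A B) + dim (A \<inter> B) = dim A + dim B"
proof -
  have "join A B = {x + y |x y. x \<in> A \<and> y \<in> B}"
    using assms unfolding join_def span_Un by (simp add: span_eq_iff[THEN iffD2])
  thus ?thesis using dim_sums_Int[OF assms] by simp
qed

lemma dim_join_singleton: "subspace A \<Longrightarrow> v \<notin> A \<Longrightarrow> dim (join A {v}) = Suc (dim A)"
  unfolding join_def using dim_insert[of v A] by (simp add: span_eq_iff[THEN iffD2])

lemma subspace_Int [simp, intro]: "subspace A \<Longrightarrow> subspace B \<Longrightarrow> subspace (A \<inter> B)"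
  by (rule subspace_inter)

lemma subspace_eqI: "subspace A \<Longrightarrow> subspace B \<Longrightarrow> A \<subseteq> B \<Longrightarrow> dim B \<le> dim A \<Longrightarrow> A = B"
  by (rule subspace_dim_equal)

lemma dim_less: "subspace A \<Longrightarrow> subspace B \<Longrightarrow> A \<subset> B \<Longrightarrow> dim A < dim B"
  by (metis dim_subset not_le psubset_imp_subset subspace_eqI psubset_eq)

lemma dim_Int_lower:
  assumes "subspace A" "subspace B" "subspace W" "A \<subseteq> W" "B \<subseteq> W"
  shows "dim A + dim B \<le> dim W + dim (A \<inter> B)"
  using dim_join[of A B] dim_subset[OF join_least[of W A B]] assms by simp

lemma join_eq_between:
  assumes "subspace U" "K \<in> between U W (Suc (dim U))" "v \<in> K" "v \<notin> U"
  shows "join U {v} = K"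
proof (rule subspace_eqI)
  show "join U {v} \<subseteq> K" using assms by (intro join_least) (auto simp: between_def)
qed (use assms in \<open>auto simp: between_def dim_join_singleton\<close>)

text \<open>The sets \<open>K - U\<close> partition \<open>W - U\<close>, because a vector
  \<open>v\<close> outside \<open>U\<close> determines \<open>K\<close> as
  \<open>join U {v}\<close>. Each of them has \<open>q ^ dim U * (q - 1)\<close> elements.\<close>

lemma card_between_Suc:
  assumes U: "subspace U" and W: "subspace W" and UW: "U \<subseteq> W"
  shows "card (between U W (Suc (dim U))) = qnum (dim W - dim U)"
proof -
  let ?B = "between U W (Suc (dim U))"
  have dUW: "dim U \<le> dim W" using UW by (rule dim_subset)
  have W_eq: "W - U = (\<Union>K\<in>?B. K - U)"
  proof -
    have "v \<in> (\<Union>K\<in>?B. K - U)" if "v \<in> W" "v \<notin> U" for v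
    proof -
      have "join U {v} \<subseteq> W" using that assms by (intro join_least) auto
      hence "join U {v} \<in> ?B" using that assms by (simp add: between_def dim_join_singleton)
      moreover have "v \<in> join U {v}" by (simp add: join_upperI)
      ultimately show ?thesis using that by (intro UN_I[of "join U {v}"]) auto
    qed
    thus ?thesis unfolding between_def by blast
  qed
  have disj: "(K - U) \<inter> (K' - U) = {}" if "K \<in> ?B" "K' \<in> ?B" "K \<noteq> K'" for K K'
    using join_eq_between[OF U] that by blast
  have "card (W - U) = (\<Sum>K\<in>?B. card (K - U))"
    unfolding W_eq by (intro card_UN_disjoint) (use disj in auto)
  also have "\<dots> = (\<Sum>K\<in>?B. q ^ Suc (dim U) - q ^ dim U)"
    by (intro sum.cong) (auto simp: between_def card_Diff_subset card_subspace U)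
  finally have "q ^ dim W - q ^ dim U = card ?B * (q ^ Suc (dim U) - q ^ dim U)"
    using U W UW by (simp add: card_Diff_subset card_subspace)
  moreover have "q ^ Suc (dim U) - q ^ dim U = q ^ dim U * (q - 1)"
    by (simp add: algebra_simps)
  moreover have "q ^ dim W - q ^ dim U = q ^ dim U * (q - 1) * qnum (dim W - dim U)"
  proof -
    have "q ^ dim W = q ^ dim U * q ^ (dim W - dim U)"
      using dUW by (simp flip: power_add)
    also have "\<dots> = q ^ dim U * ((q - 1) * qnum (dim W - dim U) + 1)" by (simp only: qnum_eq)
    finally show ?thesis by (simp add: algebra_simps)
  qed
  ultimately have "q ^ dim U * (q - 1) * qnum (dim W - dim U) = q ^ dim U * (q - 1) * card ?B"
    by (simp add: ac_simps)
  thus ?thesis using q_ge_2 by simp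
qed

text \<open>Double counting of pairs \<open>L \<subseteq> K\<close>, where \<open>L\<close> lies one
  dimension above \<open>U\<close>, reproduces the absorption rule.\<close>

lemma card_between:
  assumes "subspace U" "subspace W" "U \<subseteq> W" "dim U \<le> j"
  shows "real (card (between U W j)) = qbinom (dim W - dim U) (j - dim U)"
  using assms
proof (induction "j - dim U" arbitrary: U)
  case 0
  hence j: "j = dim U" by simp
  have "K = U" if "K \<in> between U W j" for K
    using that 0(2) subspace_eqI[of U K] by (simp add: between_def j)
  moreover have "U \<in> between U W j" using 0(2-4) by (simp add: between_def j)
  ultimately have "between U W j = {U}" by blast
  thus ?case using 0 by simp
next
  case (Suc e)
  let ?L = "between U W (Suc (dim U))"
  have e: "j - dim U = Suc e" using Suc by simp
  have "card (between U W j) * qnum (Suc e) = (\<Sum>K\<in>between U W j. card {L\<in>?L. L \<subseteq> K})"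
  proof -
    have "card {L\<in>?L. L \<subseteq> K} = qnum (Suc e)" if "K \<in> between U W j" for K
    proof -
      have "{L\<in>?L. L \<subseteq> K} = between U K (Suc (dim U))" using that by (auto simp: between_def)
      moreover have "subspace K" "U \<subseteq> K" "dim K = j" using that by (auto simp: between_def)
      ultimately show ?thesis using card_between_Suc[of U K] Suc.prems(1) e by simp
    qed
    thus ?thesis by simp
  qed
  also have "\<dots> = (\<Sum>L\<in>?L. card {K\<in>between U W j. L \<subseteq> K})"
    using sum.swap_restrict[of "between U W j" ?L "\<lambda>_ _. 1::nat" "\<lambda>K L. L \<subseteq> K"]
    by (simp only: finite_vec_sets card_eq_sum)
  finally have 1: "real (card (between U W j) * qnum (Suc e)) =
      (\<Sum>L\<in>?L. real (card {K\<in>between U W j. L \<subseteq> K}))" by simp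
  have "real (card {K\<in>between U W j. L \<subseteq> K}) = qbinom (dim W - Suc (dim U)) e" if "L \<in> ?L" for L
  proof -
    have "{K\<in>between U W j. L \<subseteq> K} = between L W j" using that by (auto simp: between_def)
    moreover have "subspace L" "L \<subseteq> W" "dim L = Suc (dim U)" using that by (auto simp: between_def)
    moreover have "e = j - Suc (dim U)" "Suc (dim U) \<le> j" using e by auto
    ultimately show ?thesis using Suc.hyps(1)[of L] Suc.prems(2) by simp
  qed
  with 1 have 2: "real (card (between U W j)) * qnum (Suc e) =
      qnum (dim W - dim U) * qbinom (dim W - Suc (dim U)) e"
    using card_between_Suc[of U W] Suc by simp
  show ?case
  proof (cases "dim W - dim U")
    case 0
    with 2 show ?thesis using e qnum_pos[of "Suc e"] by simp
  next
    case d: (Suc d)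
    hence "dim W - Suc (dim U) = d" by simp
    with 2 d have "real (card (between U W j)) * qnum (Suc e) = qbinom (Suc d) (Suc e) * qnum (Suc e)"
      by (simp only: qbinom_rec)
    moreover have "real (qnum (Suc e)) \<noteq> 0" using qnum_pos[of "Suc e"] by simp
    ultimately show ?thesis unfolding d e by (simp only: mult_cancel_right) blast
  qed
qed

lemma card_hyperplanes:
  assumes "subspace U" "subspace W" "U \<subseteq> W" "dim W = Suc d" "dim U \<le> d"
  shows "card (between U W d) = qnum (Suc d - dim U)"
proof -
  have "real (card (between U W d)) = qbinom (Suc d - dim U) (d - dim U)"
    using card_between[of U W d] assms by simp
  also have "\<dots> = qnum (Suc d - dim U)"
    using qbinom_Suc_self[of "d - dim U"] assms by (simp add: Suc_diff_le)
  finally show ?thesis by simp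
qed

text \<open>A vector outside \<open>join K X\<close> can be added to \<open>K\<close> without
  enlarging \<open>K \<inter> X\<close>. The last hypothesis says that \<open>W\<close> has room for
  \<open>k - dim T\<close> such steps.\<close>

lemma exists_extension_avoiding:
  assumes "subspace T" "subspace X" "subspace W" "T \<subseteq> W" "X \<subseteq> W"
    and "dim T \<le> k" "dim (join T X) + k \<le> dim W + dim T"
  obtains K where "subspace K" "T \<subseteq> K" "K \<subseteq> W" "dim K = k" "K \<inter> X = T \<inter> X"
proof -
  have "\<exists>K. subspace K \<and> T \<subseteq> K \<and> K \<subseteq> W \<and> dim K = k \<and> K \<inter> X = T \<inter> X"
    using assms
  proof (induction k)
    case 0
    thus ?case by (intro exI[of _ T]) auto
  next
    case (Suc k)
    show ?case
    proof (cases "dim T = Suc k")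
      case True
      thus ?thesis using Suc.prems by (intro exI[of _ T]) auto
    next
      case False
      then obtain K where K: "subspace K" "T \<subseteq> K" "K \<subseteq> W" "dim K = k" "K \<inter> X = T \<inter> X"
        using Suc by auto
      have "dim (join K X) < dim W"
        using dim_join[of K X] dim_join[of T X] K Suc.prems by simp
      then obtain v where v: "v \<in> W" "v \<notin> join K X"
        using dim_subset[of W "join K X"] by auto
      have vK: "v \<notin> K" using v by (auto simp: join_upperI)
      have "join K {v} \<inter> X \<subseteq> T \<inter> X"
      proof
        fix x assume x: "x \<in> join K {v} \<inter> X"
        have "join K {v} = span (insert v K)" by (simp add: join_def)
        then obtain c where c: "x - scale c v \<in> span K" using x by (auto simp: span_breakdown_eq)
        hence c': "x - scale c v \<in> K" using K by (simp add: span_eq_iff[THEN iffD2])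
        have "c = 0"
        proof (rule ccontr)
          assume "c \<noteq> 0"
          have "x - (x - scale c v) \<in> join K X"
            using x c' by (intro subspace_diff[OF subspace_join] join_upperI) auto
          hence "scale c v \<in> join K X" by simp
          hence "scale (inverse c) (scale c v) \<in> join K X"
            by (rule subspace_scale[OF subspace_join])
          moreover have "scale (inverse c) (scale c v) = v"
            using \<open>c \<noteq> 0\<close> by simp
          ultimately show False using v by simp
        qed
        with c' K x show "x \<in> T \<inter> X" by auto
      qed
      moreover have "T \<subseteq> join K {v}" using K(2) join_upper(1) by (rule subset_trans)
      moreover have "join K {v} \<subseteq> W" using K v Suc.prems by (intro join_least) auto
      ultimately show ?thesis using K v vK Suc.prems
        by (intro exI[of _ "join K {v}"]) (auto simp: dim_join_singleton)
    qed
  qed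
  thus ?thesis using that by auto
qed

lemma exists_between:
  assumes "subspace U" "subspace W" "U \<subseteq> W" "dim U \<le> j" "j \<le> dim W"
  obtains K where "K \<in> between U W j"
proof -
  \<comment> \<open>With \<open>X = U\<close> the avoidance condition is void.\<close>
  have "join U U = U" using assms by (simp add: join_def span_eq_iff[THEN iffD2])
  then show thesis
    using exists_extension_avoiding[of U U W j] assms that by (auto simp: between_def)
qed


abbreviation subs :: "nat \<Rightarrow> 'b set set" where "subs j \<equiv> {K. subspace K \<and> dim K = j}"

section \<open>Covers\<close>

definition meets :: "nat \<Rightarrow> 'b set \<Rightarrow> 'b set set \<Rightarrow> bool" where
  "meets s T \<G> \<longleftrightarrow> (\<forall>G\<in>\<G>. s \<le> dim (T \<inter> G))"

(* The case distinction avoids truncated subtraction: for u > j no j-space contains a u-space. *)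
definition num_above :: "nat \<Rightarrow> nat \<Rightarrow> real" where
  "num_above j u = (if u \<le> j then qbinom (dim (UNIV :: 'b set) - u) (j - u) else 0)"

lemma num_above_nonneg [simp]: "num_above j u \<ge> 0"
  by (simp add: num_above_def)

lemma card_above:
  assumes "subspace U"
  shows "real (card {K \<in> subs j. U \<subseteq> K}) = num_above j (dim U)"
proof (cases "dim U \<le> j")
  case True
  have "{K \<in> subs j. U \<subseteq> K} = between U UNIV j" by (auto simp: between_def)
  thus ?thesis using card_between[of U UNIV j] assms True by (simp add: num_above_def del: dim_UNIV)
next
  case False
  hence "{K \<in> subs j. U \<subseteq> K} = {}" using dim_subset by fastforce
  thus ?thesis using False by (simp only: num_above_def) simp
qed

text \<open>With n the dimension of the whole space, the quotient of the two counts is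
  \<open>qnum (n - u) / qnum (j - u)\<close> by the absorption rule.\<close>

lemma num_above_Suc:
  assumes "j \<le> dim (UNIV :: 'b set)"
  shows "num_above j (Suc u) * q ^ (dim (UNIV :: 'b set) - j) \<le> num_above j u"
proof (cases "Suc u \<le> j")
  case True
  define d e where "d = dim (UNIV :: 'b set) - Suc u" and "e = j - Suc u"
  have eqs: "dim (UNIV :: 'b set) - u = Suc d" "j - u = Suc e" "dim (UNIV :: 'b set) - j = Suc d - Suc e"
    using True assms by (auto simp: d_def e_def simp del: dim_UNIV)
  have "Suc e \<le> Suc d" using True assms by (simp add: d_def e_def del: dim_UNIV)
  from qnum_shift[OF this]
  have "real (qnum (Suc e)) * q ^ (Suc d - Suc e) \<le> qnum (Suc d)"
    by (simp only: of_nat_mult[symmetric] of_nat_power[symmetric] of_nat_le_iff)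
  hence "real (qnum (Suc e)) * q ^ (Suc d - Suc e) * qbinom d e \<le> qnum (Suc d) * qbinom d e"
    by (rule mult_right_mono) simp
  also have "\<dots> = qbinom (Suc d) (Suc e) * qnum (Suc e)" by (simp only: qbinom_rec)
  finally have "qnum (Suc e) * (qbinom d e * q ^ (Suc d - Suc e)) \<le> qnum (Suc e) * qbinom (Suc d) (Suc e)"
    by (simp only: ac_simps)
  hence "qbinom d e * q ^ (Suc d - Suc e) \<le> qbinom (Suc d) (Suc e)"
    using qnum_pos[of "Suc e"] by (subst (asm) mult_le_cancel_left_pos) simp_all
  thus ?thesis using True unfolding num_above_def eqs d_def[symmetric] e_def[symmetric]
    by (simp del: qbinom.simps)
qed (simp add: num_above_def)

lemma num_above_self [simp]: "num_above j j = 1"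
  by (simp add: num_above_def)

text \<open>An \<open>F\<close> above \<open>U\<close> that meets \<open>G\<close> in dimension
  \<open>s\<close> contains a vector of \<open>G\<close> outside \<open>U\<close>, hence one of the
  extensions of \<open>U\<close> by such vectors. Extending only by a smaller subspace of
  \<open>G\<close> makes the count independent of \<open>dim (U \<inter> G)\<close>.\<close>

lemma extension_family:
  assumes U: "subspace U" and G: "subspace G" and lt: "dim (U \<inter> G) < s" and s: "s \<le> dim G"
  shows "\<exists>\<U>. card \<U> \<le> qnum (Suc (dim G) - s) \<and>
    (\<forall>U'\<in>\<U>. subspace U' \<and> U \<subseteq> U' \<and> dim U' = Suc (dim U)) \<and>
    (\<forall>F. subspace F \<and> U \<subseteq> F \<and> s \<le> dim (F \<inter> G) \<longrightarrow> (\<exists>U'\<in>\<U>. U' \<subseteq> F))"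
proof -
  define c where "c = dim (U \<inter> G)"
  (* G' has just the codimension in G for which every F in question meets G' outside U. *)
  obtain G' where G': "subspace G'" "U \<inter> G \<subseteq> G'" "G' \<subseteq> G" "dim G' = dim G - s + c + 1"
  proof -
    have "c \<le> dim G - s + c + 1" "dim G - s + c + 1 \<le> dim G" using lt s by (auto simp: c_def)
    then obtain G' where "G' \<in> between (U \<inter> G) G (dim G - s + c + 1)"
      using exists_between[of "U \<inter> G" G "dim G - s + c + 1"] U G unfolding c_def by blast
    thus thesis using that unfolding between_def by blast
  qed
  have UG': "U \<inter> G' = U \<inter> G" using G' by auto
  define \<U> where "\<U> = between U (join U G') (Suc (dim U))"
  have dj: "dim (join U G') - dim U = Suc (dim G) - s"
    using dim_join[OF U G'(1)] s unfolding UG' c_def[symmetric] G'(4) by simp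
  show ?thesis
  proof (intro exI[of _ \<U>] conjI ballI allI impI; (elim conjE)?)
    show "card \<U> \<le> qnum (Suc (dim G) - s)"
      unfolding \<U>_def using card_between_Suc[of U "join U G'"] U dj by simp
    show "subspace U'" "U \<subseteq> U'" "dim U' = Suc (dim U)" if "U' \<in> \<U>" for U'
      using that by (simp_all add: \<U>_def between_def)
    show "\<exists>U'\<in>\<U>. U' \<subseteq> F" if F: "subspace F" "U \<subseteq> F" "s \<le> dim (F \<inter> G)" for F
    proof -
      \<comment> \<open>Inside \<open>G\<close> the two spaces overlap in dimension at least
        \<open>s + dim G' - dim G = c + 1\<close>, one more than \<open>U \<inter> G\<close>
        has.\<close>
      have "dim (F \<inter> G) + dim G' \<le> dim G + dim (F \<inter> G \<inter> G')"
        using G' G F by (intro dim_Int_lower) auto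
      also have "F \<inter> G \<inter> G' = F \<inter> G'" using G' by auto
      finally have "dim (F \<inter> G') > dim (U \<inter> G')"
        using lt s F(3) unfolding UG' c_def[symmetric] G'(4) by linarith
      hence "\<not> F \<inter> G' \<subseteq> U \<inter> G'" using dim_subset[of "F \<inter> G'" "U \<inter> G'"] by linarith
      then obtain v where v: "v \<in> F" "v \<in> G'" "v \<notin> U" by blast
      have "join U {v} \<subseteq> join U G'" by (rule join_least) (use v in \<open>simp_all add: join_upperI\<close>)
      moreover have "join U {v} \<subseteq> F" using F v by (intro join_least) simp_all
      ultimately show ?thesis using U v
        by (intro bexI[of _ "join U {v}"]) (simp_all add: \<U>_def between_def dim_join_singleton)
    qed
  qed
qed

text \<open>Branching: as long as \<open>U\<close> is not a cover, some \<open>G\<close> forces one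
  of at most \<open>qnum (Suc k - s)\<close> extensions, and this repeats until dimension
  \<open>b\<close>. Absence of covers is asked only inside members of \<open>\<A>\<close>, so that
  the lemma also applies to the members containing no small cover.\<close>

lemma card_above_le:
  assumes A: "\<A> \<subseteq> subs j" and G: "\<G> \<subseteq> subs k" and "s \<le> k"
    and cross: "\<And>F. F \<in> \<A> \<Longrightarrow> meets s F \<G>"
    and noc: "\<And>F U. F \<in> \<A> \<Longrightarrow> subspace U \<Longrightarrow> U \<subseteq> F \<Longrightarrow> dim U < b \<Longrightarrow> \<not> meets s U \<G>"
    and U: "subspace U" "dim U \<le> b"
  shows "real (card {F\<in>\<A>. U \<subseteq> F}) \<le> qnum (Suc k - s) ^ (b - dim U) * num_above j b"
  using U
proof (induction "b - dim U" arbitrary: U)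
  case 0
  hence b: "b = dim U" by linarith
  have "card {F\<in>\<A>. U \<subseteq> F} \<le> card {F\<in>subs j. U \<subseteq> F}"
    using A by (intro card_mono) auto
  thus ?case using card_above[OF 0(2), of j] by (simp add: b)
next
  case (Suc e)
  let ?K = "qnum (Suc k - s)"
  show ?case
  proof (cases "{F\<in>\<A>. U \<subseteq> F} = {}")
    case False
    then obtain F where "F \<in> \<A>" "U \<subseteq> F" by auto
    moreover have "dim U < b" using Suc.hyps(2) by linarith
    ultimately have "\<not> meets s U \<G>" using noc Suc.prems(1) by blast
    then obtain G where G0: "G \<in> \<G>" "dim (U \<inter> G) < s" by (auto simp: meets_def not_le)
    have dG: "subspace G" "dim G = k" using G G0(1) by blast+
    have "s \<le> dim G" using dG \<open>s \<le> k\<close> by simp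
    obtain \<U> where \<U>: "card \<U> \<le> ?K"
      "\<forall>U'\<in>\<U>. subspace U' \<and> U \<subseteq> U' \<and> dim U' = Suc (dim U)"
      "\<forall>F. subspace F \<and> U \<subseteq> F \<and> s \<le> dim (F \<inter> G) \<longrightarrow> (\<exists>U'\<in>\<U>. U' \<subseteq> F)"
      using extension_family[OF Suc.prems(1) dG(1) G0(2) \<open>s \<le> dim G\<close>]
      unfolding dG(2) by (elim exE conjE)
    have "{F\<in>\<A>. U \<subseteq> F} \<subseteq> (\<Union>U'\<in>\<U>. {F\<in>\<A>. U' \<subseteq> F})"
    proof
      fix F assume F: "F \<in> {F\<in>\<A>. U \<subseteq> F}"
      hence "subspace F" "s \<le> dim (F \<inter> G)" using A cross[of F] G0(1) by (auto simp: meets_def)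
      with \<U>(3) F show "F \<in> (\<Union>U'\<in>\<U>. {F\<in>\<A>. U' \<subseteq> F})" by simp
    qed
    hence "card {F\<in>\<A>. U \<subseteq> F} \<le> card (\<Union>U'\<in>\<U>. {F\<in>\<A>. U' \<subseteq> F})"
      by (intro card_mono) auto
    also have "\<dots> \<le> (\<Sum>U'\<in>\<U>. card {F\<in>\<A>. U' \<subseteq> F})" by (rule card_UN_le) simp
    finally have "real (card {F\<in>\<A>. U \<subseteq> F}) \<le> (\<Sum>U'\<in>\<U>. real (card {F\<in>\<A>. U' \<subseteq> F}))"
      by (simp flip: of_nat_sum)
    also have "\<dots> \<le> (\<Sum>U'\<in>\<U>. ?K ^ e * num_above j b)"
    proof (rule sum_mono)
      fix U' assume "U' \<in> \<U>"
      with \<U>(2) have U': "subspace U'" "dim U' = Suc (dim U)" by blast+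
      have "e = b - dim U'" "dim U' \<le> b" unfolding U'(2) using Suc.hyps(2) by linarith+
      with Suc.hyps(1)[of U'] U'(1) show "real (card {F\<in>\<A>. U' \<subseteq> F}) \<le> ?K ^ e * num_above j b" by simp
    qed
    also have "\<dots> = card \<U> * (?K ^ e * num_above j b)" by simp
    also have "\<dots> \<le> ?K * (?K ^ e * num_above j b)" using \<U>(1) by (intro mult_right_mono) auto
    also have "\<dots> = ?K ^ (b - dim U) * num_above j b" unfolding Suc.hyps(2)[symmetric] by simp
    finally show ?thesis .
  next
    case True
    show ?thesis unfolding True by simp
  qed
qed

text \<open>Every member contains an \<open>s\<close>-subspace of \<open>T\<close>; the branching
  starts from each of these.\<close>

lemma card_le_by_cover:
  assumes A: "\<A> \<subseteq> subs j" and G: "\<G> \<subseteq> subs k" and "s \<le> k"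
    and cross: "\<And>F. F \<in> \<A> \<Longrightarrow> meets s F \<G>"
    and noc: "\<And>F U. F \<in> \<A> \<Longrightarrow> subspace U \<Longrightarrow> U \<subseteq> F \<Longrightarrow> dim U < b \<Longrightarrow> \<not> meets s U \<G>"
    and T: "subspace T" "meets s T \<A>" and "s \<le> b"
  shows "real (card \<A>) \<le> qbinom (dim T) s * qnum (Suc k - s) ^ (b - s) * num_above j b"
proof -
  let ?K = "qnum (Suc k - s)" and ?S = "between {0} T s"
  have "\<exists>U\<in>?S. U \<subseteq> F" if "F \<in> \<A>" for F
  proof -
    have F: "subspace F" "s \<le> dim (T \<inter> F)" using that A T by (auto simp: meets_def)
    then obtain U where "U \<in> between {0} (T \<inter> F) s"
      using exists_between[of "{0}" "T \<inter> F" s] T by (auto simp: subspace_0)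
    thus ?thesis by (intro bexI[of _ U]) (auto simp: between_def)
  qed
  hence "\<A> \<subseteq> (\<Union>U\<in>?S. {F\<in>\<A>. U \<subseteq> F})" by blast
  hence "card \<A> \<le> card (\<Union>U\<in>?S. {F\<in>\<A>. U \<subseteq> F})" by (intro card_mono) auto
  also have "\<dots> \<le> (\<Sum>U\<in>?S. card {F\<in>\<A>. U \<subseteq> F})" by (rule card_UN_le) simp
  finally have "real (card \<A>) \<le> (\<Sum>U\<in>?S. real (card {F\<in>\<A>. U \<subseteq> F}))"
    by (simp flip: of_nat_sum)
  also have "\<dots> \<le> (\<Sum>U\<in>?S. ?K ^ (b - s) * num_above j b)"
  proof (rule sum_mono)
    fix U assume "U \<in> ?S"
    hence "subspace U" "dim U = s" by (auto simp: between_def)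
    thus "real (card {F\<in>\<A>. U \<subseteq> F}) \<le> ?K ^ (b - s) * num_above j b"
      using card_above_le[of \<A> j \<G> k s b U] assms by simp
  qed
  also have "\<dots> = qbinom (dim T) s * (?K ^ (b - s) * num_above j b)"
    using card_between[of "{0}" T s] T by (simp add: subspace_0)
  finally show ?thesis by (simp add: mult.assoc)
qed

text \<open>The binomial grows by at most \<open>q ^ (s + 1)\<close> and the additional branching
  factor is at most \<open>q ^ (Suc k - s)\<close>; together they give
  \<open>q ^ (k + 2)\<close>.\<close>

lemma cover_bound_decreasing:
  assumes "s \<le> a" "s \<le> k" "k \<le> dim (UNIV :: 'b set)"
  shows "qbinom (Suc a) s * qnum (Suc k - s) ^ (Suc a - s) * num_above k (Suc a) * q ^ (dim (UNIV :: 'b set) - k)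
    \<le> q ^ (k + 2) * (qbinom a s * qnum (Suc k - s) ^ (a - s) * num_above k a)"
proof -
  let ?K = "qnum (Suc k - s)" and ?n = "dim (UNIV :: 'b set)"
  have qp: "real q > 0" using q_ge_2 by simp
  have "qbinom (Suc a) s * q ^ (a - s) \<le> qbinom (Suc a) s * qnum (Suc a - s)"
    using qnum_ge[of "a - s"] assms by (intro mult_left_mono) (simp_all add: Suc_diff_le flip: of_nat_power)
  also have "\<dots> = qnum (Suc a) * qbinom a s" using assms by (simp only: qbinom_Suc_left)
  also have "\<dots> \<le> q ^ Suc a * qbinom a s"
    using qnum_less[of "Suc a"] by (intro mult_right_mono) (simp_all only: qbinom_nonneg of_nat_le_iff less_imp_le)
  also have "\<dots> = q ^ (s + 1) * qbinom a s * q ^ (a - s)"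
    using assms by (simp add: field_simps flip: power_add)
  finally have 1: "qbinom (Suc a) s \<le> q ^ (s + 1) * qbinom a s"
    using qp by (subst (asm) mult_le_cancel_right_pos) simp_all
  have 2: "real ?K \<le> q ^ (Suc k - s)"
    using qnum_less[of "Suc k - s"] by (simp only: of_nat_le_iff less_imp_le)
  have 3: "num_above k (Suc a) * q ^ (?n - k) \<le> num_above k a" using assms by (intro num_above_Suc)
  have "qbinom (Suc a) s * ?K ^ (Suc a - s) * num_above k (Suc a) * q ^ (?n - k)
    = qbinom (Suc a) s * (?K * (?K ^ (a - s) * (num_above k (Suc a) * q ^ (?n - k))))"
    using assms by (simp add: Suc_diff_le)
  also have "\<dots> \<le> (q ^ (s + 1) * qbinom a s) * (q ^ (Suc k - s) * (?K ^ (a - s) * num_above k a))"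
    by (intro mult_mono 1 2 3 mult_left_mono mult_nonneg_nonneg) auto
  also have "\<dots> = (q ^ (s + 1) * q ^ (Suc k - s)) * (qbinom a s * ?K ^ (a - s) * num_above k a)"
    by (simp only: of_nat_mult ac_simps)
  also have "q ^ (s + 1) * q ^ (Suc k - s) = q ^ (k + 2)"
    using assms by (simp flip: power_add)
  finally show ?thesis .
qed

end

section \<open>Cross-intersecting sets of covers\<close>

text \<open>Points of a grid that pairwise agree in a coordinate all lie on one line of the grid: a
  point off the line through \<open>x\<close> and \<open>y\<close> cannot share its other coordinate
  with both.\<close>

lemma card_le_if_share_coordinate:
  assumes "finite P" "finite Q" "card P \<le> d" "card Q \<le> d" "X \<subseteq> P \<times> Q"
    and share: "\<And>x y. x \<in> X \<Longrightarrow> y \<in> X \<Longrightarrow> fst x = fst y \<or> snd x = snd y"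
  shows "card X \<le> d"
proof -
  have "inj_on fst X \<or> inj_on snd X"
  proof (rule ccontr)
    assume "\<not> ?thesis"
    then obtain x y z w where xy: "x \<in> X" "y \<in> X" "fst x = fst y" "x \<noteq> y"
      and zw: "z \<in> X" "w \<in> X" "snd z = snd w" "z \<noteq> w" unfolding inj_on_def by blast
    have "snd x \<noteq> snd y" "fst z \<noteq> fst w" using xy zw by (metis prod.expand)+
    then obtain u where "u \<in> X" "fst u \<noteq> fst x" using zw by metis
    with share[of u x] share[of u y] xy \<open>snd x \<noteq> snd y\<close> show False by metis
  qed
  thus ?thesis
  proof
    assume "inj_on fst X"
    moreover have "fst ` X \<subseteq> P" using assms(5) by auto
    ultimately have "card X \<le> card P" using assms(1) by (intro card_inj_on_le)
    thus ?thesis using assms(3) by simp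
  next
    assume "inj_on snd X"
    moreover have "snd ` X \<subseteq> Q" using assms(5) by auto
    ultimately have "card X \<le> card Q" using assms(2) by (intro card_inj_on_le)
    thus ?thesis using assms(4) by simp
  qed
qed

context finite_vector_space
begin

text \<open>The dimension condition forces \<open>T\<close> to be the join of \<open>P\<close> and
  \<open>Q\<close>.\<close>

lemma spanned_subset:
  assumes "subspace T" "subspace P" "subspace Q" "P \<subseteq> T" "Q \<subseteq> T"
    and "dim T + dim (P \<inter> Q) \<le> dim P + dim Q" and "subspace Z" "P \<subseteq> Z" "Q \<subseteq> Z"
  shows "T \<subseteq> Z"
proof -
  have "join P Q = T"
    using assms dim_join[of P Q] by (intro subspace_eqI join_least subspace_join) auto
  thus ?thesis using join_least assms by blast
qed

lemma dim_Int_less: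
  assumes "subspace A" "subspace B" "\<not> A \<subseteq> B" shows "dim (A \<inter> B) < dim A"
  using assms by (intro dim_less) auto

lemma subset_if_dim_Int:
  assumes "subspace A" "subspace B" "dim A \<le> dim (A \<inter> B)" shows "A \<subseteq> B"
  using assms dim_Int_less[of A B] by linarith

lemma dim_Int_eqI:
  assumes "T \<in> subs (Suc s)" "T' \<in> subs (Suc s)" "s \<le> dim (T \<inter> T')" "T \<noteq> T'"
  shows "dim (T \<inter> T') = s"
proof -
  have "\<not> T \<subseteq> T'" using assms subspace_eqI[of T T'] by auto
  hence "dim (T \<inter> T') < dim T" using assms by (intro dim_Int_less) auto
  thus ?thesis using assms by simp
qed

definition clique :: "nat \<Rightarrow> 'b set set \<Rightarrow> bool" where
  "clique s \<A> \<longleftrightarrow> (\<forall>T\<in>\<A>. \<forall>T'\<in>\<A>. s \<le> dim (T \<inter> T'))"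

text \<open>The traces of \<open>T\<close> on \<open>T1\<close> and \<open>T2\<close> have dimension
  at least \<open>s\<close> and overlap in less than \<open>s\<close>, so they span
  \<open>T\<close>.\<close>

lemma contains_or_contained:
  assumes T1: "T1 \<in> subs (Suc s)" and T2: "T2 \<in> subs (Suc s)" and d: "dim (T1 \<inter> T2) = s"
    and T: "T \<in> subs (Suc s)" "s \<le> dim (T \<inter> T1)" "s \<le> dim (T \<inter> T2)"
    and nsub: "\<not> T1 \<inter> T2 \<subseteq> T"
  shows "T \<subseteq> join T1 T2"
proof -
  have eq: "(T \<inter> T1) \<inter> (T \<inter> T2) = T1 \<inter> T2 \<inter> T" by auto
  have "dim (T1 \<inter> T2 \<inter> T) < dim (T1 \<inter> T2)"
    using T1 T2 T nsub by (intro dim_Int_less) auto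
  hence "dim T + dim ((T \<inter> T1) \<inter> (T \<inter> T2)) \<le> dim (T \<inter> T1) + dim (T \<inter> T2)"
    unfolding eq using d T by simp
  thus ?thesis
    by (rule spanned_subset[rotated 5]) (use T T1 T2 in \<open>auto simp: join_upperI\<close>)
qed

text \<open>The classical dichotomy between a star and the hyperplanes of one space. Two members fix
  the candidates \<open>S = T1 \<inter> T2\<close> and \<open>Z = join T1 T2\<close>; whatever
  misses \<open>S\<close> lies in \<open>Z\<close>, and one such member drags all others into
  \<open>Z\<close>.\<close>

lemma clique_cases:
  assumes A: "\<A> \<subseteq> subs (Suc s)" "\<A> \<noteq> {}" and cl: "clique s \<A>"
  shows "(\<exists>S\<in>subs s. \<forall>T\<in>\<A>. S \<subseteq> T) \<or> (\<exists>Z\<in>subs (Suc (Suc s)). \<forall>T\<in>\<A>. T \<subseteq> Z)"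
proof (cases "\<exists>T1\<in>\<A>. \<exists>T2\<in>\<A>. T1 \<noteq> T2")
  case False
  then obtain T where T: "T \<in> \<A>" "\<A> \<subseteq> {T}" using A by blast
  have "subspace T" "dim T = Suc s" using A(1) T(1) by blast+
  then obtain S where "S \<in> between {0} T s" using exists_between[of "{0}" T s]
    by (auto simp: subspace_0)
  hence "S \<in> subs s" "\<forall>T\<in>\<A>. S \<subseteq> T" using T(2) by (auto simp: between_def)
  thus ?thesis by (intro disjI1 bexI[of _ S])
next
  case True
  then obtain T1 T2 where T12: "T1 \<in> \<A>" "T2 \<in> \<A>" "T1 \<noteq> T2" by auto
  hence s12: "T1 \<in> subs (Suc s)" "T2 \<in> subs (Suc s)" using A by blast+
  define S Z where "S = T1 \<inter> T2" and "Z = join T1 T2"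
  have dS: "dim S = s" using dim_Int_eqI[OF s12] T12 cl unfolding clique_def S_def by blast
  have sS: "subspace S" using s12 by (auto simp: S_def)
  have dZ: "dim Z = Suc (Suc s)" using dim_join[of T1 T2] s12 dS by (simp add: S_def Z_def)
  have SZ: "S \<subseteq> Z" by (auto simp: S_def Z_def join_upperI)
  have inZ: "T \<subseteq> Z" if "T \<in> \<A>" "\<not> S \<subseteq> T" for T
    unfolding Z_def
    by (rule contains_or_contained[OF s12]) (use that A T12 cl dS in \<open>auto simp: S_def clique_def\<close>)
  show ?thesis
  proof (cases "\<forall>T\<in>\<A>. S \<subseteq> T")
    case True
    thus ?thesis using sS dS by blast
  next
    case False
    then obtain T3 where T3: "T3 \<in> \<A>" "\<not> S \<subseteq> T3" by auto
    hence s3: "subspace T3" using A by blast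
    have "T \<subseteq> Z" if T: "T \<in> \<A>" for T
    proof (cases "S \<subseteq> T")
      case True
      \<comment> \<open>\<open>T\<close> is spanned by \<open>S\<close> and
        \<open>T \<inter> T3\<close>, both contained in \<open>Z\<close>.\<close>
      have sT: "subspace T" "dim T = Suc s" using A T by blast+
      have "dim (S \<inter> T3) < dim S" using sS s3 T3 by (intro dim_Int_less)
      moreover have "S \<inter> (T \<inter> T3) = S \<inter> T3" using True by auto
      moreover have "s \<le> dim (T \<inter> T3)" using cl T T3 by (auto simp: clique_def)
      ultimately have "dim T + dim (S \<inter> (T \<inter> T3)) \<le> dim S + dim (T \<inter> T3)"
        using sT dS by simp
      thus ?thesis
        by (rule spanned_subset[rotated 5])
           (use sT sS s3 True SZ inZ[OF T3] in \<open>auto simp: Z_def\<close>)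
    qed (use inZ T in blast)
    thus ?thesis using dZ by (intro disjI2 bexI[of _ Z]) (auto simp: Z_def)
  qed
qed

text \<open>Each \<open>T\<close> is spanned by \<open>S\<close> and its trace on \<open>F\<close>.
  This is where the (k+1)-space \<open>M\<close> of the star configuration originates, with
  \<open>F\<close> a member of the family that misses \<open>S\<close>.\<close>

lemma star_contained:
  assumes A: "\<A> \<subseteq> subs (Suc s)" "\<A> \<noteq> {}" and S: "S \<in> subs s" "\<And>T. T \<in> \<A> \<Longrightarrow> S \<subseteq> T"
    and F: "subspace F" "\<not> S \<subseteq> F" "\<And>T. T \<in> \<A> \<Longrightarrow> s \<le> dim (T \<inter> F)"
  shows "dim (join S F) = Suc (dim F)" and "\<A> \<subseteq> between S (join S F) (Suc s)"
proof -
  have lt: "dim (S \<inter> F) < s" using dim_Int_less[of S F] S F by simp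
  have T: "s \<le> dim (S \<inter> F) + 1 \<and> T \<subseteq> join S F" if "T \<in> \<A>" for T
  proof
    have sT: "subspace T" "dim T = Suc s" "S \<subseteq> T" using A S that by blast+
    have eq: "S \<inter> (T \<inter> F) = S \<inter> F" using sT by auto
    have "dim S + dim (T \<inter> F) \<le> dim T + dim (S \<inter> (T \<inter> F))"
      using sT S F by (intro dim_Int_lower) auto
    thus 1: "s \<le> dim (S \<inter> F) + 1" using F(3)[OF that] sT S unfolding eq by simp
    have "dim T + dim (S \<inter> (T \<inter> F)) \<le> dim S + dim (T \<inter> F)"
      unfolding eq using lt F(3)[OF that] sT S by simp
    thus "T \<subseteq> join S F"
      by (rule spanned_subset[rotated 5]) (use sT S F in \<open>auto simp: join_upperI\<close>)
  qed
  then have "s \<le> dim (S \<inter> F) + 1" using A by blast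
  thus "dim (join S F) = Suc (dim F)" using dim_join[of S F] S F lt by simp
  show "\<A> \<subseteq> between S (join S F) (Suc s)" using T A S(2) unfolding between_def by blast
qed

text \<open>Let \<open>T1\<close> and \<open>T2\<close> violate the clique condition. Then
  \<open>R = T1 \<inter> T2\<close> has dimension \<open>s - 1\<close>, and a member of
  \<open>\<B>\<close> is the join of its traces on \<open>T1\<close> and \<open>T2\<close>, each of
  which is one of \<open>q + 1\<close> spaces above \<open>R\<close>. If \<open>\<B>\<close> is a
  clique, any two members share a trace.\<close>

lemma nonclique_grid:
  assumes A: "\<A> \<subseteq> subs (Suc s)" and B: "\<B> \<subseteq> subs (Suc s)"
    and cross: "\<And>T T'. T \<in> \<A> \<Longrightarrow> T' \<in> \<B> \<Longrightarrow> s \<le> dim (T \<inter> T')"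
    and ncl: "\<not> clique s \<A>" and ne: "\<B> \<noteq> {}"
  shows "card \<B> \<le> (q + 1) * (q + 1)" and "clique s \<B> \<Longrightarrow> card \<B> \<le> q + 1"
proof -
  obtain T1 T2 where T12: "T1 \<in> \<A>" "T2 \<in> \<A>" "dim (T1 \<inter> T2) < s"
    using ncl by (auto simp: clique_def not_le)
  hence s12: "subspace T1" "dim T1 = Suc s" "subspace T2" "dim T2 = Suc s" using A by blast+
  define R where "R = T1 \<inter> T2"
  have sR: "subspace R" using s12 by (simp add: R_def)
  have B': "Suc (dim R) = s \<and> T' \<inter> T1 \<in> between R T1 s \<and> T' \<inter> T2 \<in> between R T2 s \<and>
      join (T' \<inter> T1) (T' \<inter> T2) = T'" if T': "T' \<in> \<B>" for T'
  proof -
    have sT': "subspace T'" "dim T' = Suc s" using B T' by blast+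
    have "T' \<noteq> T1" "T' \<noteq> T2" using cross[OF T12(2) T'] cross[OF T12(1) T'] T12(3)
      by (auto simp: Int_commute)
    hence d: "dim (T' \<inter> T1) = s" "dim (T' \<inter> T2) = s"
      using cross[OF T12(1) T'] cross[OF T12(2) T'] sT' s12
      by (auto intro!: dim_Int_eqI simp: Int_commute)
    have eq: "(T' \<inter> T1) \<inter> (T' \<inter> T2) = R \<inter> T'" by (auto simp: R_def)
    have "dim (T' \<inter> T1) + dim (T' \<inter> T2) \<le> dim T' + dim ((T' \<inter> T1) \<inter> (T' \<inter> T2))"
      using sT' s12 by (intro dim_Int_lower) auto
    hence ge: "s \<le> Suc (dim (R \<inter> T'))" unfolding eq d sT' by simp
    have "dim (R \<inter> T') \<le> dim R" by (intro dim_subset) auto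
    hence dR: "Suc (dim R) = s" "dim R \<le> dim (R \<inter> T')" using T12(3) ge by (auto simp: R_def)
    hence RT': "R \<subseteq> T'" using sR sT' by (intro subset_if_dim_Int)
    hence RT: "R \<inter> T' = R" by auto
    have "join (T' \<inter> T1) (T' \<inter> T2) = T'"
      using dim_join[of "T' \<inter> T1" "T' \<inter> T2"] sT' s12 d dR unfolding eq RT
      by (intro subspace_eqI join_least) auto
    thus ?thesis using dR d RT' sT' s12 by (auto simp: between_def R_def)
  qed
  have dR: "Suc (dim R) = s" using ne B' by blast
  define P Q where "P = between R T1 s" and "Q = between R T2 s"
  have PQ: "card P = q + 1" "card Q = q + 1"
    using card_between_Suc[of R T1] card_between_Suc[of R T2] sR s12 dR
    by (auto simp: P_def Q_def R_def qnum_Suc numeral_2_eq_2)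
  define f where "f T' = (T' \<inter> T1, T' \<inter> T2)" for T' :: "'b set"
  have inj: "inj_on f \<B>"
    unfolding inj_on_def f_def using B' by (metis prod.inject)
  have im: "f ` \<B> \<subseteq> P \<times> Q" using B' unfolding f_def P_def Q_def by blast
  have "card \<B> \<le> card (P \<times> Q)" using inj im by (intro card_inj_on_le) auto
  thus "card \<B> \<le> (q + 1) * (q + 1)" by (simp only: card_cartesian_product PQ)
  show "card \<B> \<le> q + 1" if cl: "clique s \<B>"
  proof -
    have share: "T' \<inter> T1 = T'' \<inter> T1 \<or> T' \<inter> T2 = T'' \<inter> T2" if T: "T' \<in> \<B>" "T'' \<in> \<B>" for T' T''
    proof (rule ccontr)
      assume neq: "\<not> ?thesis"
      have sT: "subspace T'" "dim T' = Suc s" "subspace T''" "dim T'' = Suc s" using B T by blast+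
      have sub: "X \<subseteq> join T' T''" if X: "subspace X" "dim X = Suc s"
        "T' \<inter> X \<noteq> T'' \<inter> X" "dim (T' \<inter> X) = s" "dim (T'' \<inter> X) = s" for X
      proof -
        have "dim ((T' \<inter> X) \<inter> (T'' \<inter> X)) < dim (T' \<inter> X)"
          using X sT subspace_eqI[of "T' \<inter> X" "T'' \<inter> X"] by (intro dim_Int_less) auto
        hence "dim X + dim ((T' \<inter> X) \<inter> (T'' \<inter> X)) \<le> dim (T' \<inter> X) + dim (T'' \<inter> X)"
          using X by simp
        thus ?thesis
          by (rule spanned_subset[rotated 5]) (use X sT in \<open>auto simp: join_upperI\<close>)
      qed
      have "T1 \<subseteq> join T' T''" "T2 \<subseteq> join T' T''"
        by (rule sub; use B'[OF T(1)] B'[OF T(2)] neq s12 in \<open>simp add: between_def\<close>)+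
      \<comment> \<open>The left side is \<open>s + 3\<close>, whereas the clique condition bounds
        the right side by \<open>s + 2\<close>.\<close>
      hence "dim (join T1 T2) \<le> dim (join T' T'')" by (intro dim_subset join_least) auto
      moreover have "s \<le> dim (T' \<inter> T'')" using cl T by (auto simp: clique_def)
      ultimately show False
        using dim_join[of T1 T2] dim_join[of T' T''] s12 sT dR by (simp add: R_def)
    qed
    have "card (f ` \<B>) \<le> q + 1"
    proof (rule card_le_if_share_coordinate[of P Q])
      fix x y assume "x \<in> f ` \<B>" "y \<in> f ` \<B>"
      thus "fst x = fst y \<or> snd x = snd y" using share unfolding f_def by fastforce
    qed (use PQ im in simp_all)
    thus ?thesis using card_image[OF inj] by simp
  qed
qed

lemma clique_card_le:
  assumes A: "\<A> \<subseteq> subs (Suc s)" "\<A> \<noteq> {}" and cl: "clique s \<A>"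
    and star: "\<And>U. U \<in> subs s \<Longrightarrow> card {T\<in>\<A>. U \<subseteq> T} \<le> qnum a"
  shows "card \<A> \<le> qnum (max a (Suc (Suc s)))"
  using clique_cases[OF assms(1-3)]
proof
  assume "\<exists>S\<in>subs s. \<forall>T\<in>\<A>. S \<subseteq> T"
  then obtain S where S: "S \<in> subs s" "\<forall>T\<in>\<A>. S \<subseteq> T" by blast
  have "{T\<in>\<A>. S \<subseteq> T} = \<A>" using S by blast
  hence "card \<A> \<le> qnum a" using star[OF S(1)] by simp
  also have "\<dots> \<le> qnum (max a (Suc (Suc s)))" by (rule qnum_mono) simp
  finally show ?thesis .
next
  assume "\<exists>Z\<in>subs (Suc (Suc s)). \<forall>T\<in>\<A>. T \<subseteq> Z"
  then obtain Z where Z: "subspace Z" "dim Z = Suc (Suc s)" "\<forall>T\<in>\<A>. T \<subseteq> Z" by blast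
  have "{0} \<subseteq> Z" using Z subspace_0 by simp
  have "\<A> \<subseteq> between {0} Z (Suc s)" using A Z subspace_0 by (auto simp: between_def)
  hence "card \<A> \<le> card (between {0} Z (Suc s))" by (intro card_mono) auto
  also have "\<dots> = qnum (Suc (Suc s))"
    using card_hyperplanes[of "{0}" Z "Suc s"] Z \<open>{0} \<subseteq> Z\<close> by simp
  also have "\<dots> \<le> qnum (max a (Suc (Suc s)))" by (rule qnum_mono) simp
  finally show ?thesis .
qed

text \<open>Each member of \<open>\<A>\<close> contains one of the \<open>qnum (Suc s)\<close>
  hyperplanes of \<open>T'\<close>.\<close>

lemma card_le_hyperplanes_star:
  assumes A: "\<A> \<subseteq> subs (Suc s)" and T': "T' \<in> subs (Suc s)"
    and cross: "\<And>T. T \<in> \<A> \<Longrightarrow> s \<le> dim (T \<inter> T')"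
    and star: "\<And>U. U \<in> subs s \<Longrightarrow> card {T\<in>\<A>. U \<subseteq> T} \<le> K"
  shows "card \<A> \<le> qnum (Suc s) * K"
proof -
  let ?S = "between {0} T' s"
  have T'': "subspace T'" "dim T' = Suc s" "{0} \<subseteq> T'" using T' subspace_0 by auto
  have "\<exists>U\<in>?S. U \<subseteq> T" if "T \<in> \<A>" for T
  proof -
    have "subspace (T \<inter> T')" "s \<le> dim (T \<inter> T')" using A T' cross that by auto
    then obtain U where "U \<in> between {0} (T \<inter> T') s"
      using exists_between[of "{0}" "T \<inter> T'" s] by (auto dest: subspace_0)
    thus ?thesis by (intro bexI[of _ U]) (auto simp: between_def)
  qed
  hence "\<A> \<subseteq> (\<Union>U\<in>?S. {T\<in>\<A>. U \<subseteq> T})" by blast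
  hence "card \<A> \<le> card (\<Union>U\<in>?S. {T\<in>\<A>. U \<subseteq> T})" by (intro card_mono) auto
  also have "\<dots> \<le> (\<Sum>U\<in>?S. card {T\<in>\<A>. U \<subseteq> T})" by (rule card_UN_le) simp
  also have "\<dots> \<le> (\<Sum>U\<in>?S. K)" by (intro sum_mono star) (auto simp: between_def)
  also have "\<dots> = qnum (Suc s) * K" using card_hyperplanes[of "{0}" T' s] T'' by simp
  finally show ?thesis .
qed

text \<open>If \<open>\<B>\<close> is no clique either, both sides lie in grids. If
  \<open>\<B>\<close> is a single space, stars around its hyperplanes suffice. Otherwise two members
  of \<open>\<B>\<close> confine \<open>\<A>\<close> to a star and the hyperplanes of one space,
  while \<open>\<B>\<close> has at most \<open>q + 1\<close> members.\<close>

lemma nonclique_product_less: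
  assumes A: "\<A> \<subseteq> subs (Suc s)" and B: "\<B> \<subseteq> subs (Suc s)" "\<B> \<noteq> {}"
    and cross: "\<And>T T'. T \<in> \<A> \<Longrightarrow> T' \<in> \<B> \<Longrightarrow> s \<le> dim (T \<inter> T')"
    and starA: "\<And>U. U \<in> subs s \<Longrightarrow> card {T\<in>\<A>. U \<subseteq> T} \<le> qnum a"
    and ncl: "\<not> clique s \<A>" and "2 \<le> s" and m: "m = max a (Suc (Suc s))"
  shows "card \<A> * card \<B> < qnum m * qnum m"
proof -
  \<comment> \<open>Here \<open>2 \<le> s\<close> enters: it gives \<open>m \<ge> 4\<close>, and
    \<open>qnum 4\<close> exceeds the grid size \<open>(q + 1) * (q + 1)\<close>.\<close>
  have g4: "(q + 1) * (q * q + 1) \<le> qnum m"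
  proof -
    have "qnum 4 = (q + 1) * (q * q + 1)"
      by (simp add: qnum_Suc eval_nat_numeral algebra_simps)
    thus ?thesis using qnum_mono[of 4 m] m \<open>2 \<le> s\<close> by simp
  qed
  have ge: "qnum (Suc (Suc s)) \<le> qnum m" "qnum a \<le> qnum m" using m by (auto intro: qnum_mono)
  have pos: "qnum m > 0" using m by (intro qnum_pos) simp
  have "q * 2 \<le> q * q" using q_ge_2 by simp
  hence qq: "q < q * q" "4 \<le> q * q" using q_ge_2 by linarith+
  have AsubB: "card \<B> \<le> (q + 1) * (q + 1)" "clique s \<B> \<Longrightarrow> card \<B> \<le> q + 1"
    using nonclique_grid[OF A B(1) cross ncl B(2)] by blast+
  have lt: "(q + 1) * (q + 1) < qnum m"
  proof -
    have "(q + 1) * (q + 1) < (q + 1) * (q * q + 1)" using qq by (intro mult_strict_left_mono) auto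
    thus ?thesis using g4 by linarith
  qed
  show ?thesis
  proof (cases "clique s \<B>")
    case False
    have "\<A> \<noteq> {}" using ncl by (auto simp: clique_def)
    have cross': "s \<le> dim (T \<inter> T')" if "T \<in> \<B>" "T' \<in> \<A>" for T T'
      using cross[OF that(2,1)] by (simp only: Int_commute)
    have "card \<A> \<le> (q + 1) * (q + 1)"
      by (rule nonclique_grid(1)[OF B(1) A cross' False \<open>\<A> \<noteq> {}\<close>])
    thus ?thesis using AsubB(1) lt by (intro mult_strict_mono') auto
  next
    case True
    show ?thesis
    proof (cases "\<exists>T1\<in>\<B>. \<exists>T2\<in>\<B>. T1 \<noteq> T2")
      case False
      then obtain T' where T': "\<B> = {T'}" using B by blast
      hence "card \<A> \<le> qnum (Suc s) * qnum a"
        using card_le_hyperplanes_star[of \<A> s T'] A B cross starA by auto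
      also have "\<dots> \<le> qnum (Suc s) * qnum m" using ge by simp
      also have "\<dots> < qnum m * qnum m"
        using qnum_strict_mono[of "Suc s" "Suc (Suc s)"] ge pos by (intro mult_strict_right_mono) auto
      finally show ?thesis using T' by simp
    next
      case two: True
      then obtain T1 T2 where T12: "T1 \<in> \<B>" "T2 \<in> \<B>" "T1 \<noteq> T2" by auto
      have s12: "T1 \<in> subs (Suc s)" "T2 \<in> subs (Suc s)" using B T12 by blast+
      have d: "dim (T1 \<inter> T2) = s"
        using dim_Int_eqI[OF s12] T12 True unfolding clique_def by blast
      define Z where "Z = join T1 T2"
      have sZ: "subspace Z" "{0} \<subseteq> Z" using subspace_0[of Z] by (auto simp: Z_def)
      have dZ: "dim Z = Suc (Suc s)" using dim_join[of T1 T2] s12 d by (simp add: Z_def)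
      have sS: "T1 \<inter> T2 \<in> subs s" using s12 d by auto
      have "\<A> \<subseteq> {T\<in>\<A>. T1 \<inter> T2 \<subseteq> T} \<union> between {0} Z (Suc s)"
      proof
        fix T assume T: "T \<in> \<A>"
        have sT: "T \<in> subs (Suc s)" using A T by blast
        have "T \<subseteq> Z" if "\<not> T1 \<inter> T2 \<subseteq> T"
          unfolding Z_def by (rule contains_or_contained[OF s12 d sT _ _ that]) (use cross T T12 in auto)
        thus "T \<in> {T\<in>\<A>. T1 \<inter> T2 \<subseteq> T} \<union> between {0} Z (Suc s)"
          using T sT subspace_0[of T] by (auto simp: between_def)
      qed
      hence "card \<A> \<le> card ({T\<in>\<A>. T1 \<inter> T2 \<subseteq> T} \<union> between {0} Z (Suc s))"
        by (intro card_mono) auto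
      also have "\<dots> \<le> card {T\<in>\<A>. T1 \<inter> T2 \<subseteq> T} + card (between {0} Z (Suc s))"
        by (rule card_Un_le)
      also have "card {T\<in>\<A>. T1 \<inter> T2 \<subseteq> T} \<le> qnum a" by (rule starA[OF sS])
      also have "card (between {0} Z (Suc s)) = qnum (Suc (Suc s))"
        using card_hyperplanes[of "{0}" Z "Suc s"] sZ dZ by simp
      finally have cA: "card \<A> \<le> 2 * qnum m" using ge by linarith
      have "card \<A> * card \<B> \<le> (2 * qnum m) * (q + 1)"
        using cA AsubB(2)[OF True] by (rule mult_le_mono)
      also have "\<dots> = (2 * (q + 1)) * qnum m" by (simp add: algebra_simps)
      also have "\<dots> < qnum m * qnum m"
      proof (rule mult_strict_right_mono[OF _ pos])
        have "(q + 1) * 2 < (q + 1) * (q * q + 1)" using qq by (intro mult_strict_left_mono) auto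
        thus "2 * (q + 1) < qnum m" using g4 by linarith
      qed
      finally show ?thesis .
    qed
  qed
qed

lemma cross_product_cases:
  assumes A: "\<A> \<subseteq> subs (Suc s)" "\<A> \<noteq> {}" and B: "\<B> \<subseteq> subs (Suc s)" "\<B> \<noteq> {}"
    and cross: "\<And>T T'. T \<in> \<A> \<Longrightarrow> T' \<in> \<B> \<Longrightarrow> s \<le> dim (T \<inter> T')"
    and starA: "\<And>U. U \<in> subs s \<Longrightarrow> card {T\<in>\<A>. U \<subseteq> T} \<le> qnum a"
    and starB: "\<And>U. U \<in> subs s \<Longrightarrow> card {T\<in>\<B>. U \<subseteq> T} \<le> qnum a"
    and "2 \<le> s" and m: "m = max a (Suc (Suc s))"
  shows "card \<A> * card \<B> < qnum m * qnum m \<or>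
    clique s \<A> \<and> clique s \<B> \<and> card \<A> = qnum m \<and> card \<B> = qnum m"
proof -
  have cross': "s \<le> dim (T \<inter> T')" if "T \<in> \<B>" "T' \<in> \<A>" for T T'
    using cross[OF that(2,1)] by (simp only: Int_commute)
  have pos: "qnum m > 0" using m by (intro qnum_pos) simp
  consider "\<not> clique s \<A>" | "\<not> clique s \<B>" | "clique s \<A>" "clique s \<B>" by blast
  thus ?thesis
  proof cases
    case 1
    thus ?thesis using nonclique_product_less[OF A(1) B cross starA] assms by blast
  next
    case 2
    hence "card \<B> * card \<A> < qnum m * qnum m"
      using nonclique_product_less[OF B(1) A cross' starB] assms by blast
    thus ?thesis by (simp only: mult.commute[of "card \<B>"]) simp
  next
    case 3
    have le: "card \<A> \<le> qnum m" "card \<B> \<le> qnum m"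
      using clique_card_le[OF A 3(1) starA] clique_card_le[OF B 3(2) starB] m by auto
    have "card \<A> * card \<B> < qnum m * qnum m" if "card \<A> \<noteq> qnum m \<or> card \<B> \<noteq> qnum m"
    proof (cases "card \<A> = qnum m")
      case True
      thus ?thesis using le that pos by simp
    next
      case False
      hence "card \<A> * card \<B> \<le> card \<A> * qnum m" "card \<A> < qnum m" using le by auto
      thus ?thesis using pos mult_strict_right_mono[of "card \<A>" "qnum m" "qnum m"] by linarith
    qed
    thus ?thesis using 3 by blast
  qed
qed


section \<open>Pairs of families\<close>

lemma qbinom_pos: "e \<le> d \<Longrightarrow> qbinom d e > 0"
proof (induction d e rule: qbinom.induct)
  case (3 d e)
  thus ?case using qnum_pos[of "Suc d"] qnum_pos[of "Suc e"] by simp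
qed auto

text \<open>Dimension \<open>s + 1\<close> is the smallest possible by
  \<open>no_small_cover\<close>; covers of larger dimension contribute only to error terms.\<close>

definition covers :: "nat \<Rightarrow> 'b set set \<Rightarrow> 'b set set" where
  "covers s \<G> = {T \<in> subs (Suc s). meets s T \<G>}"

text \<open>For subspaces this says that the common intersection has dimension below
  \<open>s\<close>. As \<open>t \<le> s\<close>, it follows from the condition with
  \<open>t\<close>.\<close>

definition nontrivial :: "nat \<Rightarrow> 'b set set \<Rightarrow> bool" where
  "nontrivial s \<G> \<longleftrightarrow> (\<forall>S\<in>subs s. \<exists>G\<in>\<G>. \<not> S \<subseteq> G)"

(* With M the same in both parts, main_part Un extra_part is the family of part (i) of the theorem;
   a pair of families may use different M in the two parts. near is the family of part (ii). *)
definition main_part :: "nat \<Rightarrow> nat \<Rightarrow> 'b set \<Rightarrow> 'b set \<Rightarrow> 'b set set" where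
  "main_part s k S M = {F \<in> subs k. S \<subseteq> F \<and> Suc s \<le> dim (F \<inter> M)}"

definition extra_part :: "nat \<Rightarrow> 'b set \<Rightarrow> 'b set \<Rightarrow> 'b set set" where
  "extra_part k S M = {F \<in> subs k. F \<subseteq> M \<and> \<not> S \<subseteq> F}"

definition near :: "nat \<Rightarrow> nat \<Rightarrow> 'b set \<Rightarrow> 'b set set" where
  "near s k Z = {F \<in> subs k. Suc s \<le> dim (F \<inter> Z)}"

lemma meets_mono: "meets s T \<G> \<Longrightarrow> T \<subseteq> K \<Longrightarrow> meets s K \<G>"
  unfolding meets_def by (meson Int_mono dim_subset le_trans order_refl)

end

locale cross_pair = finite_vector_space scale Basis q
  for scale :: "'a::{field,finite} \<Rightarrow> 'b::ab_group_add \<Rightarrow> 'b" and Basis and q +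
  fixes s k :: nat and \<F> \<G> :: "'b set set"
  assumes sk: "2 \<le> s" "s < k" and n_ge: "4 * k + 6 \<le> dim (UNIV :: 'b set)"
    and F_sub: "\<F> \<subseteq> subs k" and G_sub: "\<G> \<subseteq> subs k"
    and cross: "\<And>F G. F \<in> \<F> \<Longrightarrow> G \<in> \<G> \<Longrightarrow> s \<le> dim (F \<inter> G)"
    and F_nontrivial: "nontrivial s \<F>" and G_nontrivial: "nontrivial s \<G>"
    (* Automatic if one family consists of all k-spaces meeting the other one in dimension s. *)
    and covers_cross: "\<And>T T'. T \<in> covers s \<F> \<Longrightarrow> T' \<in> covers s \<G> \<Longrightarrow> s \<le> dim (T \<inter> T')"
begin

lemma swap: "cross_pair scale Basis q s k \<G> \<F>"
proof
  show "s \<le> dim (F \<inter> G)" if "F \<in> \<G>" "G \<in> \<F>" for F G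
    using cross[OF that(2,1)] by (simp only: Int_commute)
  show "s \<le> dim (T \<inter> T')" if "T \<in> covers s \<G>" "T' \<in> covers s \<F>" for T T'
    using covers_cross[OF that(2,1)] by (simp only: Int_commute)
qed (use sk n_ge F_sub G_sub F_nontrivial G_nontrivial in simp_all)

abbreviation "K \<equiv> qnum (Suc k - s)"
abbreviation "N \<equiv> num_above k (Suc s)"
abbreviation "n \<equiv> dim (UNIV :: 'b set)"

text \<open>Not a bound for either family: if \<open>a\<close> and \<open>b\<close> are the least
  cover dimensions, each size estimate mixes \<open>a\<close> and \<open>b\<close>, and this
  collects the factors of the product that depend on \<open>a\<close>.\<close>

definition cover_bound :: "nat \<Rightarrow> real" where "cover_bound a = qbinom a s * K ^ (a - s) * num_above k a"

lemma N_pos: "N > 0"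
  unfolding num_above_def using sk n_ge by (auto intro!: qbinom_pos simp del: dim_UNIV)

text \<open>Enlarged to dimension \<open>s\<close>, such a cover would lie in every member of
  \<open>\<G>\<close>.\<close>

lemma no_small_cover:
  assumes "subspace U" "dim U \<le> s" shows "\<not> meets s U \<G>"
proof
  assume m: "meets s U \<G>"
  obtain S where S: "S \<in> between U UNIV s"
    using exists_between[of U UNIV s] assms sk n_ge by (auto simp del: dim_UNIV)
  have "S \<in> subs s" using S by (auto simp: between_def)
  then obtain G where G: "G \<in> \<G>" "\<not> S \<subseteq> G" using G_nontrivial unfolding nontrivial_def by blast
  have sG: "subspace G" using G G_sub by blast
  have "s \<le> dim (U \<inter> G)" using m G by (auto simp: meets_def)
  also have "\<dots> \<le> dim (S \<inter> G)" using S by (intro dim_subset) (auto simp: between_def)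
  also have "\<dots> < s" using dim_Int_less[of S G] \<open>S \<in> subs s\<close> sG G by auto
  finally show False by simp
qed

lemma F_meets: "F \<in> \<F> \<Longrightarrow> meets s F \<G>"
  using cross by (auto simp: meets_def)

lemma F_nonempty: "\<F> \<noteq> {}"
proof -
  obtain S where "S \<in> between {0} UNIV s"
    using exists_between[of "{0}" UNIV s] sk n_ge by (auto simp: subspace_0 simp del: dim_UNIV)
  hence "S \<in> subs s" by (auto simp: between_def)
  thus ?thesis using F_nontrivial unfolding nontrivial_def by blast
qed

text \<open>A minimum exists because every member of \<open>\<F>\<close> is itself a cover of
  \<open>\<G>\<close>.\<close>

lemma min_cover:
  obtains b T where "Suc s \<le> b" "subspace T" "dim T = b" "meets s T \<G>"
    "\<And>U. subspace U \<Longrightarrow> dim U < b \<Longrightarrow> \<not> meets s U \<G>"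
proof -
  define P where "P b \<longleftrightarrow> (\<exists>T. subspace T \<and> dim T = b \<and> meets s T \<G>)" for b
  obtain F where "F \<in> \<F>" using F_nonempty by blast
  hence "P k" using F_sub F_meets unfolding P_def by blast
  define b where "b = (LEAST b. P b)"
  have "P b" unfolding b_def using \<open>P k\<close> by (rule LeastI)
  then obtain T where T: "subspace T" "dim T = b" "meets s T \<G>" unfolding P_def by blast
  show thesis
  proof (rule that[OF _ T])
    show "Suc s \<le> b" using no_small_cover[OF T(1)] T by linarith
    show "\<not> meets s U \<G>" if "subspace U" "dim U < b" for U
      using that not_less_Least[of "dim U" P] unfolding b_def P_def by blast
  qed
qed

lemma cover_bound_nonneg [simp]: "cover_bound a \<ge> 0"
  by (simp add: cover_bound_def)

lemma cover_bound_Suc: assumes "s \<le> a" shows "cover_bound (Suc a) * q ^ (2 * k + 4) \<le> cover_bound a"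
proof -
  have qp: "real q ^ (k + 2) > 0" using q_ge_2 by simp
  \<comment> \<open>The exponent \<open>3 * k + 6\<close> is at most \<open>n - k\<close>: this uses
    the full strength of the bound on \<open>n\<close>.\<close>
  have "cover_bound (Suc a) * q ^ (2 * k + 4) * q ^ (k + 2) = cover_bound (Suc a) * q ^ (3 * k + 6)"
    by (simp only: mult.assoc power_add[symmetric] of_nat_power) (simp add: algebra_simps)
  also have "\<dots> \<le> cover_bound (Suc a) * q ^ (n - k)"
    using n_ge q_ge_2 by (intro mult_left_mono) (simp_all add: power_increasing del: dim_UNIV)
  also have "\<dots> \<le> cover_bound a * q ^ (k + 2)"
    using cover_bound_decreasing[of s a k] assms sk n_ge
    by (simp add: cover_bound_def mult.commute del: dim_UNIV)
  finally show ?thesis using qp by (subst (asm) mult_le_cancel_right_pos) simp_all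
qed

lemma cover_bound_antimono: assumes "a \<ge> Suc s" shows "cover_bound a \<le> cover_bound (Suc s)"
  using assms
proof (induction a rule: dec_induct)
  case (step a)
  have "cover_bound (Suc a) * 1 \<le> cover_bound (Suc a) * q ^ (2 * k + 4)"
    using q_ge_2 by (intro mult_left_mono) (simp_all flip: of_nat_power)
  thus ?case using cover_bound_Suc[of a] step by simp
qed simp

lemma cover_bound_antimono': assumes "a \<ge> Suc (Suc s)" shows "cover_bound a * q ^ (2 * k + 4) \<le> cover_bound (Suc s)"
proof -
  obtain a' where a: "a = Suc a'" "a' \<ge> Suc s" using assms by (cases a) auto
  thus ?thesis using cover_bound_Suc[of a'] cover_bound_antimono[of a'] by simp
qed

lemma cover_bound_Suc_s: "cover_bound (Suc s) = qnum (Suc s) * K * N"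
  unfolding cover_bound_def by (simp only: qbinom_Suc_self) simp

lemma qnum_mult_less: "qnum (Suc s) * K < q ^ (k + 2)"
proof -
  have "qnum (Suc s) * K < q ^ Suc s * q ^ (Suc k - s)"
    by (intro mult_strict_mono' qnum_less) auto
  also have "\<dots> = q ^ (k + 2)" using sk by (simp only: power_add[symmetric]) simp
  finally show ?thesis .
qed

lemma card_F_le_cover:
  assumes "\<A> \<subseteq> \<F>" "subspace T" "meets s T \<F>" "s \<le> b"
    and "\<And>F U. F \<in> \<A> \<Longrightarrow> subspace U \<Longrightarrow> U \<subseteq> F \<Longrightarrow> dim U < b \<Longrightarrow> \<not> meets s U \<G>"
  shows "real (card \<A>) \<le> qbinom (dim T) s * K ^ (b - s) * num_above k b"
proof (rule card_le_by_cover[where \<G> = \<G>])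
  show "meets s T \<A>" using assms by (auto simp: meets_def)
qed (use assms F_sub G_sub sk F_meets in auto)

lemma product_le_cover_bounds:
  "\<exists>a b. Suc s \<le> a \<and> Suc s \<le> b \<and> real (card \<F>) * real (card \<G>) \<le> cover_bound a * cover_bound b \<and>
    (a = Suc s \<longrightarrow> covers s \<F> \<noteq> {}) \<and> (b = Suc s \<longrightarrow> covers s \<G> \<noteq> {})"
proof -
  interpret sw: cross_pair scale Basis q s k \<G> \<F> by (rule swap)
  obtain b T where T: "Suc s \<le> b" "subspace T" "dim T = b" "meets s T \<G>"
    "\<And>U. subspace U \<Longrightarrow> dim U < b \<Longrightarrow> \<not> meets s U \<G>" by (rule min_cover) auto
  obtain a T' where T': "Suc s \<le> a" "subspace T'" "dim T' = a" "meets s T' \<F>"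
    "\<And>U. subspace U \<Longrightarrow> dim U < a \<Longrightarrow> \<not> meets s U \<F>" by (rule sw.min_cover) auto
  have F: "real (card \<F>) \<le> qbinom a s * K ^ (b - s) * num_above k b"
    using card_F_le_cover[of \<F> T' b] T T' by simp
  have G: "real (card \<G>) \<le> qbinom b s * K ^ (a - s) * num_above k a"
    using sw.card_F_le_cover[of \<G> T a] T T' by simp
  have "real (card \<F>) * real (card \<G>) \<le>
    (qbinom a s * K ^ (b - s) * num_above k b) * (qbinom b s * K ^ (a - s) * num_above k a)"
    by (intro mult_mono F G) auto
  also have "\<dots> = cover_bound a * cover_bound b" by (simp add: cover_bound_def)
  finally have le: "real (card \<F>) * real (card \<G>) \<le> cover_bound a * cover_bound b" .
  show ?thesis
  proof (rule exI[of _ a], rule exI[of _ b], intro conjI impI le T(1) T'(1))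
    assume "a = Suc s"
    hence "T' \<in> covers s \<F>" using T' by (simp add: covers_def)
    thus "covers s \<F> \<noteq> {}" by blast
  next
    assume "b = Suc s"
    hence "T \<in> covers s \<G>" using T by (simp add: covers_def)
    thus "covers s \<G> \<noteq> {}" by blast
  qed
qed

text \<open>At least one factor sits at dimension \<open>s + 2\<close> or more and gains
  \<open>q ^ (2 * k + 4)\<close>, the square of the factor by which
  \<open>cover_bound (Suc s)\<close> may exceed \<open>N\<close>.\<close>

lemma product_less_if_no_covers:
  assumes "covers s \<F> = {} \<or> covers s \<G> = {}"
  shows "real (card \<F>) * real (card \<G>) < N\<^sup>2"
proof -
  obtain a b where ab: "Suc s \<le> a" "Suc s \<le> b" "real (card \<F>) * real (card \<G>) \<le> cover_bound a * cover_bound b"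
    "a = Suc s \<Longrightarrow> covers s \<F> \<noteq> {}" "b = Suc s \<Longrightarrow> covers s \<G> \<noteq> {}" using product_le_cover_bounds by blast
  let ?Q = "real q ^ (2 * k + 4)"
  have Qp: "?Q > 0" using q_ge_2 by simp
  have "cover_bound a * cover_bound b * ?Q \<le> cover_bound (Suc s) * cover_bound (Suc s)"
  proof (cases "a = Suc s")
    case False
    hence "Suc (Suc s) \<le> a" using ab(1) by simp
    hence "cover_bound a * ?Q * cover_bound b \<le> cover_bound (Suc s) * cover_bound (Suc s)"
      using ab cover_bound_antimono'[of a] cover_bound_antimono[of b] by (intro mult_mono) simp_all
    thus ?thesis by (simp add: ac_simps)
  next
    case True
    hence "b \<noteq> Suc s" using ab assms by blast
    hence "Suc (Suc s) \<le> b" using ab(2) by simp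
    hence "cover_bound a * (cover_bound b * ?Q) \<le> cover_bound (Suc s) * cover_bound (Suc s)"
      using ab Qp cover_bound_antimono'[of b] cover_bound_antimono[of a] by (intro mult_mono) simp_all
    thus ?thesis by (simp add: ac_simps)
  qed
  also have "\<dots> < (q ^ (k + 2) * N) * (q ^ (k + 2) * N)"
  proof -
    have "cover_bound (Suc s) < q ^ (k + 2) * N"
      unfolding cover_bound_Suc_s using qnum_mult_less N_pos
      by (intro mult_strict_right_mono) (simp_all flip: of_nat_power of_nat_mult)
    thus ?thesis by (intro mult_strict_mono') auto
  qed
  also have "\<dots> = N\<^sup>2 * ?Q"
  proof -
    have "2 * k + 4 = (k + 2) + (k + 2)" by simp
    hence Q: "?Q = real q ^ (k + 2) * real q ^ (k + 2)" by (simp only: power_add)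
    show ?thesis unfolding Q power2_eq_square of_nat_power by (simp only: ac_simps)
  qed
  finally have "cover_bound a * cover_bound b < N\<^sup>2" using Qp by (subst (asm) mult_less_cancel_right_pos) simp_all
  thus ?thesis using ab by linarith
qed

text \<open>The branching bound applied to the covers themselves: a single step leads from
  \<open>U\<close> to dimension \<open>s + 1\<close>.\<close>

lemma covers_star: assumes "U \<in> subs s" shows "card {T\<in>covers s \<G>. U \<subseteq> T} \<le> K"
proof -
  have "real (card {T\<in>covers s \<G>. U \<subseteq> T}) \<le> K ^ (Suc s - dim U) * num_above (Suc s) (Suc s)"
  proof (rule card_above_le[where \<G> = \<G> and k = k])
    show "\<not> meets s U \<G>" if "subspace U" "dim U < Suc s" for U
      using no_small_cover that by simp
  qed (use assms sk G_sub in \<open>auto simp: covers_def\<close>)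
  thus ?thesis using assms by simp
qed

text \<open>Each cover accounts for at most \<open>N\<close> members. A member containing no
  (s+1)-dimensional cover contains none of dimension below \<open>s + 2\<close>, so branching can go
  on to that dimension.\<close>

lemma card_F_le_covers:
  assumes "covers s \<F> \<noteq> {}"
  shows "real (card \<F>) \<le> (card (covers s \<G>) + qnum (Suc s) * K\<^sup>2 / q ^ (n - k)) * N"
proof -
  let ?B = "covers s \<G>"
  define \<A> where "\<A> = {F\<in>\<F>. \<not> (\<exists>T\<in>?B. T \<subseteq> F)}"
  obtain T' where "T' \<in> covers s \<F>" using assms by blast
  hence T': "subspace T'" "dim T' = Suc s" "meets s T' \<F>" by (auto simp: covers_def)
  have noc: "\<not> meets s U \<G>" if "F \<in> \<A>" "subspace U" "U \<subseteq> F" "dim U < Suc (Suc s)" for F U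
  proof (cases "dim U \<le> s")
    case True
    thus ?thesis using no_small_cover that by blast
  next
    case False
    hence "U \<in> subs (Suc s)" using that by simp
    thus ?thesis using that(1,3) unfolding \<A>_def covers_def by blast
  qed
  have "\<A> \<subseteq> \<F>" by (auto simp: \<A>_def)
  from card_F_le_cover[OF this T'(1,3), of "Suc (Suc s)"]
  have "real (card \<A>) \<le> qbinom (Suc s) s * K ^ (Suc (Suc s) - s) * num_above k (Suc (Suc s))"
    using T'(2) noc by simp
  also have "\<dots> = qnum (Suc s) * K\<^sup>2 * num_above k (Suc (Suc s))"
    by (simp only: qbinom_Suc_self) (simp add: Suc_diff_le numeral_2_eq_2)
  also have "\<dots> \<le> qnum (Suc s) * K\<^sup>2 * (N / q ^ (n - k))"
    using num_above_Suc[of k "Suc s"] n_ge q_ge_2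
    by (intro mult_left_mono) (auto simp: pos_le_divide_eq simp del: dim_UNIV)
  finally have A: "real (card \<A>) \<le> qnum (Suc s) * K\<^sup>2 / q ^ (n - k) * N" by simp
  have "\<F> \<subseteq> (\<Union>T\<in>?B. {F\<in>subs k. T \<subseteq> F}) \<union> \<A>" using F_sub unfolding \<A>_def by blast
  hence "card \<F> \<le> card ((\<Union>T\<in>?B. {F\<in>subs k. T \<subseteq> F}) \<union> \<A>)" by (intro card_mono) simp_all
  also have "\<dots> \<le> card (\<Union>T\<in>?B. {F\<in>subs k. T \<subseteq> F}) + card \<A>" by (rule card_Un_le)
  also have "card (\<Union>T\<in>?B. {F\<in>subs k. T \<subseteq> F}) \<le> (\<Sum>T\<in>?B. card {F\<in>subs k. T \<subseteq> F})"
    by (rule card_UN_le) simp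
  finally have "real (card \<F>) \<le> (\<Sum>T\<in>?B. real (card {F\<in>subs k. T \<subseteq> F})) + real (card \<A>)"
    by (simp only: of_nat_sum[symmetric] of_nat_add[symmetric] of_nat_le_iff)
  also have "(\<Sum>T\<in>?B. real (card {F\<in>subs k. T \<subseteq> F})) = (\<Sum>T\<in>?B. N)"
  proof (rule sum.cong)
    fix T assume "T \<in> ?B"
    hence "subspace T" "dim T = Suc s" by (auto simp: covers_def)
    thus "real (card {F\<in>subs k. T \<subseteq> F}) = N" by (simp only: card_above)
  qed simp
  finally show ?thesis using A by (simp add: algebra_simps)
qed

text \<open>The hypothesis on \<open>h\<close> tolerates a defect of half a unit of
  \<open>N\<^sup>2\<close>; the other half is left for the error terms.\<close>

lemma product_cases:
  assumes m: "m = max (Suc k - s) (Suc (Suc s))" and h: "((qnum m)\<^sup>2 - 1 / 2) * N\<^sup>2 \<le> h\<^sup>2"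
  shows "real (card \<F>) * real (card \<G>) < h\<^sup>2 \<or>
    clique s (covers s \<F>) \<and> clique s (covers s \<G>) \<and>
    card (covers s \<F>) = qnum m \<and> card (covers s \<G>) = qnum m"
proof (cases "covers s \<F> = {} \<or> covers s \<G> = {}")
  case True
  have "qnum 2 \<le> qnum m" using m by (intro qnum_mono) simp
  hence "2 \<le> qnum m" using q_ge_2 by (simp add: qnum_Suc numeral_2_eq_2)
  hence "2 * 2 \<le> (real (qnum m))\<^sup>2" unfolding power2_eq_square by (intro mult_mono) simp_all
  hence "1 * N\<^sup>2 \<le> ((qnum m)\<^sup>2 - 1 / 2) * N\<^sup>2" by (intro mult_right_mono) simp_all
  thus ?thesis using product_less_if_no_covers[OF True] h by simp
next
  case False
  interpret sw: cross_pair scale Basis q s k \<G> \<F> by (rule swap)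
  let ?A = "covers s \<F>" and ?B = "covers s \<G>"
  \<comment> \<open>\<open>C\<close> bounds both numbers of covers, and \<open>E * N\<close> bounds
    the number of members without a small cover.\<close>
  define C where "C = qnum (Suc s) * K"
  define E where "E = qnum (Suc s) * K\<^sup>2 / real q ^ (n - k)"
  define x y where "x = card ?A" and "y = card ?B"
  have sub: "?A \<subseteq> subs (Suc s)" "?B \<subseteq> subs (Suc s)" by (auto simp: covers_def)
  have F: "real (card \<F>) \<le> (y + E) * N" and G: "real (card \<G>) \<le> (x + E) * N"
    using card_F_le_covers sw.card_F_le_covers False unfolding x_def y_def E_def by simp_all
  obtain T T' where TT': "T \<in> ?A" "T' \<in> ?B" using False by blast
  have xC: "x \<le> C" unfolding x_def C_def
    by (rule card_le_hyperplanes_star[of _ _ T'])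
       (use TT' sub covers_cross sw.covers_star in auto)
  have yC: "y \<le> C" unfolding y_def C_def
    by (rule card_le_hyperplanes_star[of _ _ T])
       (use TT' sub sw.covers_cross covers_star in auto)
  have qp: "real q ^ (n - k) > 0" using q_ge_2 by simp
  have Kpos: "K > 0" "qnum (Suc s) > 0" using sk by (auto intro!: qnum_pos)
  have C1: "1 \<le> C" using Kpos by (simp add: C_def Suc_le_eq)
  have E0: "0 \<le> E" using qp by (simp add: E_def)
  \<comment> \<open>The exponents add up to \<open>3 * k + 8 - s\<close>, which is at most
    \<open>3 * k + 6\<close> because \<open>2 \<le> s\<close>.\<close>
  have EC: "8 * E * C \<le> 1"
  proof -
    have g1: "qnum (Suc s) \<le> q ^ Suc s" and g2: "K \<le> q ^ (Suc k - s)"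
      using qnum_less less_imp_le by blast+
    have "2 ^ 3 \<le> q ^ 3" using q_ge_2 by (rule power_mono) simp
    hence q3: "8 \<le> q ^ 3" by simp
    have "8 * (qnum (Suc s) * K\<^sup>2) * C = 8 * ((qnum (Suc s))\<^sup>2 * K ^ 3)"
      by (simp add: C_def power2_eq_square power3_eq_cube)
    also have "\<dots> \<le> q ^ 3 * ((q ^ Suc s)\<^sup>2 * (q ^ (Suc k - s)) ^ 3)"
      by (intro mult_le_mono power_mono q3 g1 g2) auto
    also have "\<dots> = q ^ (3 + Suc s * 2 + (Suc k - s) * 3)"
      by (simp only: power_add power_mult mult.assoc)
    also have "\<dots> \<le> q ^ (n - k)" using q_ge_2 sk n_ge by (intro power_increasing) (auto simp del: dim_UNIV)
    finally have "real (8 * (qnum (Suc s) * K\<^sup>2) * C) \<le> real (q ^ (n - k))"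
      by (simp only: of_nat_le_iff)
    hence "8 * (real (qnum (Suc s)) * (real K)\<^sup>2) * C \<le> real q ^ (n - k)" by simp
    thus ?thesis using qp by (simp add: E_def)
  qed
  have "x * y < qnum m * qnum m \<or>
    clique s ?A \<and> clique s ?B \<and> x = qnum m \<and> y = qnum m"
    unfolding x_def y_def
    by (rule cross_product_cases[OF sub(1) _ sub(2) _ covers_cross _ _ sk(1) m])
       (use False sw.covers_star covers_star in auto)
  thus ?thesis
  proof
    assume "x * y < qnum m * qnum m"
    \<comment> \<open>Integrality turns the strict inequality into a gap of 1, against an error of
      at most \<open>3 * (E * C) \<le> 3 / 8\<close>.\<close>
    hence "x * y + 1 \<le> qnum m * qnum m" by simp
    hence "real (x * y + 1) \<le> real (qnum m * qnum m)" by (simp only: of_nat_le_iff)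
    hence xy: "real x * y + 1 \<le> (qnum m)\<^sup>2" by (simp add: power2_eq_square)
    have "E * 1 \<le> E * C" using E0 C1 by (intro mult_left_mono) auto
    hence "E * E \<le> E * C" using EC C1 E0
      by (intro mult_left_mono) auto
    moreover have "E * x \<le> E * C" "E * y \<le> E * C" using E0 xC yC by (auto intro!: mult_left_mono)
    ultimately have "(y + E) * (x + E) \<le> real x * y + 3 * (E * C)" by (simp add: algebra_simps)
    hence lt: "(y + E) * (x + E) < (qnum m)\<^sup>2 - 1 / 2" using xy EC by simp
    have "real (card \<F>) * real (card \<G>) \<le> ((y + E) * N) * ((x + E) * N)"
      using F G E0 N_pos by (intro mult_mono) auto
    also have "\<dots> = ((y + E) * (x + E)) * N\<^sup>2" by (simp add: power2_eq_square)
    also have "\<dots> < ((qnum m)\<^sup>2 - 1 / 2) * N\<^sup>2" using lt N_pos by (intro mult_strict_right_mono) auto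
    finally show ?thesis using h by simp
  next
    assume "clique s ?A \<and> clique s ?B \<and> x = qnum m \<and> y = qnum m"
    thus ?thesis unfolding x_def y_def by blast
  qed
qed

end

section \<open>Shape of families with the largest sets of covers\<close>

context finite_vector_space
begin

text \<open>Consequently the spaces of one level between \<open>U\<close> and \<open>W\<close>,
  below \<open>W\<close>, have nothing in common outside \<open>U\<close>.\<close>

lemma between_avoiding:
  assumes "subspace U" "subspace W" "U \<subseteq> W" "dim U \<le> d" "d < dim W" "v \<notin> U"
  obtains T where "T \<in> between U W d" "v \<notin> T"
proof (cases "v \<in> W")
  case False
  obtain T where "T \<in> between U W d" using exists_between[of U W d] assms by auto
  moreover have "v \<notin> T" using calculation False by (auto simp: between_def)
  ultimately show thesis by (rule that)
next
  case True
  have "join U (span {v}) = join U {v}"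
  proof
    have "span {v} \<subseteq> join U {v}" by (intro span_minimal) (simp_all add: join_upperI)
    thus "join U (span {v}) \<subseteq> join U {v}" by (intro join_least) auto
    show "join U {v} \<subseteq> join U (span {v})" by (intro join_least) (auto simp: join_upperI span_base)
  qed
  hence d: "dim (join U (span {v})) = Suc (dim U)" using assms by (simp add: dim_join_singleton)
  have "span {v} \<subseteq> W" using True assms by (intro span_minimal) auto
  then obtain T where T: "subspace T" "U \<subseteq> T" "T \<subseteq> W" "dim T = d" "T \<inter> span {v} = U \<inter> span {v}"
    using exists_extension_avoiding[of U "span {v}" W d] assms d by auto
  have "v \<notin> T" using T(5) assms(6) span_base[of v "{v}"] by blast
  with T show thesis using that[of T] by (simp add: between_def)
qed

text \<open>If \<open>X \<inter> Z\<close> had dimension \<open>s\<close> only, every hyperplane of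
  \<open>Z\<close> would have to contain it; but some hyperplane avoids a nonzero vector of
  it.\<close>

lemma dim_Int_ge_if_meets_hyperplanes:
  assumes "subspace X" "subspace Z" "dim Z = Suc (Suc s)" "1 \<le> s"
    and meet: "\<And>T. T \<in> between {0} Z (Suc s) \<Longrightarrow> s \<le> dim (T \<inter> X)"
  shows "Suc s \<le> dim (X \<inter> Z)"
proof (rule ccontr)
  assume lt: "\<not> ?thesis"
  have Z0: "{0} \<subseteq> Z" using subspace_0 assms by simp
  have mono: "T \<inter> X \<subseteq> X \<inter> Z" if "T \<in> between {0} Z (Suc s)" for T
    using that by (auto simp: between_def)
  obtain T where "T \<in> between {0} Z (Suc s)"
    using exists_between[of "{0}" Z "Suc s"] assms Z0 by auto
  hence "s \<le> dim (X \<inter> Z)" using meet dim_subset[OF mono] le_trans by blast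
  hence "X \<inter> Z \<noteq> {0}" using \<open>1 \<le> s\<close> by auto
  then obtain w where w: "w \<in> X" "w \<in> Z" "w \<noteq> 0" using subspace_0 assms by blast
  then obtain T where T: "T \<in> between {0} Z (Suc s)" "w \<notin> T"
    using between_avoiding[of "{0}" Z "Suc s" w] assms Z0 by auto
  have "dim (T \<inter> X) < dim (X \<inter> Z)"
    using T w assms mono[OF T(1)] by (intro dim_less) (auto simp: between_def)
  thus False using lt meet[OF T(1)] by simp
qed

text \<open>\<open>M\<close> is the union of \<open>S\<close> and the spaces
  \<open>join S {v}\<close> with \<open>v\<close> in \<open>M\<close> outside
  \<open>S\<close>.\<close>

lemma between_Suc_subset:
  assumes "subspace S" "subspace M" "S \<subseteq> M" "dim S = s"
    and "between S M (Suc s) \<subseteq> between S W (Suc s)" "S \<subseteq> W"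
  shows "M \<subseteq> W"
proof
  fix v assume v: "v \<in> M"
  show "v \<in> W"
  proof (cases "v \<in> S")
    case False
    have "join S {v} \<subseteq> M" using assms v by (intro join_least) auto
    hence "join S {v} \<in> between S M (Suc s)" using assms False
      by (simp add: between_def dim_join_singleton)
    hence "join S {v} \<in> between S W (Suc s)" using assms(5) by (rule rev_subsetD)
    hence "join S {v} \<subseteq> W" by (simp add: between_def)
    thus ?thesis using join_upperI(2)[of v "{v}" S] by auto
  qed (use assms in auto)
qed

text \<open>The star puts \<open>M\<close> inside \<open>join S X\<close>; both have dimension
  \<open>k + 1\<close>.\<close>

lemma subset_if_meets_star:
  assumes X: "X \<in> subs k" and S: "S \<in> subs s" and M: "M \<in> subs (Suc k)" "S \<subseteq> M" and "s < k"
    and nS: "\<not> S \<subseteq> X" and meet: "\<And>T. T \<in> between S M (Suc s) \<Longrightarrow> s \<le> dim (T \<inter> X)"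
  shows "X \<subseteq> M"
proof -
  have s: "subspace X" "dim X = k" "subspace S" "dim S = s" "subspace M" "dim M = Suc k"
    using assms by auto
  obtain T where "T \<in> between S M (Suc s)"
    using exists_between[of S M "Suc s"] s M \<open>s < k\<close> by auto
  hence ne: "between S M (Suc s) \<noteq> {}" by blast
  have b: "between S M (Suc s) \<subseteq> subs (Suc s)" "\<And>T. T \<in> between S M (Suc s) \<Longrightarrow> S \<subseteq> T"
    by (auto simp: between_def)
  have d: "dim (join S X) = Suc k" and "between S M (Suc s) \<subseteq> between S (join S X) (Suc s)"
    using star_contained[OF b(1) ne S b(2) s(1) nS meet] s by simp_all
  hence "M \<subseteq> join S X" using s M by (intro between_Suc_subset[of S M s]) auto
  hence "M = join S X" using s d by (intro subspace_eqI) auto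
  thus ?thesis by auto
qed

end

context cross_pair
begin

lemma F_subset_near:
  assumes "covers s \<F> = between {0} Z (Suc s)" "Z \<in> subs (Suc (Suc s))"
  shows "\<F> \<subseteq> near s k Z"
proof
  fix F assume F: "F \<in> \<F>"
  hence "subspace F" "dim F = k" using F_sub by blast+
  moreover have "Suc s \<le> dim (F \<inter> Z)"
  proof (rule dim_Int_ge_if_meets_hyperplanes)
    fix T assume "T \<in> between {0} Z (Suc s)"
    hence "T \<in> covers s \<F>" using assms by simp
    thus "s \<le> dim (T \<inter> F)" using F by (auto simp: covers_def meets_def)
  qed (use calculation assms sk in auto)
  ultimately show "F \<in> near s k Z" by (simp add: near_def)
qed

text \<open>Members missing \<open>S\<close> are controlled by the covers of \<open>\<F>\<close>,
  hence by \<open>M\<close>. Members \<open>F\<close> above \<open>S\<close> are controlled by a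
  \<open>G\<close> missing \<open>S\<close>: \<open>G\<close> lies in \<open>M'\<close>, and
  \<open>F \<inter> G\<close> reaches outside \<open>S\<close>.\<close>

lemma F_subset_main_extra:
  assumes S: "S \<in> subs s" and M: "M \<in> subs (Suc k)" "S \<subseteq> M" and M': "M' \<in> subs (Suc k)" "S \<subseteq> M'"
    and F: "covers s \<F> = between S M (Suc s)" and G: "covers s \<G> = between S M' (Suc s)"
  shows "\<F> \<subseteq> main_part s k S M' \<union> extra_part k S M"
proof
  fix F assume F': "F \<in> \<F>"
  hence sF: "F \<in> subs k" using F_sub by blast
  show "F \<in> main_part s k S M' \<union> extra_part k S M"
  proof (cases "S \<subseteq> F")
    case False
    have "F \<subseteq> M"
    proof (rule subset_if_meets_star[OF sF S M sk(2) False])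
      fix T assume "T \<in> between S M (Suc s)"
      hence "T \<in> covers s \<F>" using F by simp
      thus "s \<le> dim (T \<inter> F)" using F' by (auto simp: covers_def meets_def)
    qed
    thus ?thesis using sF False by (simp add: extra_part_def)
  next
    case True
    obtain G where G': "G \<in> \<G>" "\<not> S \<subseteq> G" using G_nontrivial S unfolding nontrivial_def by blast
    hence sG: "G \<in> subs k" using G_sub by blast
    have GM: "G \<subseteq> M'"
    proof (rule subset_if_meets_star[OF sG S M' sk(2) G'(2)])
      fix T assume "T \<in> between S M' (Suc s)"
      hence "T \<in> covers s \<G>" using G by simp
      thus "s \<le> dim (T \<inter> G)" using G' by (auto simp: covers_def meets_def)
    qed
    have "dim (S \<inter> G) < s" using dim_Int_less[of S G] S sG G' by simp
    moreover have "S \<inter> (F \<inter> G) = S \<inter> G" using True by blast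
    moreover have "s \<le> dim (F \<inter> G)" using cross F' G' by blast
    ultimately have "Suc s \<le> dim (join S (F \<inter> G))"
      using dim_join[of S "F \<inter> G"] S sF sG by simp
    also have "\<dots> \<le> dim (F \<inter> M')"
      using True GM M' sF by (intro dim_subset join_least) auto
    finally show ?thesis using sF True by (simp add: main_part_def)
  qed
qed

text \<open>A member missing \<open>S\<close> confines the star to the level above \<open>S\<close>
  in a (k+1)-space, and the size \<open>qnum m\<close> is enough to fill that level.\<close>

lemma star_covers:
  assumes S: "S \<in> subs s" "\<And>T. T \<in> covers s \<F> \<Longrightarrow> S \<subseteq> T"
    and m: "m = max (Suc k - s) (Suc (Suc s))" and card: "card (covers s \<F>) = qnum m"
  obtains M where "M \<in> subs (Suc k)" "S \<subseteq> M" "covers s \<F> = between S M (Suc s)" "m = Suc k - s"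
proof -
  obtain F where F: "F \<in> \<F>" "\<not> S \<subseteq> F" using F_nontrivial S unfolding nontrivial_def by blast
  hence sF: "subspace F" "dim F = k" using F_sub by blast+
  have "qnum m > 0" using m by (intro qnum_pos) simp
  hence ne: "covers s \<F> \<noteq> {}" using card by auto
  have sub: "covers s \<F> \<subseteq> subs (Suc s)" by (auto simp: covers_def)
  have meet: "s \<le> dim (T \<inter> F)" if "T \<in> covers s \<F>" for T
    using that F by (auto simp: covers_def meets_def)
  define M where "M = join S F"
  have dM: "dim M = Suc k" and cM: "covers s \<F> \<subseteq> between S M (Suc s)"
    using star_contained[OF sub ne S(1) S(2) sF(1) F(2) meet] sF by (simp_all add: M_def)
  have SM: "subspace M" "S \<subseteq> M" by (simp_all add: M_def)
  have cb: "card (between S M (Suc s)) = qnum (Suc k - s)"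
    using card_between_Suc[of S M] S SM dM by simp
  have "qnum m \<le> qnum (Suc k - s)" using card_mono[OF _ cM] card cb by simp
  moreover have "qnum (Suc k - s) \<le> qnum m" using m by (intro qnum_mono) simp
  ultimately have eq: "qnum m = qnum (Suc k - s)" by simp
  show thesis
  proof (rule that[of M])
    show "covers s \<F> = between S M (Suc s)" using cM eq card cb by (intro card_subset_eq) auto
    show "m = Suc k - s" using eq by (simp only: qnum_inject)
  qed (use SM dM in simp_all)
qed

lemma covers_subset_hyperplanes:
  assumes Z: "Z \<in> subs (Suc (Suc s))" and F: "covers s \<F> = between {0} Z (Suc s)"
  shows "covers s \<G> \<subseteq> between {0} Z (Suc s)"
proof
  fix T' assume T': "T' \<in> covers s \<G>"
  hence sT': "subspace T'" "dim T' = Suc s" by (auto simp: covers_def)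
  have "Suc s \<le> dim (T' \<inter> Z)"
    by (rule dim_Int_ge_if_meets_hyperplanes) (use sT' Z sk F covers_cross T' in auto)
  hence "T' \<subseteq> Z" using sT' Z by (intro subset_if_dim_Int) auto
  thus "T' \<in> between {0} Z (Suc s)" using sT' subspace_0 by (simp add: between_def)
qed

text \<open>A \<open>T'\<close> missing \<open>S\<close> would confine the star to an (s+2)-space,
  where it has at most \<open>qnum 2\<close> members.\<close>

lemma covers_contain_centre:
  assumes S: "S \<in> subs s" and star: "\<And>T. T \<in> covers s \<F> \<Longrightarrow> S \<subseteq> T"
    and card: "qnum 3 \<le> card (covers s \<F>)" and T': "T' \<in> covers s \<G>"
  shows "S \<subseteq> T'"
proof (rule ccontr)
  assume n: "\<not> ?thesis"
  have sT': "subspace T'" "dim T' = Suc s" using T' by (auto simp: covers_def)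
  have "qnum 3 > 0" by (intro qnum_pos) simp
  hence ne: "covers s \<F> \<noteq> {}" using card by auto
  have sub: "covers s \<F> \<subseteq> subs (Suc s)" by (auto simp: covers_def)
  have "dim (join S T') = Suc (Suc s)" "covers s \<F> \<subseteq> between S (join S T') (Suc s)"
    using star_contained[OF sub ne S star sT'(1) n covers_cross[OF _ T']] sT' by simp_all
  hence "card (covers s \<F>) \<le> qnum 2"
    using card_mono[of "between S (join S T') (Suc s)" "covers s \<F>"]
      card_between_Suc[of S "join S T'"] S by (simp add: numeral_2_eq_2)
  thus False using card qnum_strict_mono[of 2 3] by simp
qed

text \<open>The ranges overlap in \<open>k = 2 * s + 1\<close>: there both configurations have the
  same number of covers, and only the sizes of the families separate them.\<close>

lemma pair_structure:
  assumes m: "m = max (Suc k - s) (Suc (Suc s))"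
    and cl: "clique s (covers s \<F>)"
    and card: "card (covers s \<F>) = qnum m" "card (covers s \<G>) = qnum m"
  shows "(k \<le> 2 * s + 1 \<and> (\<exists>Z\<in>subs (Suc (Suc s)). \<F> \<subseteq> near s k Z \<and> \<G> \<subseteq> near s k Z)) \<or>
    (2 * s + 1 \<le> k \<and> (\<exists>S\<in>subs s. \<exists>M\<in>subs (Suc k). \<exists>M'\<in>subs (Suc k). S \<subseteq> M \<and> S \<subseteq> M' \<and>
       covers s \<F> = between S M (Suc s) \<and> covers s \<G> = between S M' (Suc s) \<and>
       \<F> \<subseteq> main_part s k S M' \<union> extra_part k S M \<and>
       \<G> \<subseteq> main_part s k S M \<union> extra_part k S M'))"
proof -
  interpret sw: cross_pair scale Basis q s k \<G> \<F> by (rule swap)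
  have "qnum m > 0" using m by (intro qnum_pos) simp
  hence ne: "covers s \<F> \<noteq> {}" using card by auto
  have sub: "covers s \<F> \<subseteq> subs (Suc s)" by (auto simp: covers_def)
  from clique_cases[OF sub ne cl] show ?thesis
  proof
    assume "\<exists>Z\<in>subs (Suc (Suc s)). \<forall>T\<in>covers s \<F>. T \<subseteq> Z"
    then obtain Z where Z: "Z \<in> subs (Suc (Suc s))" "\<forall>T\<in>covers s \<F>. T \<subseteq> Z" by blast
    have cZ: "covers s \<F> \<subseteq> between {0} Z (Suc s)"
    proof
      fix T assume T: "T \<in> covers s \<F>"
      have "subspace T" "dim T = Suc s" using T sub by blast+
      thus "T \<in> between {0} Z (Suc s)" using T Z(2) subspace_0[of T] by (simp add: between_def)
    qed
    have cb: "card (between {0} Z (Suc s)) = qnum (Suc (Suc s))"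
      using card_hyperplanes[of "{0}" Z "Suc s"] Z subspace_0[of Z] by simp
    have "qnum m \<le> qnum (Suc (Suc s))" using card_mono[OF _ cZ] card cb by simp
    moreover have "qnum (Suc (Suc s)) \<le> qnum m" using m by (intro qnum_mono) simp
    ultimately have eq: "qnum m = qnum (Suc (Suc s))" by simp
    hence "m = Suc (Suc s)" by (simp only: qnum_inject)
    hence "k \<le> 2 * s + 1" using m by simp
    moreover have F: "covers s \<F> = between {0} Z (Suc s)"
      using cZ eq card cb by (intro card_subset_eq) auto
    moreover have G: "covers s \<G> = between {0} Z (Suc s)"
      using covers_subset_hyperplanes[OF Z(1) F] eq card cb by (intro card_subset_eq) auto
    ultimately show ?thesis
      using F_subset_near[OF F Z(1)] sw.F_subset_near[OF G Z(1)] Z(1) by (intro disjI1 conjI bexI[of _ Z])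
  next
    assume "\<exists>S\<in>subs s. \<forall>T\<in>covers s \<F>. S \<subseteq> T"
    then obtain S where S: "S \<in> subs s" "\<And>T. T \<in> covers s \<F> \<Longrightarrow> S \<subseteq> T" by blast
    have "qnum 3 \<le> qnum m" using m sk by (intro qnum_mono) simp
    hence S': "S \<subseteq> T'" if "T' \<in> covers s \<G>" for T'
      using covers_contain_centre[OF S _ that] card by simp
    obtain M where M: "M \<in> subs (Suc k)" "S \<subseteq> M" "covers s \<F> = between S M (Suc s)" "m = Suc k - s"
      by (rule star_covers[OF S m card(1)])
    obtain M' where M': "M' \<in> subs (Suc k)" "S \<subseteq> M'" "covers s \<G> = between S M' (Suc s)"
      by (rule sw.star_covers[OF S(1) S' m card(2)])
    have "2 * s + 1 \<le> k" using m M(4) by simp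
    moreover have "\<F> \<subseteq> main_part s k S M' \<union> extra_part k S M"
      by (rule F_subset_main_extra[OF S(1) M(1,2) M'(1,2) M(3) M'(3)])
    moreover have "\<G> \<subseteq> main_part s k S M \<union> extra_part k S M'"
      by (rule sw.F_subset_main_extra[OF S(1) M'(1,2) M(1,2) M'(3) M(3)])
    ultimately show ?thesis using S(1) M(1-3) M'
      by (intro disjI2 conjI bexI[of _ S] bexI[of _ M] bexI[of _ M'])
  qed
qed

end

section \<open>Sizes of the extremal families\<close>

text \<open>With the relative loss \<open>e = D / Q\<close>, at most \<open>1 / (4 * x)\<close>, the
  square of \<open>x - e\<close> is at least \<open>x\<^sup>2 - 2 * x * e\<close>.\<close>

lemma square_bound:
  fixes x D P N Q h :: real
  assumes h: "x * N - D * P \<le> h" and P: "P * Q \<le> N" and D: "4 * x * D \<le> Q"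
    and pos: "1 \<le> x" "0 \<le> D" "0 < Q" "0 \<le> N"
  shows "(x\<^sup>2 - 1 / 2) * N\<^sup>2 \<le> h\<^sup>2"
proof -
  define e where "e = D / Q"
  have e0: "0 \<le> e" using pos by (simp add: e_def)
  have xe: "4 * (x * e) \<le> 1" using D pos by (simp add: e_def field_simps)
  have "1 * e \<le> x * e" using pos e0 by (intro mult_right_mono) auto
  hence ex: "e \<le> x" using xe pos by simp
  have "D * P \<le> D * (N / Q)" using P pos by (intro mult_left_mono) (auto simp: pos_le_divide_eq)
  hence "(x - e) * N \<le> h" using h by (simp add: e_def algebra_simps)
  moreover have "0 \<le> (x - e) * N" using ex pos by simp
  ultimately have "((x - e) * N)\<^sup>2 \<le> h\<^sup>2" by (rule power_mono)
  moreover have "(x\<^sup>2 - 1 / 2) * N\<^sup>2 \<le> (x - e)\<^sup>2 * N\<^sup>2"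
  proof (rule mult_right_mono)
    have "x\<^sup>2 - 1 / 2 \<le> x\<^sup>2 - 2 * (x * e)" using xe by simp
    also have "\<dots> \<le> x\<^sup>2 - 2 * (x * e) + e\<^sup>2" by simp
    also have "\<dots> = (x - e)\<^sup>2" by (simp add: power2_diff)
    finally show "x\<^sup>2 - 1 / 2 \<le> (x - e)\<^sup>2" .
  qed simp
  ultimately show ?thesis by (simp add: power_mult_distrib)
qed

context finite_vector_space
begin

text \<open>Double counting with the hyperplanes of \<open>Z\<close>: a member contains exactly one
  of them, or all \<open>1 + q * qnum (Suc s)\<close> if it contains \<open>Z\<close>.\<close>

lemma card_near:
  assumes Z: "Z \<in> subs (Suc (Suc s))"
  shows "real (card (near s k Z)) =
    qnum (Suc (Suc s)) * num_above k (Suc s) - q * qnum (Suc s) * num_above k (Suc (Suc s))"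
proof -
  let ?T = "between {0} Z (Suc s)"
  have sZ: "subspace Z" "dim Z = Suc (Suc s)" "{0} \<subseteq> Z" using Z subspace_0[of Z] by auto
  have cT: "card ?T = qnum (Suc (Suc s))" using card_hyperplanes[of "{0}" Z "Suc s"] sZ by simp
  define c where "c F = card {T\<in>?T. T \<subseteq> F}" for F :: "'b set"
  have in_near: "F \<in> near s k Z" if "F \<in> subs k" "T \<in> ?T" "T \<subseteq> F" for F T
  proof -
    have "dim T \<le> dim (F \<inter> Z)" using that by (intro dim_subset) (auto simp: between_def)
    thus ?thesis using that by (simp add: near_def between_def)
  qed
  have c: "c F = 1 + (if Z \<subseteq> F then q * qnum (Suc s) else 0)" if "F \<in> near s k Z" for F
  proof -
    have F: "subspace F" "Suc s \<le> dim (F \<inter> Z)" using that by (auto simp: near_def)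
    show ?thesis
    proof (cases "Z \<subseteq> F")
      case True
      hence "{T\<in>?T. T \<subseteq> F} = ?T" by (auto simp: between_def)
      thus ?thesis using True cT by (simp add: c_def qnum_Suc')
    next
      case False
      have "dim (Z \<inter> F) < dim Z" using F sZ False by (intro dim_Int_less)
      hence d: "dim (F \<inter> Z) = Suc s" using F sZ by (simp add: Int_commute)
      have "T = F \<inter> Z" if "T \<in> ?T" "T \<subseteq> F" for T
        using that F sZ d by (intro subspace_eqI) (auto simp: between_def)
      moreover have "F \<inter> Z \<in> ?T" using F sZ d subspace_0[of F] by (simp add: between_def)
      ultimately have "{T\<in>?T. T \<subseteq> F} = {F \<inter> Z}" by blast
      thus ?thesis using False by (simp add: c_def)
    qed
  qed
  have "qnum (Suc (Suc s)) * num_above k (Suc s) = (\<Sum>T\<in>?T. real (card {F\<in>near s k Z. T \<subseteq> F}))"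
  proof -
    have "real (card {F\<in>near s k Z. T \<subseteq> F}) = num_above k (Suc s)" if "T \<in> ?T" for T
    proof -
      have "{F\<in>near s k Z. T \<subseteq> F} = {F\<in>subs k. T \<subseteq> F}"
        using in_near[OF _ that] by (auto simp: near_def)
      thus ?thesis using card_above[of T k] that by (simp add: between_def)
    qed
    thus ?thesis using cT by simp
  qed
  also have "\<dots> = real (\<Sum>F\<in>near s k Z. c F)"
    using sum.swap_restrict[of "near s k Z" ?T "\<lambda>_ _. 1::nat" "\<lambda>F T. T \<subseteq> F"]
    unfolding c_def by (simp only: finite_vec_sets card_eq_sum of_nat_sum[symmetric])
  also have "(\<Sum>F\<in>near s k Z. c F) = (\<Sum>F\<in>near s k Z. 1 + (if Z \<subseteq> F then q * qnum (Suc s) else 0))"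
    by (intro sum.cong c) auto
  also have "\<dots> = card (near s k Z) + q * qnum (Suc s) * card {F\<in>near s k Z. Z \<subseteq> F}"
    unfolding sum.distrib by (simp add: sum.If_cases Int_def)
  also have "{F\<in>near s k Z. Z \<subseteq> F} = {F\<in>subs k. Z \<subseteq> F}"
  proof -
    have "F \<inter> Z = Z" if "Z \<subseteq> F" for F using that by blast
    thus ?thesis using sZ by (auto simp: near_def)
  qed
  finally show ?thesis using card_above[OF sZ(1), of k] sZ by simp
qed

text \<open>Double counting of pairs of a member and a \<open>j\<close>-space between
  \<open>S\<close> and \<open>M\<close>. The values \<open>j = s + 1\<close> and
  \<open>j = s + 2\<close> give first and second order terms.\<close>

lemma main_part_count:
  assumes S: "S \<in> subs s" and M: "M \<in> subs (Suc k)" "S \<subseteq> M" and j: "Suc s \<le> j"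
  shows "qbinom (Suc k - s) (j - s) * num_above k j = (\<Sum>F\<in>main_part s k S M. qbinom (dim (F \<inter> M) - s) (j - s))"
proof -
  let ?T = "between S M j" and ?A = "main_part s k S M"
  have s: "subspace S" "dim S = s" "subspace M" "dim M = Suc k" using S M by auto
  have in_main: "F \<in> ?A" if "F \<in> subs k" "T \<in> ?T" "T \<subseteq> F" for F T
  proof -
    have "dim T \<le> dim (F \<inter> M)" using that by (intro dim_subset) (auto simp: between_def)
    thus ?thesis using that j by (auto simp: main_part_def between_def)
  qed
  have "qbinom (Suc k - s) (j - s) * num_above k j = (\<Sum>T\<in>?T. num_above k j)"
    using card_between[of S M j] s M j by simp
  also have "\<dots> = (\<Sum>T\<in>?T. real (card {F\<in>?A. T \<subseteq> F}))"
  proof (rule sum.cong)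
    fix T assume T: "T \<in> ?T"
    have "{F\<in>?A. T \<subseteq> F} = {F\<in>subs k. T \<subseteq> F}"
      using in_main[OF _ T] by (auto simp: main_part_def)
    thus "num_above k j = real (card {F\<in>?A. T \<subseteq> F})" using card_above[of T k] T by (simp add: between_def)
  qed simp
  also have "\<dots> = (\<Sum>F\<in>?A. real (card {T\<in>?T. T \<subseteq> F}))"
    using sum.swap_restrict[of ?A ?T "\<lambda>_ _. 1::nat" "\<lambda>F T. T \<subseteq> F"]
    by (simp only: finite_vec_sets card_eq_sum of_nat_sum[symmetric])
  also have "\<dots> = (\<Sum>F\<in>?A. qbinom (dim (F \<inter> M) - s) (j - s))"
  proof (rule sum.cong)
    fix F assume F: "F \<in> ?A"
    have "{T\<in>?T. T \<subseteq> F} = between S (F \<inter> M) j" by (auto simp: between_def)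
    thus "real (card {T\<in>?T. T \<subseteq> F}) = qbinom (dim (F \<inter> M) - s) (j - s)"
      using card_between[of S "F \<inter> M" j] s M F j by (auto simp: main_part_def)
  qed simp
  finally show ?thesis .
qed

text \<open>The sum on the right is the overcount caused by members meeting \<open>M\<close> in more
  than \<open>s + 1\<close> dimensions.\<close>

lemma main_part_count_1:
  assumes "S \<in> subs s" "M \<in> subs (Suc k)" "S \<subseteq> M"
  shows "qnum (Suc k - s) * num_above k (Suc s) =
    card (main_part s k S M) + (\<Sum>F\<in>main_part s k S M. real (q * qnum (dim (F \<inter> M) - Suc s)))"
proof -
  have "qbinom (dim (F \<inter> M) - s) (Suc 0) = 1 + real (q * qnum (dim (F \<inter> M) - Suc s))"
    if F: "F \<in> main_part s k S M" for F
  proof -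
    have "dim (F \<inter> M) - s = Suc (dim (F \<inter> M) - Suc s)" using F by (auto simp: main_part_def)
    thus ?thesis by (simp only: qbinom_1) (simp add: qnum_Suc')
  qed
  hence "(\<Sum>F\<in>main_part s k S M. qbinom (dim (F \<inter> M) - s) (Suc 0)) =
      (\<Sum>F\<in>main_part s k S M. 1 + real (q * qnum (dim (F \<inter> M) - Suc s)))"
    by (intro sum.cong refl)
  thus ?thesis using main_part_count[OF assms, of "Suc s"] by (simp add: sum.distrib)
qed

text \<open>The overcount of each member is at most \<open>q\<close> times the number of its
  (s+2)-spaces between \<open>S\<close> and \<open>M\<close>, and their total is known from
  \<open>main_part_count\<close>.\<close>

lemma card_main_part_ge:
  assumes "S \<in> subs s" "M \<in> subs (Suc k)" "S \<subseteq> M"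
  shows "qnum (Suc k - s) * num_above k (Suc s) - q * qbinom (Suc k - s) 2 * num_above k (Suc (Suc s))
    \<le> card (main_part s k S M)"
proof -
  have "real (q * qnum (dim (F \<inter> M) - Suc s)) \<le> q * qbinom (dim (F \<inter> M) - s) 2"
    if F: "F \<in> main_part s k S M" for F
  proof -
    obtain i where i: "dim (F \<inter> M) - s = Suc i" "dim (F \<inter> M) - Suc s = i"
      using F by (auto simp: main_part_def intro: that[of "dim (F \<inter> M) - Suc s"])
    have "qnum i * (q + 1) \<le> qnum i * qnum (Suc i)"
    proof (cases i)
      case (Suc l)
      have "qnum 2 \<le> qnum (Suc i)" using Suc by (intro qnum_mono) simp
      thus ?thesis by (intro mult_left_mono) (simp_all add: qnum_Suc numeral_2_eq_2)
    qed simp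
    hence "real (qnum i * (q + 1)) \<le> real (qnum i * qnum (Suc i))" by (simp only: of_nat_le_iff)
    hence "qnum i * real (q + 1) \<le> qbinom (Suc i) 2 * real (q + 1)"
      unfolding qbinom_2 by (simp only: of_nat_mult mult.commute)
    hence "qnum i \<le> qbinom (Suc i) 2" by (subst (asm) mult_le_cancel_right_pos) simp_all
    thus ?thesis unfolding i using q_ge_2 by simp
  qed
  hence "(\<Sum>F\<in>main_part s k S M. real (q * qnum (dim (F \<inter> M) - Suc s)))
    \<le> (\<Sum>F\<in>main_part s k S M. q * qbinom (dim (F \<inter> M) - s) 2)" by (rule sum_mono)
  also have "\<dots> = q * (qbinom (Suc k - s) 2 * num_above k (Suc (Suc s)))"
    using main_part_count[OF assms, of "Suc (Suc s)"] by (simp add: sum_distrib_left Suc_diff_le numeral_2_eq_2)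
  finally show ?thesis using main_part_count_1[OF assms] by simp
qed

(* In this tie both extremal configurations have equally many covers and the
   second-order terms decide. *)
lemma card_main_part_le:
  assumes S: "S \<in> subs s" and M: "M \<in> subs (Suc k)" "S \<subseteq> M" and k: "k = 2 * s + 1"
  shows "card (main_part s k S M) \<le>
    qnum (Suc (Suc s)) * num_above k (Suc s) - q * qnum (Suc (Suc s)) * num_above k (Suc (Suc s))"
proof -
  let ?A = "main_part s k S M"
  have ks: "Suc k - s = Suc (Suc s)" using k by simp
  \<comment> \<open>The overcount is now bounded from below: \<open>F \<inter> M\<close> exceeds
    \<open>S\<close> by at most \<open>k - s = s + 1\<close> dimensions, so at most
    \<open>qnum (Suc s)\<close> is lost in the comparison.\<close>
  have "q * (q + 1) * qbinom (dim (F \<inter> M) - s) 2 \<le> qnum (Suc s) * real (q * qnum (dim (F \<inter> M) - Suc s))"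
    if F: "F \<in> ?A" for F
  proof -
    obtain i where i: "dim (F \<inter> M) - s = Suc i" "dim (F \<inter> M) - Suc s = i"
      using F by (auto simp: main_part_def intro: that[of "dim (F \<inter> M) - Suc s"])
    have "dim (F \<inter> M) \<le> dim F" by (intro dim_subset) auto
    hence "dim (F \<inter> M) - s \<le> Suc s" using F k by (simp add: main_part_def)
    hence "qnum (Suc i) \<le> qnum (Suc s)" unfolding i by (rule qnum_mono)
    hence le: "real (qnum (Suc i)) * (q * qnum i) \<le> real (qnum (Suc s)) * (q * qnum i)"
      by (intro mult_right_mono) auto
    have "q * (q + 1) * qbinom (Suc i) 2 = q * (qbinom (Suc i) 2 * (q + 1))" by (simp add: algebra_simps)
    also have "\<dots> = real (qnum (Suc i)) * (q * qnum i)" by (simp only: qbinom_2) simp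
    finally show ?thesis using le unfolding i by simp
  qed
  hence "(\<Sum>F\<in>?A. q * (q + 1) * qbinom (dim (F \<inter> M) - s) 2)
    \<le> (\<Sum>F\<in>?A. qnum (Suc s) * real (q * qnum (dim (F \<inter> M) - Suc s)))" by (rule sum_mono)
  hence "q * (q + 1) * (\<Sum>F\<in>?A. qbinom (dim (F \<inter> M) - s) 2)
    \<le> qnum (Suc s) * (\<Sum>F\<in>?A. real (q * qnum (dim (F \<inter> M) - Suc s)))"
    by (simp only: sum_distrib_left)
  also have "(\<Sum>F\<in>?A. qbinom (dim (F \<inter> M) - s) 2) = qbinom (Suc (Suc s)) 2 * num_above k (Suc (Suc s))"
    using main_part_count[OF S M, of "Suc (Suc s)"] ks by (simp add: Suc_diff_le numeral_2_eq_2)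
  also have "q * (q + 1) * (qbinom (Suc (Suc s)) 2 * num_above k (Suc (Suc s))) =
    q * (qbinom (Suc (Suc s)) 2 * (q + 1)) * num_above k (Suc (Suc s))" by (simp add: algebra_simps)
  also have "\<dots> = qnum (Suc s) * (q * qnum (Suc (Suc s)) * num_above k (Suc (Suc s)))"
    by (simp only: qbinom_2) simp
  finally have "q * qnum (Suc (Suc s)) * num_above k (Suc (Suc s)) \<le>
      (\<Sum>F\<in>?A. real (q * qnum (dim (F \<inter> M) - Suc s)))"
    using qnum_pos[of "Suc s"] by (subst (asm) mult_le_cancel_left_pos) simp_all
  thus ?thesis using main_part_count_1[OF S M] unfolding ks by simp
qed

text \<open>The count is independent of the choice of \<open>S\<close> and \<open>M\<close>; see
  \<open>card_main_extra\<close>.\<close>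

lemma card_extra_part:
  assumes S: "S \<in> subs s" and M: "M \<in> subs (Suc k)" "S \<subseteq> M" and "s \<le> k"
  shows "card (extra_part k S M) = qnum (Suc k) - qnum (Suc k - s)"
proof -
  have s: "subspace S" "dim S = s" "subspace M" "dim M = Suc k" "{0} \<subseteq> S" "{0} \<subseteq> M"
    using S M subspace_0 by auto
  have "extra_part k S M = between {0} M k - between S M k"
    using subspace_0 by (auto simp: extra_part_def between_def)
  moreover have "between S M k \<subseteq> between {0} M k" using s by (auto simp: between_def)
  ultimately have "card (extra_part k S M) = card (between {0} M k) - card (between S M k)"
    by (simp add: card_Diff_subset)
  thus ?thesis using card_hyperplanes[of "{0}" M k] card_hyperplanes[of S M k] s M \<open>s \<le> k\<close> by simp
qed

lemma num_above_ge_1: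
  assumes "j \<le> dim (UNIV :: 'b set)" "u \<le> j"
  shows "1 \<le> num_above j u"
  using assms(2)
proof (induction rule: inc_induct)
  case (step u)
  have "1 * 1 \<le> num_above j (Suc u) * real (q ^ (dim (UNIV :: 'b set) - j))"
    using step q_ge_2 by (intro mult_mono) (simp_all del: of_nat_power)
  thus ?case using num_above_Suc[OF assms(1), of u] by simp
qed simp

lemma qnum_add: "qnum (a + b) = qnum a + q ^ a * qnum b"
  by (induction b) (simp_all add: qnum_Suc power_add algebra_simps)

text \<open>Leading terms agree. In second order the main part falls short by at least
  \<open>q ^ (s + 2) * ?P\<close>, and the extra part regains only
  \<open>q ^ (s + 2) * qnum s\<close>.\<close>

lemma main_extra_less_near:
  assumes S: "S \<in> subs s" and M: "M \<in> subs (Suc k)" "S \<subseteq> M" and M': "M' \<in> subs (Suc k)" "S \<subseteq> M'"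
    and k: "k = 2 * s + 1" and "2 \<le> s" and n: "4 * k + 6 \<le> dim (UNIV :: 'b set)"
    and Z: "Z \<in> subs (Suc (Suc s))"
  shows "card (main_part s k S M' \<union> extra_part k S M) < card (near s k Z)"
proof -
  let ?P = "num_above k (Suc (Suc s))" and ?N = "num_above k (Suc s)"
  have "card (main_part s k S M' \<union> extra_part k S M) \<le> card (main_part s k S M') + card (extra_part k S M)"
    by (rule card_Un_le)
  also have "card (extra_part k S M) = q ^ Suc (Suc s) * qnum s"
    using card_extra_part[OF S M] k qnum_add[of "Suc (Suc s)" s] by (simp add: mult_2)
  finally have "real (card (main_part s k S M' \<union> extra_part k S M))
      \<le> real (card (main_part s k S M')) + q ^ Suc (Suc s) * qnum s" by (simp flip: of_nat_add of_nat_mult of_nat_power)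
  also have "\<dots> \<le> qnum (Suc (Suc s)) * ?N - q * qnum (Suc (Suc s)) * ?P + q ^ Suc (Suc s) * qnum s"
    using card_main_part_le[OF S M' k] by simp
  also have "\<dots> < qnum (Suc (Suc s)) * ?N - q * qnum (Suc (Suc s)) * ?P + q ^ Suc (Suc s) * ?P"
  proof -
    have "real (qnum s) < real (q ^ s)" using qnum_less by simp
    also have "\<dots> \<le> real (q ^ (dim (UNIV :: 'b set) - k))"
      unfolding of_nat_le_iff using n k q_ge_2 by (intro power_increasing) (auto simp del: dim_UNIV)
    \<comment> \<open>A space of dimension \<open>s + 3\<close> still fits into a k-space, since
      \<open>k = 2 * s + 1\<close> and \<open>2 \<le> s\<close>.\<close>
    also have "\<dots> \<le> num_above k (Suc (Suc (Suc s))) * real (q ^ (dim (UNIV :: 'b set) - k))"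
      using num_above_ge_1[of k "Suc (Suc (Suc s))"] n k \<open>2 \<le> s\<close> mult_right_mono[of 1 "num_above k (Suc (Suc (Suc s)))"]
      by (simp del: dim_UNIV of_nat_power)
    also have "\<dots> \<le> ?P" using num_above_Suc[of k "Suc (Suc s)"] n by (simp del: dim_UNIV)
    finally have "qnum s < ?P" .
    moreover have "real (q ^ Suc (Suc s)) > 0" using q_ge_2 by simp
    ultimately show ?thesis by (intro add_strict_left_mono) (simp only: of_nat_mult mult_less_cancel_left_pos)
  qed
  also have "\<dots> = qnum (Suc (Suc s)) * ?N - q * qnum (Suc s) * ?P"
    by (simp add: qnum_Suc algebra_simps)
  also have "\<dots> = card (near s k Z)" by (rule card_near[OF Z, symmetric])
  finally show ?thesis by simp
qed

lemma near_large:
  assumes Z: "Z \<in> subs (Suc (Suc s))" and "s < k" and n: "4 * k + 6 \<le> dim (UNIV :: 'b set)"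
  shows "((qnum (Suc (Suc s)))\<^sup>2 - 1 / 2) * (num_above k (Suc s))\<^sup>2 \<le> (real (card (near s k Z)))\<^sup>2"
unfolding of_nat_power
proof (rule square_bound)
  let ?Q = "q ^ (dim (UNIV :: 'b set) - k)"
  show "num_above k (Suc (Suc s)) * ?Q \<le> num_above k (Suc s)" using num_above_Suc[of k "Suc s"] n by (simp del: dim_UNIV)
  show "real (qnum (Suc (Suc s))) * num_above k (Suc s) - real (q * qnum (Suc s)) * num_above k (Suc (Suc s))
      \<le> card (near s k Z)" using card_near[OF Z] by simp
  have "4 * qnum (Suc (Suc s)) * (q * qnum (Suc s)) \<le> q ^ 2 * q ^ Suc (Suc s) * (q * q ^ Suc s)"
  proof (intro mult_le_mono order_refl)
    have "2 ^ 2 \<le> q ^ 2" using q_ge_2 by (intro power_mono) auto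
    thus "4 \<le> q ^ 2" by simp
  qed (use qnum_less less_imp_le in blast)+
  also have "\<dots> = q ^ (2 + Suc (Suc s) + Suc (Suc s))" by (simp only: power_add power_Suc)
  also have "\<dots> \<le> ?Q" using assms q_ge_2 by (intro power_increasing) (auto simp del: dim_UNIV)
  finally have "real (4 * qnum (Suc (Suc s)) * (q * qnum (Suc s))) \<le> real ?Q" by (simp only: of_nat_le_iff)
  thus "4 * real (qnum (Suc (Suc s))) * real (q * qnum (Suc s)) \<le> ?Q" by simp
  show "1 \<le> real (qnum (Suc (Suc s)))" using qnum_pos[of "Suc (Suc s)"] by simp
qed (use q_ge_2 in simp_all)

text \<open>The main part alone gives the required lower bound, so the extra part is dropped from
  the estimate.\<close>

lemma main_part_large:
  assumes S: "S \<in> subs s" and M: "M \<in> subs (Suc k)" "S \<subseteq> M" and "2 \<le> s" "s < k"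
    and n: "4 * k + 6 \<le> dim (UNIV :: 'b set)" and h: "real (card (main_part s k S M)) \<le> h"
  shows "((qnum (Suc k - s))\<^sup>2 - 1 / 2) * (num_above k (Suc s))\<^sup>2 \<le> h\<^sup>2"
unfolding of_nat_power
proof (rule square_bound)
  let ?Q = "q ^ (dim (UNIV :: 'b set) - k)"
  show "num_above k (Suc (Suc s)) * ?Q \<le> num_above k (Suc s)" using num_above_Suc[of k "Suc s"] n by (simp del: dim_UNIV)
  show "real (qnum (Suc k - s)) * num_above k (Suc s) - (q * qbinom (Suc k - s) 2) * num_above k (Suc (Suc s)) \<le> h"
    using card_main_part_ge[OF S M] h by simp
  have e: "Suc k - s = Suc (k - s)" using \<open>s < k\<close> by simp
  have "4 * qnum (Suc k - s) * (q * (qnum (Suc (k - s)) * qnum (k - s)))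
    \<le> q ^ 2 * q ^ (Suc k - s) * (q * (q ^ Suc (k - s) * q ^ (k - s)))"
  proof (intro mult_le_mono order_refl)
    have "2 ^ 2 \<le> q ^ 2" using q_ge_2 by (intro power_mono) auto
    thus "4 \<le> q ^ 2" by simp
  qed (use qnum_less less_imp_le in blast)+
  also have "\<dots> = q ^ (2 + (Suc k - s) + Suc (Suc (k - s) + (k - s)))"
    by (simp only: power_add power_Suc mult.assoc)
  also have "\<dots> \<le> ?Q" using assms q_ge_2 by (intro power_increasing) (auto simp del: dim_UNIV)
  finally have 1: "real (4 * qnum (Suc k - s) * (q * (qnum (Suc (k - s)) * qnum (k - s)))) \<le> real ?Q"
    by (simp only: of_nat_le_iff)
  have "qbinom (Suc (k - s)) 2 * 1 \<le> qbinom (Suc (k - s)) 2 * (q + 1)" by (intro mult_left_mono) auto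
  hence "qbinom (Suc (k - s)) 2 \<le> qnum (Suc (k - s)) * qnum (k - s)" by (simp only: qbinom_2)
  hence "4 * real (qnum (Suc k - s)) * (q * qbinom (Suc k - s) 2)
    \<le> 4 * real (qnum (Suc k - s)) * (q * (qnum (Suc (k - s)) * qnum (k - s)))"
    unfolding e by (intro mult_left_mono) (auto intro!: mult_left_mono)
  thus "4 * real (qnum (Suc k - s)) * (q * qbinom (Suc k - s) 2) \<le> ?Q" using 1 by simp
  show "1 \<le> real (qnum (Suc k - s))" using qnum_pos[of "Suc k - s"] \<open>s < k\<close> by simp
qed (use q_ge_2 in simp_all)

end

section \<open>From pairs to r families\<close>

text \<open>If one number exceeded \<open>h\<close>, all others would be below \<open>h\<close>.
  Pairing it with a second one yields at most \<open>h * h\<close>, and a third one makes the total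
  product too small.\<close>

lemma all_eq_if_pairwise_products_le:
  fixes c :: "'i \<Rightarrow> nat"
  assumes I: "finite I" "3 \<le> card I"
    and pairs: "\<And>i j. i \<in> I \<Longrightarrow> j \<in> I \<Longrightarrow> i \<noteq> j \<Longrightarrow> c i * c j \<le> h * h"
    and prod: "h ^ card I \<le> (\<Prod>i\<in>I. c i)" and h: "0 < h"
    and i: "i \<in> I"
  shows "c i = h"
proof -
  have le: "c i \<le> h" if i: "i \<in> I" for i
  proof (rule ccontr)
    assume "\<not> c i \<le> h"
    hence gt: "h < c i" by simp
    have lt: "c j < h" if "j \<in> I - {i}" for j
    proof (rule ccontr)
      assume "\<not> c j < h"
      hence "h * h < c i * c j" using gt h by (intro mult_less_le_imp_less) auto
      thus False using pairs[of i j] that i by auto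
    qed
    have "card (I - {i}) \<ge> 2" using I i by simp
    then obtain j where j: "j \<in> I - {i}" by (metis card.empty ex_in_conv not_numeral_le_zero)
    have cIj: "card (I - {i} - {j}) = card I - 2" using I i j by (simp add: card_Diff_singleton)
    hence "I - {i} - {j} \<noteq> {}" using I by (metis card.empty diff_is_0_eq not_less_eq_eq numeral_2_eq_2 numeral_3_eq_3)
    then obtain l where l: "l \<in> I - {i} - {j}" by blast
    have "(\<Prod>i\<in>I - {i} - {j} - {l}. c i) \<le> (\<Prod>i\<in>I - {i} - {j} - {l}. h)"
      using lt by (intro prod_mono) (auto intro: less_imp_le)
    also have "\<dots> = h ^ (card I - 3)" using l cIj I by (simp add: card_Diff_singleton)
    finally have P: "(\<Prod>i\<in>I - {i} - {j} - {l}. c i) \<le> h ^ (card I - 3)" .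
    have "c i * c j \<le> h * h" by (rule pairs) (use i j in auto)
    hence "c i * c j * (c l * (\<Prod>i\<in>I - {i} - {j} - {l}. c i)) \<le> h * h * (c l * h ^ (card I - 3))"
      by (rule mult_le_mono[OF _ mult_le_mono[OF order_refl P]])
    also have "\<dots> < h * h * (h * h ^ (card I - 3))" using lt[of l] l h by simp
    also have "\<dots> = h ^ Suc (Suc (Suc (card I - 3)))" by simp
    also have "Suc (Suc (Suc (card I - 3))) = card I" using I by simp
    finally have "c i * c j * (c l * (\<Prod>i\<in>I - {i} - {j} - {l}. c i)) < h ^ card I" .
    moreover have "(\<Prod>i\<in>I. c i) = c i * (c j * (c l * (\<Prod>i\<in>I - {i} - {j} - {l}. c i)))"
      using I i j l by (simp only: prod.remove[of I i] prod.remove[of "I - {i}" j]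
        prod.remove[of "I - {i} - {j}" l] finite_Diff)
    ultimately show False using prod by (simp only: mult.assoc)
  qed
  have "\<not> c i < h"
  proof
    assume lt: "c i < h"
    have "(\<Prod>i\<in>I - {i}. c i) \<le> (\<Prod>i\<in>I - {i}. h)" using le by (intro prod_mono) auto
    hence "c i * (\<Prod>i\<in>I - {i}. c i) \<le> c i * h ^ (card I - 1)" using I i by (simp add: card_Diff_singleton)
    also have "\<dots> < h * h ^ (card I - 1)" using lt h by simp
    also have "\<dots> = h ^ card I" using I by (cases "card I") auto
    finally show False using prod prod.remove[OF I(1) i, of c] by simp
  qed
  thus ?thesis using le[OF i] by simp
qed

context finite_vector_space
begin

text \<open>The sets of covers are recorded because they determine \<open>S\<close>,
  \<open>M\<close> and \<open>M'\<close>; this allows pairs with a common family to be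
  compared.\<close>

definition extremal_pair :: "nat \<Rightarrow> nat \<Rightarrow> 'b set set \<Rightarrow> 'b set set \<Rightarrow> bool" where
  "extremal_pair s k \<F> \<G> \<longleftrightarrow>
    (k \<le> 2 * s + 1 \<and> (\<exists>Z\<in>subs (Suc (Suc s)). \<F> = near s k Z \<and> \<G> = near s k Z)) \<or>
    (2 * s + 1 < k \<and> (\<exists>S\<in>subs s. \<exists>M\<in>subs (Suc k). \<exists>M'\<in>subs (Suc k). S \<subseteq> M \<and> S \<subseteq> M' \<and>
       covers s \<F> = between S M (Suc s) \<and> covers s \<G> = between S M' (Suc s) \<and>
       \<F> = main_part s k S M' \<union> extra_part k S M \<and>
       \<G> = main_part s k S M \<union> extra_part k S M'))"

(* For k > 2s + 1 only an upper bound is required, so h can be taken as the maximum over all pairs S, M;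
   this avoids showing that the size does not depend on S and M. *)
definition extremal_size :: "nat \<Rightarrow> nat \<Rightarrow> nat \<Rightarrow> bool" where
  "extremal_size s k h \<longleftrightarrow>
    (k \<le> 2 * s + 1 \<longrightarrow> (\<forall>Z\<in>subs (Suc (Suc s)). card (near s k Z) = h)) \<and>
    (2 * s + 1 < k \<longrightarrow> (\<forall>S\<in>subs s. \<forall>M\<in>subs (Suc k). S \<subseteq> M \<longrightarrow>
       card (main_part s k S M \<union> extra_part k S M) \<le> h)) \<and>
    ((qnum (max (Suc k - s) (Suc (Suc s))))\<^sup>2 - 1 / 2) * (num_above k (Suc s))\<^sup>2 \<le> (real h)\<^sup>2"

text \<open>A pair using different \<open>M\<close> and \<open>M'\<close> is therefore no larger
  than what \<open>extremal_size\<close> bounds for a single one.\<close>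

lemma card_main_extra:
  assumes "S \<in> subs s" "M \<in> subs (Suc k)" "S \<subseteq> M" "M' \<in> subs (Suc k)" "S \<subseteq> M'" "s \<le> k"
  shows "card (main_part s k S M' \<union> extra_part k S M) = card (main_part s k S M' \<union> extra_part k S M')"
proof -
  have "main_part s k S X \<inter> extra_part k S Y = {}" for X Y
    by (auto simp: main_part_def extra_part_def)
  thus ?thesis using assms by (simp add: card_Un_disjoint card_extra_part)
qed

end

context cross_pair
begin

text \<open>The second alternative bounds both sizes separately, and not just their product: with
  \<open>card \<F> \<le> h\<close> for the closure, a subfamily of size \<open>h\<close> must be the
  closure itself.\<close>

lemma pair_bound:
  assumes h: "extremal_size s k h"
  shows "card \<F> * card \<G> < h * h \<or>
    card \<F> \<le> h \<and> card \<G> \<le> h \<and> (card \<F> = h \<and> card \<G> = h \<longrightarrow> extremal_pair s k \<F> \<G>)"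
proof -
  define m where "m = max (Suc k - s) (Suc (Suc s))"
  have hm: "((qnum m)\<^sup>2 - 1 / 2) * (num_above k (Suc s))\<^sup>2 \<le> (real h)\<^sup>2"
    using h unfolding extremal_size_def m_def by blast
  have eqI: "\<A> = X" if "\<A> \<subseteq> X" "card X \<le> h" "card \<A> = h" for \<A> X :: "'b set set"
    using that by (intro card_seteq) auto
  have leI: "card \<A> \<le> h" if "\<A> \<subseteq> X" "card X \<le> h" for \<A> X :: "'b set set"
    using that card_mono[of X \<A>] by simp
  from product_cases[OF m_def hm] show ?thesis
  proof
    assume "real (card \<F>) * real (card \<G>) < (real h)\<^sup>2"
    hence "real (card \<F> * card \<G>) < real (h * h)" by (simp add: power2_eq_square)
    thus ?thesis by (intro disjI1) (simp only: of_nat_less_iff)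
  next
    assume *: "clique s (covers s \<F>) \<and> clique s (covers s \<G>) \<and>
      card (covers s \<F>) = qnum m \<and> card (covers s \<G>) = qnum m"
    have "(k \<le> 2 * s + 1 \<and> (\<exists>Z\<in>subs (Suc (Suc s)). \<F> \<subseteq> near s k Z \<and> \<G> \<subseteq> near s k Z)) \<or>
      (2 * s + 1 \<le> k \<and> (\<exists>S\<in>subs s. \<exists>M\<in>subs (Suc k). \<exists>M'\<in>subs (Suc k). S \<subseteq> M \<and> S \<subseteq> M' \<and>
       covers s \<F> = between S M (Suc s) \<and> covers s \<G> = between S M' (Suc s) \<and>
       \<F> \<subseteq> main_part s k S M' \<union> extra_part k S M \<and>
       \<G> \<subseteq> main_part s k S M \<union> extra_part k S M'))"
      by (rule pair_structure[OF m_def]) (use * in simp_all)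
    thus ?thesis
    proof (elim disjE conjE bexE)
      fix Z assume Z: "k \<le> 2 * s + 1" "Z \<in> subs (Suc (Suc s))" "\<F> \<subseteq> near s k Z" "\<G> \<subseteq> near s k Z"
      have c: "card (near s k Z) \<le> h" using h Z(1,2) unfolding extremal_size_def by simp
      have "extremal_pair s k \<F> \<G>" if "card \<F> = h" "card \<G> = h"
        using eqI[OF Z(3) c that(1)] eqI[OF Z(4) c that(2)] Z(1,2)
        unfolding extremal_pair_def by (intro disjI1 conjI bexI[of _ Z])
      thus ?thesis using leI[OF Z(3) c] leI[OF Z(4) c] by blast
    next
      fix S M M' assume k: "2 * s + 1 \<le> k"
        and SM: "S \<in> subs s" "M \<in> subs (Suc k)" "M' \<in> subs (Suc k)" "S \<subseteq> M" "S \<subseteq> M'"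
        and cov: "covers s \<F> = between S M (Suc s)" "covers s \<G> = between S M' (Suc s)"
        and sub: "\<F> \<subseteq> main_part s k S M' \<union> extra_part k S M" "\<G> \<subseteq> main_part s k S M \<union> extra_part k S M'"
      show ?thesis
      proof (cases "k = 2 * s + 1")
        \<comment> \<open>In the tie the star configuration is strictly smaller than
          \<open>near\<close>, so the product bound is strict.\<close>
        case True
        obtain Z where "Z \<in> between {0} UNIV (Suc (Suc s))"
          using exists_between[of "{0}" UNIV "Suc (Suc s)"] sk n_ge by (auto simp: subspace_0 simp del: dim_UNIV)
        hence Z: "Z \<in> subs (Suc (Suc s))" by (simp add: between_def)
        have hZ: "card (near s k Z) = h" using h Z True unfolding extremal_size_def by simp
        have "card \<F> \<le> card (main_part s k S M' \<union> extra_part k S M)" by (intro card_mono sub) simp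
        also have "\<dots> < h"
          using main_extra_less_near[OF SM(1,2,4,3,5) True sk(1) n_ge Z] hZ by simp
        finally have 1: "card \<F> < h" .
        have "card \<G> \<le> card (main_part s k S M \<union> extra_part k S M')" by (intro card_mono sub) simp
        also have "\<dots> < h"
          using main_extra_less_near[OF SM(1,3,5,2,4) True sk(1) n_ge Z] hZ by simp
        finally have "card \<G> < h" .
        with 1 have "card \<F> * card \<G> < h * h" by (intro mult_strict_mono') auto
        thus ?thesis ..
      next
        case False
        hence k': "2 * s + 1 < k" using k by simp
        have H: "card (main_part s k S X \<union> extra_part k S X) \<le> h" if "X \<in> subs (Suc k)" "S \<subseteq> X" for X
          using h k' SM(1) that unfolding extremal_size_def by blast
        have c: "card (main_part s k S M' \<union> extra_part k S M) \<le> h"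
          using card_main_extra[OF SM(1,2,4,3,5)] H[OF SM(3,5)] sk by simp
        have c': "card (main_part s k S M \<union> extra_part k S M') \<le> h"
          using card_main_extra[OF SM(1,3,5,2,4)] H[OF SM(2,4)] sk by simp
        have "extremal_pair s k \<F> \<G>" if "card \<F> = h" "card \<G> = h"
          unfolding extremal_pair_def
          by (intro disjI2 conjI bexI[of _ S] bexI[of _ M] bexI[of _ M'] k' SM cov
              eqI[OF sub(1) c that(1)] eqI[OF sub(2) c' that(2)])
        thus ?thesis using leI[OF sub(1) c] leI[OF sub(2) c'] by blast
      qed
    qed
  qed
qed

end

section \<open>Arbitrary pairs, and agreement between several families\<close>

context finite_vector_space
begin

lemma nontrivial_mono: "nontrivial s \<F> \<Longrightarrow> \<F> \<subseteq> \<F>' \<Longrightarrow> nontrivial s \<F>'"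
  unfolding nontrivial_def by (meson subsetD)

text \<open>Given covers \<open>T\<close> and \<open>T'\<close>, extend \<open>T'\<close> to a
  k-space \<open>K\<close> without enlarging its intersection with \<open>T\<close>. Then
  \<open>K\<close> belongs to the closure, so \<open>T\<close> meets \<open>K\<close>, and hence
  \<open>T'\<close>, in dimension \<open>s\<close>.\<close>

lemma cross_pair_closure:
  assumes sk: "2 \<le> s" "s < k" and n: "4 * k + 6 \<le> dim (UNIV :: 'b set)"
    and G: "\<G> \<subseteq> subs k" and F': "\<F>' = {K \<in> subs k. meets s K \<G>}"
    and nF: "nontrivial s \<F>'" and nG: "nontrivial s \<G>"
  shows "cross_pair scale Basis q s k \<F>' \<G>"
proof
  show "s \<le> dim (F \<inter> G)" if "F \<in> \<F>'" "G \<in> \<G>" for F G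
    using that by (auto simp: F' meets_def)
  show "s \<le> dim (T \<inter> T')" if "T \<in> covers s \<F>'" "T' \<in> covers s \<G>" for T T'
  proof -
    have T: "subspace T" "dim T = Suc s" "meets s T \<F>'" and T': "subspace T'" "dim T' = Suc s" "meets s T' \<G>"
      using that by (auto simp: covers_def)
    have "dim (join T' T) \<le> Suc s + Suc s" using dim_join[of T' T] T T' by simp
    then obtain K where K: "subspace K" "T' \<subseteq> K" "dim K = k" "K \<inter> T = T' \<inter> T"
      using exists_extension_avoiding[of T' T UNIV k] T T' sk n by (auto simp del: dim_UNIV)
    have "K \<in> \<F>'" using K meets_mono[OF T'(3) K(2)] by (simp add: F')
    hence "s \<le> dim (T \<inter> K)" using T by (auto simp: meets_def)
    thus ?thesis using K(4) by (simp add: Int_commute)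
  qed
qed (use assms in auto)

lemma pair_bound_general:
  assumes sk: "2 \<le> s" "s < k" and n: "4 * k + 6 \<le> dim (UNIV :: 'b set)"
    and F: "\<F> \<subseteq> subs k" and G: "\<G> \<subseteq> subs k"
    and cross: "\<And>F G. F \<in> \<F> \<Longrightarrow> G \<in> \<G> \<Longrightarrow> s \<le> dim (F \<inter> G)"
    and nF: "nontrivial s \<F>" and nG: "nontrivial s \<G>" and h: "extremal_size s k h"
  shows "card \<F> * card \<G> \<le> h * h" and "card \<F> = h \<Longrightarrow> card \<G> = h \<Longrightarrow> extremal_pair s k \<F> \<G>"
proof -
  define \<F>' where "\<F>' = {K \<in> subs k. meets s K \<G>}"
  have sub: "\<F> \<subseteq> \<F>'"
  proof
    fix K assume K: "K \<in> \<F>"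
    hence "K \<in> subs k" using F by blast
    moreover have "meets s K \<G>" using cross K by (simp add: meets_def)
    ultimately show "K \<in> \<F>'" by (simp add: \<F>'_def)
  qed
  interpret cross_pair scale Basis q s k \<F>' \<G>
    by (rule cross_pair_closure[OF sk n G \<F>'_def nontrivial_mono[OF nF sub] nG])
  have cle: "card \<F> \<le> card \<F>'" by (intro card_mono sub) simp
  hence le: "card \<F> * card \<G> \<le> card \<F>' * card \<G>" by (rule mult_le_mono1)
  note pb = pair_bound[OF h]
  have "card \<F>' * card \<G> \<le> h * h" using pb by (auto intro: mult_le_mono)
  with le show "card \<F> * card \<G> \<le> h * h" by (rule order_trans)
  assume c: "card \<F> = h" "card \<G> = h"
  have "\<not> card \<F>' * card \<G> < h * h" using le c by (simp only: not_less)
  hence pb': "card \<F>' \<le> h" "card \<F>' = h \<and> card \<G> = h \<longrightarrow> extremal_pair s k \<F>' \<G>" using pb by blast+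
  have "\<F> = \<F>'" using sub pb'(1) c by (intro card_seteq) auto
  thus "extremal_pair s k \<F> \<G>" using pb' c by simp
qed

text \<open>\<open>S\<close> is the common part of the level and \<open>M\<close> its union.\<close>

lemma between_Suc_inject:
  assumes S: "S \<in> subs s" "S' \<in> subs s" and M: "M \<in> subs (Suc k)" "M' \<in> subs (Suc k)"
    and SM: "S \<subseteq> M" "S' \<subseteq> M'" and "s < k" and eq: "between S M (Suc s) = between S' M' (Suc s)"
  shows "S = S'" and "M = M'"
proof -
  have "S' \<subseteq> S"
  proof (rule ccontr)
    assume "\<not> ?thesis"
    then obtain v where v: "v \<in> S'" "v \<notin> S" by blast
    obtain T where T: "T \<in> between S M (Suc s)" "v \<notin> T"
      by (rule between_avoiding[of S M "Suc s" v]) (use S M SM v \<open>s < k\<close> in auto)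
    hence "T \<in> between S' M' (Suc s)" using eq by simp
    thus False using T(2) v by (auto simp: between_def)
  qed
  thus SS: "S = S'" using S subspace_eqI[of S' S] by simp
  have "M \<subseteq> M'" using S M SM eq SS by (intro between_Suc_subset[of S M s M']) auto
  thus "M = M'" using M by (intro subspace_eqI) auto
qed

text \<open>A vector of \<open>M\<close> outside \<open>M'\<close> extends \<open>S\<close> to a
  space \<open>W\<close>; a k-space above \<open>W\<close> adding nothing further in
  \<open>M'\<close> lies in one main part only.\<close>

lemma main_part_inject:
  assumes S: "S \<in> subs s" and M: "M \<in> subs (Suc k)" "S \<subseteq> M" and M': "M' \<in> subs (Suc k)" "S \<subseteq> M'"
    and "s < k" and n: "2 * k + 2 \<le> dim (UNIV :: 'b set)"
    and eq: "main_part s k S M = main_part s k S M'"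
  shows "M = M'"
proof -
  have "M \<subseteq> M'"
  proof
    fix v assume v: "v \<in> M"
    show "v \<in> M'"
    proof (rule ccontr)
      assume v': "v \<notin> M'"
      define W where "W = join S {v}"
      have vS: "v \<notin> S" using v' M' by blast
      have sW: "subspace W" "S \<subseteq> W" "v \<in> W" by (simp_all add: W_def join_upperI)
      have dW: "dim W = Suc s" using vS S by (simp add: W_def dim_join_singleton)
      have WM: "W \<subseteq> M" unfolding W_def using M v by (intro join_least) auto
      have lt: "dim (W \<inter> M') < Suc s" using dim_Int_less[of W M'] sW dW M' v' by auto
      have "dim S \<le> dim (W \<inter> M')" using sW M' by (intro dim_subset) auto
      hence "dim (join W M') \<le> k + 2" using dim_join[of W M'] sW dW M' S by simp
      then obtain K where K: "subspace K" "W \<subseteq> K" "dim K = k" "K \<inter> M' = W \<inter> M'"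
        using exists_extension_avoiding[of W M' UNIV k] sW dW M' \<open>s < k\<close> n by (auto simp del: dim_UNIV)
      have "dim W \<le> dim (K \<inter> M)" using K WM by (intro dim_subset) auto
      hence "K \<in> main_part s k S M" using K sW dW by (auto simp: main_part_def)
      hence "K \<in> main_part s k S M'" using eq by simp
      thus False using lt K(4) by (simp add: main_part_def)
    qed
  qed
  thus ?thesis using M M' by (intro subspace_eqI) auto
qed

lemma extremal_families:
  fixes \<F> :: "'i \<Rightarrow> 'b set set"
  assumes sk: "2 \<le> s" "s < k" and n: "4 * k + 6 \<le> dim (UNIV :: 'b set)" and I: "finite I" "3 \<le> card I"
    and sub: "\<And>i. i \<in> I \<Longrightarrow> \<F> i \<subseteq> subs k" and nontriv: "\<And>i. i \<in> I \<Longrightarrow> nontrivial s (\<F> i)"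
    and cross: "\<And>i j F G. i \<in> I \<Longrightarrow> j \<in> I \<Longrightarrow> i \<noteq> j \<Longrightarrow> F \<in> \<F> i \<Longrightarrow> G \<in> \<F> j \<Longrightarrow> s \<le> dim (F \<inter> G)"
    and h: "extremal_size s k h" "0 < h" and prod: "h ^ card I \<le> (\<Prod>i\<in>I. card (\<F> i))"
  shows "k \<le> 2 * s + 1 \<Longrightarrow> \<exists>Z\<in>subs (Suc (Suc s)). \<forall>i\<in>I. \<F> i = near s k Z"
    and "2 * s + 1 < k \<Longrightarrow> \<exists>M\<in>subs (Suc k). \<exists>S\<in>subs s. S \<subseteq> M \<and>
      (\<forall>i\<in>I. \<F> i = main_part s k S M \<union> extra_part k S M)"
proof -
  have c: "card (\<F> i) = h" if "i \<in> I" for i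
  proof (rule all_eq_if_pairwise_products_le[OF I _ prod h(2) that])
    fix i j assume ij: "i \<in> I" "j \<in> I" "i \<noteq> j"
    show "card (\<F> i) * card (\<F> j) \<le> h * h"
      by (rule pair_bound_general(1)[OF sk n sub sub cross nontriv nontriv h(1)]) (use ij in simp_all)
  qed
  have ex: "extremal_pair s k (\<F> i) (\<F> j)" if ij: "i \<in> I" "j \<in> I" "i \<noteq> j" for i j
    by (rule pair_bound_general(2)[OF sk n sub sub cross nontriv nontriv h(1)]) (use ij c in simp_all)
  have third: "\<exists>l\<in>I. l \<noteq> i \<and> l \<noteq> j" for i j
  proof (rule ccontr)
    assume "\<not> ?thesis"
    hence "card I \<le> card {i, j}" by (intro card_mono) auto
    also have "\<dots> \<le> 2" by (simp add: card_insert_if)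
    finally show False using I by simp
  qed
  have two: "\<exists>i\<in>I. \<exists>j\<in>I. i \<noteq> j" using third by metis
  then obtain i0 j0 where ij0: "i0 \<in> I" "j0 \<in> I" "i0 \<noteq> j0" by blast
  show "\<exists>Z\<in>subs (Suc (Suc s)). \<forall>i\<in>I. \<F> i = near s k Z" if k: "k \<le> 2 * s + 1"
  proof -
    have eq: "\<exists>Z\<in>subs (Suc (Suc s)). \<F> i = near s k Z \<and> \<F> j = near s k Z"
      if "i \<in> I" "j \<in> I" "i \<noteq> j" for i j
      using ex[OF that] k unfolding extremal_pair_def by (elim disjE; elim conjE; (assumption | linarith))
    then obtain Z where Z: "Z \<in> subs (Suc (Suc s))" "\<F> i0 = near s k Z"
      using eq[OF ij0] by (elim bexE conjE)
    have "\<F> i = \<F> i0" if "i \<in> I" for i 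
    proof (cases "i = i0")
      case False
      show ?thesis using eq[OF that ij0(1) False] by (elim bexE conjE) (simp only:)
    qed simp
    thus ?thesis using Z by (intro bexI[of _ Z]) auto
  qed
  show "\<exists>M\<in>subs (Suc k). \<exists>S\<in>subs s. S \<subseteq> M \<and>
      (\<forall>i\<in>I. \<F> i = main_part s k S M \<union> extra_part k S M)" if k: "2 * s + 1 < k"
  proof -
    have ex': "\<exists>S\<in>subs s. \<exists>M\<in>subs (Suc k). \<exists>M'\<in>subs (Suc k). S \<subseteq> M \<and> S \<subseteq> M' \<and>
       covers s (\<F> i) = between S M (Suc s) \<and> covers s (\<F> j) = between S M' (Suc s) \<and>
       \<F> i = main_part s k S M' \<union> extra_part k S M \<and>
       \<F> j = main_part s k S M \<union> extra_part k S M'"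
      if "i \<in> I" "j \<in> I" "i \<noteq> j" for i j
      using ex[OF that] k unfolding extremal_pair_def by (elim disjE; elim conjE; (assumption | linarith))
    have eq: "\<exists>S\<in>subs s. \<exists>M\<in>subs (Suc k). S \<subseteq> M \<and>
        \<F> i = main_part s k S M \<union> extra_part k S M \<and> \<F> j = main_part s k S M \<union> extra_part k S M"
      if ij: "i \<in> I" "j \<in> I" "i \<noteq> j" for i j
    proof -
      obtain l where l: "l \<in> I" "l \<noteq> i" "l \<noteq> j" using third by blast
      obtain S M M' where S: "S \<in> subs s" and M: "M \<in> subs (Suc k)" "M' \<in> subs (Suc k)" "S \<subseteq> M" "S \<subseteq> M'"
        and ij_eq: "covers s (\<F> i) = between S M (Suc s)" "covers s (\<F> j) = between S M' (Suc s)"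
          "\<F> i = main_part s k S M' \<union> extra_part k S M" "\<F> j = main_part s k S M \<union> extra_part k S M'"
        using ex'[OF ij] by (elim bexE conjE)
      obtain S1 M1 L1 where 1: "S1 \<in> subs s" "M1 \<in> subs (Suc k)" "L1 \<in> subs (Suc k)" "S1 \<subseteq> M1" "S1 \<subseteq> L1"
        and il: "covers s (\<F> i) = between S1 M1 (Suc s)" "\<F> l = main_part s k S1 M1 \<union> extra_part k S1 L1"
        using ex'[OF ij(1) l(1) l(2)[symmetric]] by (elim bexE conjE)
      obtain S2 M2 L2 where 2: "S2 \<in> subs s" "M2 \<in> subs (Suc k)" "L2 \<in> subs (Suc k)" "S2 \<subseteq> M2" "S2 \<subseteq> L2"
        and jl: "covers s (\<F> j) = between S2 M2 (Suc s)" "\<F> l = main_part s k S2 M2 \<union> extra_part k S2 L2"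
        using ex'[OF ij(2) l(1) l(3)[symmetric]] by (elim bexE conjE)
      have e1: "S1 = S" "M1 = M"
        using between_Suc_inject[OF 1(1) S 1(2) M(1) 1(4) M(3) sk(2)] il(1) ij_eq(1) by simp_all
      have e2: "S2 = S" "M2 = M'"
        using between_Suc_inject[OF 2(1) S 2(2) M(2) 2(4) M(4) sk(2)] jl(1) ij_eq(2) by simp_all
      \<comment> \<open>The members of the third family above \<open>S\<close> are governed by
        \<open>M\<close> in its pair with \<open>i\<close> and by \<open>M'\<close> in its pair with
        \<open>j\<close>.\<close>
      have "main_part s k S M = {F \<in> \<F> l. S \<subseteq> F}"
        unfolding il(2) e1 by (auto simp: main_part_def extra_part_def)
      moreover have "main_part s k S M' = {F \<in> \<F> l. S \<subseteq> F}"
        unfolding jl(2) e2 by (auto simp: main_part_def extra_part_def)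
      ultimately have "main_part s k S M = main_part s k S M'" by simp
      hence "M = M'" using n by (intro main_part_inject[OF S M(1,3) M(2,4) sk(2)]) auto
      thus ?thesis using S M ij_eq by (intro bexI[of _ S] bexI[of _ M]) auto
    qed
    then obtain S M where SM: "S \<in> subs s" "M \<in> subs (Suc k)" "S \<subseteq> M"
        "\<F> i0 = main_part s k S M \<union> extra_part k S M"
      using eq[OF ij0] by (elim bexE conjE)
    have "\<F> i = \<F> i0" if "i \<in> I" for i 
    proof (cases "i = i0")
      case False
      show ?thesis using eq[OF that ij0(1) False] by (elim bexE conjE) (simp only:)
    qed simp
    thus ?thesis using SM by (intro bexI[of _ M] bexI[of _ S]) auto
  qed
qed


section \<open>Admissibility of the extremal tuples\<close>

lemma dim_subspaces_UNIV: "dim_subspaces scale UNIV j = subs j"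
  by (simp add: dim_subspaces_def)

text \<open>Each \<open>H j\<close> contains a hyperplane of \<open>M\<close>, or all of
  \<open>M\<close>, so each intersection costs at most one dimension.\<close>

lemma dim_Int_family:
  assumes "finite J" and M: "subspace M" and X: "subspace X" "X \<subseteq> M"
    and H: "\<And>j. j \<in> J \<Longrightarrow> subspace (H j) \<and> dim M \<le> Suc (dim (H j \<inter> M))"
  shows "subspace (X \<inter> (\<Inter>j\<in>J. H j)) \<and> dim X \<le> dim (X \<inter> (\<Inter>j\<in>J. H j)) + card J"
  using assms(1) H
proof (induction J)
  case empty
  thus ?case using X by simp
next
  case (insert j J)
  define Y where "Y = X \<inter> (\<Inter>j\<in>J. H j)"
  have Y: "subspace Y" "dim X \<le> dim Y + card J" using insert unfolding Y_def by simp_all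
  have Hj: "subspace (H j)" "dim M \<le> Suc (dim (H j \<inter> M))" using insert.prems by simp_all
  have YM: "Y \<subseteq> M" using X by (auto simp: Y_def)
  have "dim Y + dim (H j \<inter> M) \<le> dim M + dim (Y \<inter> (H j \<inter> M))"
    using Y Hj M YM by (intro dim_Int_lower) auto
  moreover have "Y \<inter> (H j \<inter> M) = Y \<inter> H j" using YM by blast
  moreover have "X \<inter> (\<Inter>i\<in>insert j J. H i) = Y \<inter> H j" by (auto simp: Y_def)
  moreover have "card (insert j J) = Suc (card J)" using insert.hyps by simp
  ultimately show ?case using Y Hj by simp
qed

lemma dim_Inter_zero:
  assumes "\<And>v. v \<noteq> 0 \<Longrightarrow> \<exists>F\<in>\<A>. v \<notin> F" shows "dim (\<Inter>F\<in>\<A>. F) = 0"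
proof -
  have "(\<Inter>F\<in>\<A>. F) \<subseteq> {0}" using assms by blast
  thus ?thesis by simp
qed

lemma near_avoiding:
  assumes Z: "Z \<in> subs (Suc (Suc s))" and sk: "s < k" and n: "k < dim (UNIV :: 'b set)" and v: "v \<noteq> 0"
  shows "\<exists>F\<in>near s k Z. v \<notin> F"
proof -
  have sZ: "subspace Z" "dim Z = Suc (Suc s)" "{0} \<subseteq> Z" using Z subspace_0[of Z] by auto
  obtain T where T: "T \<in> between {0} Z (Suc s)" "v \<notin> T"
    by (rule between_avoiding[of "{0}" Z "Suc s" v]) (use sZ v in auto)
  hence sT: "subspace T" "dim T = Suc s" "T \<subseteq> Z" by (simp_all add: between_def)
  obtain F where F: "F \<in> between T UNIV k" "v \<notin> F"
    by (rule between_avoiding[of T UNIV k v]) (use sT sk n T in \<open>simp_all del: dim_UNIV\<close>)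
  have "dim T \<le> dim (F \<inter> Z)" using F sT by (intro dim_subset) (simp add: between_def)
  thus ?thesis using F sT by (intro bexI[of _ F]) (simp_all add: near_def between_def)
qed

text \<open>The extra part takes care of vectors in \<open>S\<close>, the main part of all
  others.\<close>

lemma main_extra_avoiding:
  assumes S: "S \<in> subs s" and M: "M \<in> subs (Suc k)" "S \<subseteq> M" and sk: "s < k"
    and n: "k < dim (UNIV :: 'b set)" and v: "v \<noteq> 0"
  shows "\<exists>F\<in>main_part s k S M \<union> extra_part k S M. v \<notin> F"
proof (cases "v \<in> S")
  case True
  have sM: "subspace M" "dim M = Suc k" "{0} \<subseteq> M" using M subspace_0[of M] by auto
  obtain F where F: "F \<in> between {0} M k" "v \<notin> F"
    by (rule between_avoiding[of "{0}" M k v]) (use sM v in auto)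
  hence "F \<in> extra_part k S M" using True by (auto simp: extra_part_def between_def)
  thus ?thesis using F(2) by blast
next
  case False
  have sM: "subspace S" "subspace M" "dim M = Suc k" "dim S = s" using M S by auto
  obtain T where T: "T \<in> between S M (Suc s)" "v \<notin> T"
    by (rule between_avoiding[of S M "Suc s" v]) (use sM M sk False in auto)
  hence sT: "subspace T" "dim T = Suc s" "T \<subseteq> M" "S \<subseteq> T" by (simp_all add: between_def)
  obtain F where F: "F \<in> between T UNIV k" "v \<notin> F"
    by (rule between_avoiding[of T UNIV k v]) (use sT sk n T in \<open>simp_all del: dim_UNIV\<close>)
  have F': "T \<subseteq> F" "subspace F" "dim F = k" using F by (simp_all add: between_def)
  have "dim T \<le> dim (F \<inter> M)" using F' sT by (intro dim_subset) simp
  moreover have "S \<subseteq> F" using F' sT by (rule_tac subset_trans)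
  ultimately have "F \<in> main_part s k S M" using F' sT by (simp add: main_part_def)
  thus ?thesis using F(2) by blast
qed

text \<open>Cutting \<open>Z\<close> with \<open>r\<close> members leaves dimension at least
  \<open>s + 2 - r = t\<close>.\<close>

lemma near_families:
  assumes Z: "Z \<in> subs (Suc (Suc s))" and sk: "s < k" and n: "k < dim (UNIV :: 'b set)"
    and t: "0 < t" "s + 2 = t + r"
  shows "nontrivial_cross_families scale r k t (\<lambda>_. near s k Z)"
proof -
  have sZ: "subspace Z" "dim Z = Suc (Suc s)" using Z by auto
  have av: "\<exists>F\<in>near s k Z. v \<notin> F" if "v \<noteq> 0" for v
    using near_avoiding[OF Z sk n that] .
  have "UNIV \<noteq> {0 :: 'b}"
  proof
    assume "UNIV = {0 :: 'b}"
    hence "dim (UNIV :: 'b set) = dim {0 :: 'b}" by simp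
    thus False using n by simp
  qed
  then obtain v :: 'b where "v \<noteq> 0" by blast
  hence ne: "near s k Z \<noteq> {}" using av by blast
  have "t \<le> dim (\<Inter>i\<in>{1..r}. F i)" if F: "\<And>i. i \<in> {1..r} \<Longrightarrow> F i \<in> near s k Z" for F
  proof -
    have "dim Z \<le> dim (Z \<inter> (\<Inter>i\<in>{1..r}. F i)) + card {1..r}"
      using dim_Int_family[of "{1..r}" Z Z F] F sZ by (simp add: near_def)
    moreover have "dim (Z \<inter> (\<Inter>i\<in>{1..r}. F i)) \<le> dim (\<Inter>i\<in>{1..r}. F i)" by (intro dim_subset) blast
    ultimately show ?thesis using t sZ by simp
  qed
  moreover have "near s k Z \<subseteq> subs k" by (auto simp: near_def)
  moreover have "dim (\<Inter>F\<in>near s k Z. F) < t" by (subst dim_Inter_zero[OF av]) (use t in simp_all)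
  ultimately show ?thesis using ne
    unfolding nontrivial_cross_families_def cross_intersecting_def dim_subspaces_UNIV by simp
qed

lemma main_extra_families:
  assumes S: "S \<in> subs s" and M: "M \<in> subs (Suc k)" "S \<subseteq> M" and sk: "s < k"
    and n: "k < dim (UNIV :: 'b set)" and t: "0 < t" "s + 2 = t + r"
  shows "nontrivial_cross_families scale r k t (\<lambda>_. main_part s k S M \<union> extra_part k S M)"
proof -
  let ?H = "main_part s k S M \<union> extra_part k S M"
  have s: "subspace S" "dim S = s" "subspace M" "dim M = Suc k" using S M by auto
  have av: "\<exists>F\<in>?H. v \<notin> F" if "v \<noteq> 0" for v
    using main_extra_avoiding[OF S M sk n that] .
  have "UNIV \<noteq> {0 :: 'b}"
  proof
    assume "UNIV = {0 :: 'b}"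
    hence "dim (UNIV :: 'b set) = dim {0 :: 'b}" by simp
    thus False using n by simp
  qed
  then obtain v :: 'b where "v \<noteq> 0" by blast
  hence ne: "?H \<noteq> {}" using av by blast
  have "t \<le> dim (\<Inter>i\<in>{1..r}. F i)" if F: "\<And>i. i \<in> {1..r} \<Longrightarrow> F i \<in> ?H" for F
  proof -
    let ?I = "\<Inter>i\<in>{1..r}. F i"
    define J where "J = {i\<in>{1..r}. \<not> S \<subseteq> F i}"
    have J: "finite J" "J \<subseteq> {1..r}" by (auto simp: J_def)
    hence cJ: "card J \<le> r" using card_mono[of "{1..r}" J] by simp
    have FJ: "subspace (F j) \<and> dim M \<le> Suc (dim (F j \<inter> M))" if "j \<in> J" for j
    proof -
      have "F j \<in> extra_part k S M" using F[of j] that by (auto simp: J_def main_part_def)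
      hence e: "F j \<in> subs k" "F j \<subseteq> M" by (auto simp: extra_part_def)
      hence "F j \<inter> M = F j" by blast
      thus ?thesis using e s by simp
    qed
    have key: "dim X \<le> dim ?I + card J" if X: "subspace X" "X \<subseteq> M" "\<And>i. i \<in> {1..r} - J \<Longrightarrow> X \<inter> (\<Inter>j\<in>J. F j) \<subseteq> F i" for X
    proof -
      have "X \<inter> (\<Inter>j\<in>J. F j) \<subseteq> ?I" using X(3) by blast
      hence "dim (X \<inter> (\<Inter>j\<in>J. F j)) \<le> dim ?I" by (rule dim_subset)
      thus ?thesis using dim_Int_family[of J M X F, OF J(1) s(3) X(1,2) FJ] by simp
    qed
    \<comment> \<open>The starting space depends on how many members miss \<open>S\<close>:
      \<open>S\<close> of dimension \<open>s\<close>, \<open>M\<close> of dimension at least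
      \<open>s + 2\<close>, or \<open>F l \<inter> M\<close> of dimension at least
      \<open>s + 1\<close>. In each case the \<open>card J\<close> cuts leave at least
      \<open>t\<close>.\<close>
    consider "card J + 2 \<le> r" | "J = {1..r}" | l where "l \<in> {1..r} - J" "r = card J + 1"
    proof (cases "J = {1..r}")
      case False
      then obtain l where l: "l \<in> {1..r} - J" using J by blast
      have "J \<subset> {1..r}" using False J by blast
      hence "card J < r" using psubset_card_mono[of "{1..r}" J] by simp
      thus thesis using that(1) that(3)[OF l] by linarith
    qed
    thus ?thesis
    proof cases
      case 1
      have "dim S \<le> dim ?I + card J" using s M by (intro key) (auto simp: J_def)
      thus ?thesis using 1 s t by simp
    next
      case 2
      have "dim M \<le> dim ?I + card J" using s by (intro key) (use 2 in auto)
      thus ?thesis using 2 s t sk by simp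
    next
      case 3
      have "\<not> F l \<in> extra_part k S M" using 3(1) by (auto simp: J_def extra_part_def)
      hence Fl: "F l \<in> main_part s k S M" using F 3(1) by blast
      have only: "i = l" if "i \<in> {1..r} - J" for i
      proof -
        have "card ({1..r} - J) = 1" using J 3 by (simp add: card_Diff_subset)
        then obtain x where "{1..r} - J = {x}" by (rule card_1_singletonE)
        thus ?thesis using that 3(1) by simp
      qed
      have sub: "(F l \<inter> M) \<inter> (\<Inter>j\<in>J. F j) \<subseteq> F i" if "i \<in> {1..r} - J" for i
        using only[OF that] by blast
      have "dim (F l \<inter> M) \<le> dim ?I + card J"
        by (rule key[OF _ _ sub]) (use Fl s in \<open>simp_all add: main_part_def\<close>)
      thus ?thesis using Fl 3 t by (simp add: main_part_def)
    qed
  qed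
  moreover have "?H \<subseteq> subs k" by (auto simp: main_part_def extra_part_def)
  moreover have "dim (\<Inter>F\<in>?H. F) < t" by (subst dim_Inter_zero[OF av]) (use t in simp_all)
  ultimately show ?thesis using ne
    unfolding nontrivial_cross_families_def cross_intersecting_def dim_subspaces_UNIV by simp
qed

text \<open>Written as a sum to avoid truncated subtraction. One-element sets \<open>I\<close> give
  \<open>s < k\<close>, two-element sets the cross-intersection in dimension
  \<open>s\<close>.\<close>

lemma cross_intersecting_subfamily:
  assumes nt: "nontrivial_cross_families scale r k t \<F>"
    and I: "I \<subseteq> {1..r}" "I \<noteq> {}" and F: "\<And>i. i \<in> I \<Longrightarrow> F i \<in> \<F> i"
  shows "t + r \<le> dim (\<Inter>i\<in>I. F i) + card I"
  using I F
proof (induction "r - card I" arbitrary: I F)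
  case 0
  have "card I \<le> r" using card_mono[of "{1..r}" I] 0 by simp
  hence "I = {1..r}" using 0 by (intro card_subset_eq) auto
  moreover have "t \<le> dim (\<Inter>i\<in>{1..r}. F i)"
    using nt 0(4) \<open>I = {1..r}\<close> unfolding nontrivial_cross_families_def cross_intersecting_def by blast
  ultimately show ?case by simp
next
  case (Suc d)
  define W where "W = (\<Inter>i\<in>I. F i)"
  have fin: "finite I" using Suc.prems(1) finite_subset by blast
  have lt: "card I < r" using Suc.hyps(2) by simp
  then obtain j where j: "j \<in> {1..r}" "j \<notin> I"
    using card_mono[OF fin, of "{1..r}"] by fastforce
  have Fj: "\<F> j \<subseteq> subs k" "\<F> j \<noteq> {}" "dim (\<Inter>F\<in>\<F> j. F) < t"
    using nt j unfolding nontrivial_cross_families_def dim_subspaces_UNIV by blast+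
  have sW: "subspace W"
  proof -
    have "F i \<in> subs k" if "i \<in> I" for i
      using nt Suc.prems that unfolding nontrivial_cross_families_def dim_subspaces_UNIV by blast
    thus ?thesis unfolding W_def by (intro subspace_Inter) auto
  qed
  have step: "t + r \<le> dim (W \<inter> K) + card I + 1" if K: "K \<in> \<F> j" for K
  proof -
    have ci: "card (insert j I) = Suc (card I)" using fin j by simp
    have "t + r \<le> dim (\<Inter>i\<in>insert j I. (F(j := K)) i) + card (insert j I)"
    proof (rule Suc.hyps(1))
      show "d = r - card (insert j I)" using Suc.hyps(2) ci by simp
      show "(F(j := K)) i \<in> \<F> i" if "i \<in> insert j I" for i using that K Suc.prems(3) by auto
    qed (use j Suc.prems in auto)
    moreover have "(\<Inter>i\<in>insert j I. (F(j := K)) i) = W \<inter> K"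
      using j unfolding W_def by (auto split: if_splits)
    ultimately show ?thesis using ci by simp
  qed
  show ?case
  proof (rule ccontr)
    assume "\<not> ?case"
    hence small: "dim W + card I < t + r" by (simp add: W_def)
    \<comment> \<open>By \<open>step\<close> and \<open>small\<close>, intersecting with
      \<open>K\<close> does not lower the dimension of \<open>W\<close>.\<close>
    have "W \<subseteq> K" if K: "K \<in> \<F> j" for K
      using sW Fj(1) K step[OF K] small by (intro subset_if_dim_Int) auto
    hence "W \<subseteq> (\<Inter>F\<in>\<F> j. F)" by blast
    hence "dim W \<le> dim (\<Inter>F\<in>\<F> j. F)" by (rule dim_subset)
    hence "dim W < t" using Fj(3) by (rule le_less_trans)
    \<comment> \<open>As \<open>card I < r\<close>, any single member already gives
      \<open>dim (W \<inter> K) \<ge> t\<close>.\<close>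
    obtain K where K: "K \<in> \<F> j" using Fj(2) by blast
    have "dim (W \<inter> K) \<le> dim W" by (rule dim_subset) (rule Int_lower1)
    with step[OF K] lt \<open>dim W < t\<close> show False by linarith
  qed
qed

lemma main_extra_eq:
  assumes "M \<in> subs (Suc k)"
  shows "main_part s k S M \<union> extra_part k S M =
    {F \<in> dim_subspaces scale UNIV k. S \<subseteq> F \<and> s + 1 \<le> dim (F \<inter> M)} \<union>
    {F \<in> dim_subspaces scale M k. \<not> S \<subseteq> F}"
  by (auto simp: main_part_def extra_part_def dim_subspaces_def)

lemma near_eq: "near s k Z = {F \<in> dim_subspaces scale UNIV k. s + 1 \<le> dim (F \<inter> Z)}"
  by (auto simp: near_def dim_subspaces_def)

text \<open>The value \<open>h\<close> has to serve as upper bound for pairs and also be attained by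
  an admissible constant tuple, so that maximality yields a product of at least
  \<open>h ^ r\<close>.\<close>

lemma extremal_size_exists:
  assumes sk: "2 \<le> s" "s < k" and n: "4 * k + 6 \<le> dim (UNIV :: 'b set)" and t: "0 < t" "s + 2 = t + r"
  obtains h \<G> where "extremal_size s k h" "nontrivial_cross_families scale r k t \<G>"
    "\<And>i. card (\<G> i) = h"
proof (cases "k \<le> 2 * s + 1")
  case True
  have s0: "subspace {0}" by (simp add: subspace_0)
  obtain Z where "Z \<in> between {0} UNIV (Suc (Suc s))"
    using exists_between[of "{0}" UNIV "Suc (Suc s)"] sk n by (auto simp del: dim_UNIV)
  hence Z: "Z \<in> subs (Suc (Suc s))" by (simp add: between_def)
  define h where "h = card (near s k Z)"
  have m: "max (Suc k - s) (Suc (Suc s)) = Suc (Suc s)" using True by simp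
  have "card (near s k Z') = h" if "Z' \<in> subs (Suc (Suc s))" for Z'
  proof -
    have "real (card (near s k Z')) = real h" unfolding h_def card_near[OF that] card_near[OF Z] ..
    thus ?thesis by simp
  qed
  hence "extremal_size s k h"
    unfolding extremal_size_def m using near_large[OF Z sk(2) n] True by (simp add: h_def)
  thus thesis using near_families[OF Z sk(2) _ t] n by (intro that[of h "\<lambda>_. near s k Z"]) (simp_all add: h_def)
next
  case False
  define H where "H = {card (main_part s k S M \<union> extra_part k S M) |S M.
    S \<in> subs s \<and> M \<in> subs (Suc k) \<and> S \<subseteq> M}"
  have fin: "finite H"
  proof -
    have "H \<subseteq> (\<lambda>(S, M). card (main_part s k S M \<union> extra_part k S M)) ` UNIV"
      unfolding H_def by auto
    moreover have "finite (UNIV :: ('b set \<times> 'b set) set)"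
      unfolding UNIV_Times_UNIV[symmetric] by (intro finite_cartesian_product finite_vec_sets)
    ultimately show ?thesis by (meson finite_imageI finite_subset)
  qed
  obtain S where S0: "S \<in> between {0} UNIV s"
    using exists_between[of "{0}" UNIV s] sk n by (auto simp: subspace_0 simp del: dim_UNIV)
  hence S: "S \<in> subs s" by (simp add: between_def)
  obtain M where "M \<in> between S UNIV (Suc k)"
    using exists_between[of S UNIV "Suc k"] S sk n by (auto simp del: dim_UNIV)
  hence "M \<in> subs (Suc k)" "S \<subseteq> M" by (simp_all add: between_def)
  hence ne: "H \<noteq> {}" using S unfolding H_def by blast
  define h where "h = Max H"
  have "h \<in> H" unfolding h_def by (rule Max_in[OF fin ne])
  then obtain S M where SM: "S \<in> subs s" "M \<in> subs (Suc k)" "S \<subseteq> M"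
    and h: "card (main_part s k S M \<union> extra_part k S M) = h" unfolding H_def by blast
  have "card (main_part s k S M \<union> extra_part k S M) \<le> h"
    if "S \<in> subs s" "M \<in> subs (Suc k)" "S \<subseteq> M" for S M
    unfolding h_def by (rule Max_ge[OF fin]) (use that in \<open>unfold H_def, blast\<close>)
  moreover have m: "max (Suc k - s) (Suc (Suc s)) = Suc k - s" using False by simp
  moreover have "card (main_part s k S M) \<le> h" unfolding h[symmetric] by (intro card_mono) auto
  hence "real (card (main_part s k S M)) \<le> real h" by simp
  note main_part_large[OF SM sk n this]
  ultimately have "extremal_size s k h" unfolding extremal_size_def m using False by simp
  thus thesis using main_extra_families[OF SM sk(2) _ t] n h
    by (intro that[of h "\<lambda>_. main_part s k S M \<union> extra_part k S M"]) simp_all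
qed

lemma nontrivial_cross_families_structure:
  assumes r: "3 \<le> r" and kt: "t + 1 \<le> k" "0 < t" and n: "4 * k + 6 \<le> dim (UNIV :: 'b set)"
    and nt: "nontrivial_cross_families scale r k t \<F>"
    and max: "\<forall>\<G>. nontrivial_cross_families scale r k t \<G> \<longrightarrow>
      (\<Prod>i=1..r. card (\<G> i)) \<le> (\<Prod>i=1..r. card (\<F> i))"
    and s: "s = t + r - 2"
  shows "s < k"
    and "k \<le> 2 * s + 1 \<Longrightarrow> \<exists>Z\<in>subs (Suc (Suc s)). \<forall>i\<in>{1..r}. \<F> i = near s k Z"
    and "2 * s + 1 < k \<Longrightarrow> \<exists>M\<in>subs (Suc k). \<exists>S\<in>subs s. S \<subseteq> M \<and>
      (\<forall>i\<in>{1..r}. \<F> i = main_part s k S M \<union> extra_part k S M)"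
proof -
  have Fi: "\<F> i \<subseteq> subs k" "\<F> i \<noteq> {}" "dim (\<Inter>F\<in>\<F> i. F) < t" if "i \<in> {1..r}" for i
    using nt that unfolding nontrivial_cross_families_def dim_subspaces_UNIV by blast+
  have s2: "2 \<le> s" "s + 2 = t + r" using s r kt by auto
  have 1: "(1::nat) \<in> {1..r}" using r by simp
  obtain F where F: "F \<in> \<F> 1" using Fi(2)[OF 1] by blast
  have "t + r \<le> dim (\<Inter>i\<in>{1::nat}. F) + card {1::nat}"
    by (rule cross_intersecting_subfamily[OF nt]) (use 1 F in auto)
  moreover have "dim F = k" using F Fi(1)[OF 1] by blast
  ultimately show sk: "s < k" using s2 by simp
  have cross: "s \<le> dim (F \<inter> G)" if "i \<in> {1..r}" "j \<in> {1..r}" "i \<noteq> j" "F \<in> \<F> i" "G \<in> \<F> j" for i j F G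
  proof -
    have "t + r \<le> dim (\<Inter>l\<in>{i, j}. if l = i then F else G) + card {i, j}"
      by (rule cross_intersecting_subfamily[OF nt]) (use that in auto)
    thus ?thesis using that(3) s2 by (simp add: Int_commute)
  qed
  \<comment> \<open>A common \<open>s\<close>-space is impossible because
    \<open>t \<le> s\<close>.\<close>
  have nontriv: "nontrivial s (\<F> i)" if "i \<in> {1..r}" for i
    unfolding nontrivial_def
  proof (rule ballI, rule ccontr)
    fix S assume S: "S \<in> subs s" and "\<not> (\<exists>G\<in>\<F> i. \<not> S \<subseteq> G)"
    hence "S \<subseteq> (\<Inter>F\<in>\<F> i. F)" by blast
    hence "dim S \<le> dim (\<Inter>F\<in>\<F> i. F)" by (rule dim_subset)
    hence "dim S < t" using Fi(3)[OF that] by (rule le_less_trans)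
    thus False using S s r by simp
  qed
  obtain h \<G> where h: "extremal_size s k h" and G: "nontrivial_cross_families scale r k t \<G>"
    "\<And>i. card (\<G> i) = h"
    using extremal_size_exists[OF s2(1) sk n kt(2) s2(2)] by metis
  have "\<G> 1 \<noteq> {}" using G(1) 1 unfolding nontrivial_cross_families_def by blast
  hence h0: "0 < h" using G(2)[of 1] by (metis card_gt_0_iff finite_vec_sets)
  have c: "card {1..r} = r" "finite {1..r}" by simp_all
  have prod: "h ^ card {1..r} \<le> (\<Prod>i=1..r. card (\<F> i))" using max[rule_format, OF G(1)] by (simp add: G(2))
  note ef = extremal_families[OF s2(1) sk n c(2) _ Fi(1) nontriv cross h h0 prod]
  show "\<exists>Z\<in>subs (Suc (Suc s)). \<forall>i\<in>{1..r}. \<F> i = near s k Z" if "k \<le> 2 * s + 1"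
    by (rule ef(1)) (use r that in simp_all)
  show "\<exists>M\<in>subs (Suc k). \<exists>S\<in>subs s. S \<subseteq> M \<and>
      (\<forall>i\<in>{1..r}. \<F> i = main_part s k S M \<union> extra_part k S M)" if "2 * s + 1 < k"
    by (rule ef(2)) (use r that in simp_all)
qed

end

text \<open>An infinite basis would have \<open>card\<close> 0, so positive \<open>dim\<close>
  yields a finite one.\<close>

lemma finite_vector_space_exists:
  fixes scale :: "'a::{field,finite} \<Rightarrow> 'b::ab_group_add \<Rightarrow> 'b"
  assumes "vector_space scale" and d: "vector_space.dim scale (UNIV :: 'b set) > 0"
  shows "\<exists>B. finite_vector_space scale B (card (UNIV :: 'a set))"
proof -
  interpret vector_space scale by (rule assms(1))
  obtain B where B: "B \<subseteq> (UNIV :: 'b set)" "independent B" "UNIV \<subseteq> span B" "card B = dim (UNIV :: 'b set)"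
    by (rule basis_exists)
  have "finite B" using B d by (metis card.infinite less_irrefl)
  moreover have "card {0, 1::'a} \<le> card (UNIV :: 'a set)" by (intro card_mono) auto
  ultimately have "finite_vector_space scale B (card (UNIV :: 'a set))"
    using B by unfold_locales auto
  thus ?thesis ..
qed

theorem theorem1p4:
  fixes scale :: "'a::{field,finite} \<Rightarrow> 'b::ab_group_add \<Rightarrow> 'b"
    and n r k t :: nat
    and \<F> :: "nat \<Rightarrow> 'b set set"
  assumes "vector_space scale"
    and "vector_space.dim scale (UNIV :: 'b set) = n"
    and "n > 0" "r > 0" "k > 0" "t > 0"
    and "r \<ge> 3" and "k \<ge> t + 1" and "n \<ge> 4 * k + 6"
    and "nontrivial_cross_families scale r k t \<F>"
    and "\<And>\<G>. nontrivial_cross_families scale r k t \<G> \<Longrightarrow>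
               (\<Prod>i=1..r. card (\<G> i)) \<le> (\<Prod>i=1..r. card (\<F> i))"
  shows "r \<le> k - t + 1 \<and>
    (k > 2 * t + 2 * r - 3 \<longrightarrow>
      (\<exists>M \<in> dim_subspaces scale UNIV (k + 1).
       \<exists>T \<in> dim_subspaces scale M (t + r - 2).
       \<forall>i\<in>{1..r}. \<F> i =
         {F \<in> dim_subspaces scale UNIV k.
            T \<subseteq> F \<and> vector_space.dim scale (F \<inter> M) \<ge> t + r - 1} \<union>
         {F \<in> dim_subspaces scale M k. \<not> T \<subseteq> F})) \<and>
    (k \<le> 2 * t + 2 * r - 3 \<longrightarrow>
      (\<exists>Z \<in> dim_subspaces scale UNIV (t + r).
       \<forall>i\<in>{1..r}. \<F> i =
         {F \<in> dim_subspaces scale UNIV k.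
            vector_space.dim scale (F \<inter> Z) \<ge> t + r - 1}))"
proof -
  obtain B where "finite_vector_space scale B (card (UNIV :: 'a set))"
    using finite_vector_space_exists[OF assms(1)] assms(2,3) by auto
  then interpret finite_vector_space scale B "card (UNIV :: 'a set)" .
  define s where "s = t + r - 2"
  have n: "4 * k + 6 \<le> dim (UNIV :: 'b set)" using assms(2,9) by simp
  have "\<forall>\<G>. nontrivial_cross_families scale r k t \<G> \<longrightarrow>
      (\<Prod>i=1..r. card (\<G> i)) \<le> (\<Prod>i=1..r. card (\<F> i))"
    using assms(11) by blast
  note st = nontrivial_cross_families_structure[OF assms(7,8,6) n assms(10) this s_def]
  \<comment> \<open>Since \<open>t + r\<close> is at least 4, none of these subtractions is
    truncated.\<close>
  have e: "s + 1 = t + r - 1" "Suc (Suc s) = t + r" "2 * s + 1 = 2 * t + 2 * r - 3"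
    using assms(6,7) by (simp_all add: s_def)
  show ?thesis
  proof (intro conjI impI)
    have "s < k" by (rule st(1))
    thus "r \<le> k - t + 1" using assms(6-8) by (simp add: s_def)
    assume k: "k > 2 * t + 2 * r - 3"
    obtain M S where MS: "M \<in> subs (Suc k)" "S \<in> subs s" "S \<subseteq> M"
      and F: "\<forall>i\<in>{1..r}. \<F> i = main_part s k S M \<union> extra_part k S M"
      using st(3)[unfolded e(3), OF k] by (elim bexE conjE)
    show "\<exists>M \<in> dim_subspaces scale UNIV (k + 1). \<exists>T \<in> dim_subspaces scale M (t + r - 2).
       \<forall>i\<in>{1..r}. \<F> i = {F \<in> dim_subspaces scale UNIV k. T \<subseteq> F \<and> dim (F \<inter> M) \<ge> t + r - 1} \<union>
         {F \<in> dim_subspaces scale M k. \<not> T \<subseteq> F}"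
      using F unfolding main_extra_eq[OF MS(1)] e(1)
      by (intro bexI[of _ M] bexI[of _ S])
         (use MS in \<open>simp_all add: dim_subspaces_def s_def\<close>)
  next
    assume k: "k \<le> 2 * t + 2 * r - 3"
    obtain Z where Z: "Z \<in> subs (Suc (Suc s))" and F: "\<forall>i\<in>{1..r}. \<F> i = near s k Z"
      using st(2)[unfolded e(3), OF k] by (elim bexE)
    show "\<exists>Z \<in> dim_subspaces scale UNIV (t + r). \<forall>i\<in>{1..r}. \<F> i =
         {F \<in> dim_subspaces scale UNIV k. dim (F \<inter> Z) \<ge> t + r - 1}"
      using F Z unfolding near_eq e(1,2) dim_subspaces_UNIV by (intro bexI[of _ Z])
  qed
qed

end
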